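(* Let $A_0$ be a Dedekind domain with fraction field $K_0$, $Y=\operatorname{Spec}A_0$, and $\sigma\subset N_{\mathbb{Q}}$ a strongly convex polyhedral cone. (i) For every $\sigma$-polyhedral divisor $\mathfrak{D}$ over $A_0$, the ring $A_0[\mathfrak{D}]$ is normal, noetherian, and has the same fraction field as $K_0[M]$. (ii) Conversely, let $A=\bigoplus_{m\in\sigma^\vee\cap M}A_m\chi^m\subset K_0[M]$ be a normal noetherian $M$-graded subalgebra with $A_m\subset K_0$ for all $m$, degree-zero part $A_0$, weight cone $\sigma^\vee$, and same fraction field as $K_0[M]$. Then there exists a unique $\sigma$-polyhedral divisor $\mathfrak{D}$ over $A_0$ with $A=A_0[\mathfrak{D}]$. (iii) Explicitly, let $f=(f_1\chi^{m_1},\dots,f_r\chi^{m_r})$ with $f_i\in K_0^*$ and $m_1,\dots,m_r$ nonzero vectors generating the lattice $M$, and let $\sigma$ be the dual of the cone generated by the $m_i$. Then the normalization of $A_0[f_1\chi^{m_1},\dots,f_r\chi^{m_r}]$ is $A_0[\mathfrak{D}[f]]$, where $\mathfrak{D}[f]=\sum_{z}\Delta_z[f]\cdot z$ with $\Delta_z[f]=\{v\in N_{\mathbb{Q}}:\langle m_i,v\rangle\ge-\operatorname{ord}_zf_i,\ i=1,\dots,r\}$.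
   Context: $M,N$ are dual lattices of finite rank, $M_{\mathbb{Q}},N_{\mathbb{Q}}$ the associated $\mathbb{Q}$-spaces; $K_0[M]=\bigoplus_{m\in M}K_0\chi^m$ with $\chi^m\chi^{m'}=\chi^{m+m'}$. A Dedekind domain is a noetherian integrally closed domain, not a field, in which nonzero primes are maximal. Let $Z$ be the set of closed points of $Y$. A $\sigma$-polyhedron is $Q+\sigma$ with $Q$ a polytope; $h_\Delta(m)=\min_{v\in\Delta}\langle m,v\rangle$. A $\sigma$-polyhedral divisor over $A_0$ is a formal sum $\mathfrak{D}=\sum_{z\in Z}\Delta_z\cdot z$ of $\sigma$-polyhedra with $\Delta_z=\sigma$ for almost all $z$; its evaluation at $m\in\sigma^\vee$ is the rational Weil divisor $\mathfrak{D}(m)=\sum_z h_{\Delta_z}(m)z$, and $A_0[\mathfrak{D}]=\bigoplus_{m\in\sigma^\vee\cap M}H^0(Y,\mathcal{O}_Y(\lfloor\mathfrak{D}(m)\rfloor))\chi^m\subset K_0[M]$, where $H^0(Y,\mathcal{O}_Y(\lfloor D\rfloor))=\{g\in K_0^*:\operatorname{div}g+\lfloor D\rfloor\ge0\}\cup\{0\}$. *)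

theory Defs
  imports "HOL-Library.Poly_Mapping" "HOL-Library.Extended_Real"
          "HOL-Analysis.Finite_Cartesian_Product"
begin

definition subring_set :: "'a::comm_ring_1 set \<Rightarrow> bool" where
  "subring_set R \<longleftrightarrow> 0 \<in> R \<and> 1 \<in> R \<and> (\<forall>x\<in>R. \<forall>y\<in>R. x + y \<in> R \<and> x * y \<in> R \<and> - x \<in> R)"

definition ideal_in :: "'a::comm_ring_1 set \<Rightarrow> 'a set \<Rightarrow> bool" where
  "ideal_in R I \<longleftrightarrow> I \<subseteq> R \<and> 0 \<in> I \<and> (\<forall>x\<in>I. \<forall>y\<in>I. x + y \<in> I)
     \<and> (\<forall>a\<in>R. \<forall>x\<in>I. a * x \<in> I)"

definition prime_in :: "'a::comm_ring_1 set \<Rightarrow> 'a set \<Rightarrow> bool" where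
  "prime_in R P \<longleftrightarrow> ideal_in R P \<and> P \<noteq> R \<and> (\<forall>a\<in>R. \<forall>b\<in>R. a * b \<in> P \<longrightarrow> a \<in> P \<or> b \<in> P)"

definition maximal_in :: "'a::comm_ring_1 set \<Rightarrow> 'a set \<Rightarrow> bool" where
  "maximal_in R P \<longleftrightarrow> ideal_in R P \<and> P \<noteq> R \<and> (\<forall>J. ideal_in R J \<and> P \<subseteq> J \<longrightarrow> J = P \<or> J = R)"

definition gen_ideal :: "'a::comm_ring_1 set \<Rightarrow> 'a set \<Rightarrow> 'a set" where
  "gen_ideal R S = {\<Sum>s\<in>G. c s * s | G c. finite G \<and> G \<subseteq> S \<and> (\<forall>s\<in>G. c s \<in> R)}"

definition noetherian_set :: "'a::comm_ring_1 set \<Rightarrow> bool" where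
  "noetherian_set R \<longleftrightarrow> (\<forall>I. ideal_in R I \<longrightarrow> (\<exists>G. finite G \<and> G \<subseteq> I \<and> I = gen_ideal R G))"

text \<open>The fraction p/q (p, q in R, q nonzero) is integral over R: it satisfies a monic
  equation, cleared of denominators.\<close>
definition frac_integral :: "'a::comm_ring_1 set \<Rightarrow> 'a \<Rightarrow> 'a \<Rightarrow> bool" where
  "frac_integral R p q \<longleftrightarrow> (\<exists>n c. (\<forall>i<n. c i \<in> R) \<and>
      p ^ n + (\<Sum>i<n. c i * p ^ i * q ^ (n - i)) = 0)"

text \<open>Normal (integrally closed in its fraction field): every element p/q of the fraction
  field which is integral over R lies in R, i.e. q divides p in R.\<close>
definition normal_set :: "'a::comm_ring_1 set \<Rightarrow> bool" where
  "normal_set R \<longleftrightarrow> (\<forall>p\<in>R. \<forall>q\<in>R. q \<noteq> 0 \<and> frac_integral R p q \<longrightarrow> (\<exists>a\<in>R. p = q * a))"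

definition dedekind_set :: "'k::field set \<Rightarrow> bool" where
  "dedekind_set A \<longleftrightarrow> subring_set A \<and> noetherian_set A \<and> normal_set A
     \<and> (\<exists>a\<in>A. a \<noteq> 0 \<and> inverse a \<notin> A)
     \<and> (\<forall>P. prime_in A P \<and> P \<noteq> {0} \<longrightarrow> maximal_in A P)"

definition closed_pts :: "'k::field set \<Rightarrow> 'k set set" where
  "closed_pts A = {P. maximal_in A P}"

fun idpow :: "'a::comm_ring_1 set \<Rightarrow> 'a set \<Rightarrow> nat \<Rightarrow> 'a set" where
  "idpow R P 0 = R"
| "idpow R P (Suc n) = gen_ideal R {x * y | x y. x \<in> P \<and> y \<in> idpow R P n}"

definition ord_ring :: "'a::comm_ring_1 set \<Rightarrow> 'a set \<Rightarrow> 'a \<Rightarrow> nat" where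
  "ord_ring R P a = (GREATEST n. a \<in> idpow R P n)"

definition ord_at :: "'k::field set \<Rightarrow> 'k set \<Rightarrow> 'k \<Rightarrow> int" where
  "ord_at A z f = (case (SOME (a, b). a \<in> A \<and> b \<in> A \<and> b \<noteq> 0 \<and> f = a / b) of
      (a, b) \<Rightarrow> int (ord_ring A z a) - int (ord_ring A z b))"

text \<open>M = int^'n, N_Q = M_Q = rat^'n.\<close>
definition pairing :: "int^'n::finite \<Rightarrow> rat^'n \<Rightarrow> rat" where
  "pairing m v = (\<Sum>i\<in>UNIV. of_int (m $ i) * v $ i)"

definition pairQ :: "rat^'n::finite \<Rightarrow> rat^'n \<Rightarrow> rat" where
  "pairQ u v = (\<Sum>i\<in>UNIV. u $ i * v $ i)"

definition toQ :: "int^'n::finite \<Rightarrow> rat^'n" where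
  "toQ m = (\<chi> i. of_int (m $ i))"

definition cone_gen :: "(rat^'n::finite) set \<Rightarrow> (rat^'n) set" where
  "cone_gen S = {(\<chi> i. \<Sum>s\<in>F. c s * s $ i) | F c. finite F \<and> F \<subseteq> S \<and> (\<forall>s\<in>F. c s \<ge> 0)}"

definition polyhedral_cone :: "(rat^'n::finite) set \<Rightarrow> bool" where
  "polyhedral_cone \<sigma> \<longleftrightarrow> (\<exists>F. finite F \<and> \<sigma> = cone_gen F)"

definition strongly_convex :: "(rat^'n::finite) set \<Rightarrow> bool" where
  "strongly_convex \<sigma> \<longleftrightarrow> (\<forall>v. v \<in> \<sigma> \<and> - v \<in> \<sigma> \<longrightarrow> v = 0)"

definition dualQ :: "(rat^'n::finite) set \<Rightarrow> (rat^'n) set" where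
  "dualQ \<sigma> = {u. \<forall>v\<in>\<sigma>. pairQ u v \<ge> 0}"

definition dualM :: "(rat^'n::finite) set \<Rightarrow> (int^'n) set" where
  "dualM \<sigma> = {m. \<forall>v\<in>\<sigma>. pairing m v \<ge> 0}"

definition dualN :: "(rat^'n::finite) set \<Rightarrow> (rat^'n) set" where
  "dualN C = {v. \<forall>u\<in>C. pairQ u v \<ge> 0}"

definition polytope_hull :: "(rat^'n::finite) set \<Rightarrow> (rat^'n) set" where
  "polytope_hull V = {(\<chi> i. \<Sum>w\<in>V. c w * w $ i) | c. (\<forall>w\<in>V. c w \<ge> 0) \<and> (\<Sum>w\<in>V. c w) = 1}"

definition sigma_polyhedron :: "(rat^'n::finite) set \<Rightarrow> (rat^'n) set \<Rightarrow> bool" where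
  "sigma_polyhedron \<sigma> \<Delta> \<longleftrightarrow> (\<exists>V. finite V \<and> V \<noteq> {} \<and> \<Delta> = {p + s | p s. p \<in> polytope_hull V \<and> s \<in> \<sigma>})"

text \<open>h_Delta(m) = min over Delta (as an infimum in the extended reals; min of the empty set is +oo)\<close>
definition hmin :: "(rat^'n::finite) set \<Rightarrow> int^'n \<Rightarrow> ereal" where
  "hmin \<Delta> m = Inf ((\<lambda>v. ereal (of_rat (pairing m v))) ` \<Delta>)"

definition efloor :: "ereal \<Rightarrow> ereal" where
  "efloor x = (case x of ereal r \<Rightarrow> ereal (of_int \<lfloor>r\<rfloor>) | PInfty \<Rightarrow> \<infinity> | MInfty \<Rightarrow> - \<infinity>)"

text \<open>A formal sum sum_z Delta_z z over the closed points is represented by z |-> Delta_z.\<close>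
definition poly_divisor :: "'k::field set \<Rightarrow> (rat^'n::finite) set \<Rightarrow> ('k set \<Rightarrow> (rat^'n) set) \<Rightarrow> bool" where
  "poly_divisor A \<sigma> D \<longleftrightarrow> (\<forall>z\<in>closed_pts A. sigma_polyhedron \<sigma> (D z))
      \<and> finite {z\<in>closed_pts A. D z \<noteq> \<sigma>}"

text \<open>H^0(Y, O(floor(D(m)))) = {g in K0^*: div g + floor(D(m)) >= 0} u {0}\<close>
definition sections :: "'k::field set \<Rightarrow> ('k set \<Rightarrow> (rat^'n::finite) set) \<Rightarrow> int^'n \<Rightarrow> 'k set" where
  "sections A D m = {g. g = 0 \<or> (\<forall>z\<in>closed_pts A.
       ereal (of_int (ord_at A z g)) + efloor (hmin (D z) m) \<ge> 0)}"

text \<open>K0[M] is the type of finitely supported maps int^n to k; chi^m with coefficient c is Poly_Mapping.single m c.\<close>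
definition algD :: "'k::field set \<Rightarrow> (rat^'n::finite) set \<Rightarrow> ('k set \<Rightarrow> (rat^'n) set)
     \<Rightarrow> (int^'n \<Rightarrow>\<^sub>0 'k) set" where
  "algD A \<sigma> D = {f. \<forall>m. (m \<notin> dualM \<sigma> \<longrightarrow> Poly_Mapping.lookup f m = 0)
                         \<and> (m \<in> dualM \<sigma> \<longrightarrow> Poly_Mapping.lookup f m \<in> sections A D m)}"

definition same_frac :: "(int^'n::finite \<Rightarrow>\<^sub>0 'k::field) set \<Rightarrow> bool" where
  "same_frac A \<longleftrightarrow> (\<forall>x. \<exists>a\<in>A. \<exists>b\<in>A. b \<noteq> 0 \<and> b * x = a)"

definition gen_subring :: "'a::comm_ring_1 set \<Rightarrow> 'a set" where
  "gen_subring S = \<Inter>{R. subring_set R \<and> S \<subseteq> R}"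

definition is_normalization :: "'a::comm_ring_1 set \<Rightarrow> 'a set \<Rightarrow> bool" where
  "is_normalization B C \<longleftrightarrow>
     (\<forall>x\<in>C. \<exists>p\<in>B. \<exists>q\<in>B. q \<noteq> 0 \<and> q * x = p \<and> frac_integral B p q)
   \<and> (\<forall>p\<in>B. \<forall>q\<in>B. q \<noteq> 0 \<and> frac_integral B p q \<longrightarrow> (\<exists>x\<in>C. q * x = p))"

end

(*
  For v in N_Q and a closed point z, the function min_m (ord_z f_m + <m, v>) is a valuation on K0[M]
  by Gauss' lemma, and A0[D] is cut out in K0[M] by such valuations; as K0[M] is integrally closed,
  A0[D] is normal.

  Let B be generated over A0 by monomials f_i chi^(m_i) whose degrees generate M. Farkas' lemma writes
  every g chi^m in A0[D[f]], locally at z, as m = sum l_i m_i with rational l_i >= 0 and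
  sum l_i ord_z f_i <= ord_z g. Rounding the l_i down costs only a bounded error, so a single nonzero
  d in B satisfies d A0[D[f]] <= B. Since B is noetherian by Hilbert's basis theorem, A0[D[f]] is
  integral over B, which is (iii). In (i) the same argument applied to generators of the cones
  {(m, c). h_z(m) + c >= 0} embeds A0[D] as an ideal d A0[D] of a noetherian ring B. In (ii), a
  noetherian graded algebra is generated by finitely many monomials, so (iii) gives the divisor; it is
  unique because a point outside D_z is separated from D_z by a section.
*)
theory Submission
  imports Defs "HOL-Computational_Algebra.Polynomial"
begin

section \<open>Ideals and Noetherian rings\<close>

text \<open>Normality speaks about quotients of elements of K0[M], whose fraction field is never
  formed. A valuation can be applied to an integral quotient only once this is known to be a Laurent
  polynomial, and monic equations do not pass to leading coefficients. Almost integrality does: the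
  condition that q^n divides d p^n is multiplicative. Hence K0[M] is shown to be completely
  integrally closed, by induction on the variables.

  Orders are defined by powers of an ideal and a chosen fraction. An element t outside A0 with t z
  inside A0 yields a uniformizer; localizations are replaced throughout by explicit denominators
  outside z.

  Integral closures of noetherian domains need not be finite, so neither (i) nor (iii) can rest on
  that. The common denominator works because rounding leaves only lattice points of a bounded
  region, and only finitely many z carry a nonzero order of some f_i.

  The polyhedra of (iii) may be empty; then z imposes no condition, and Farkas' lemma is set up to
  cover this. In (ii) an empty polyhedron would produce, by the same lemma, a constant of A with a
  pole at z, contrary to the degree-zero part A0.\<close>

lemma subring_0: "subring_set R \<Longrightarrow> 0 \<in> R"
  and subring_1: "subring_set R \<Longrightarrow> 1 \<in> R"
  and subring_add: "subring_set R \<Longrightarrow> x \<in> R \<Longrightarrow> y \<in> R \<Longrightarrow> x + y \<in> R"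
  and subring_mult: "subring_set R \<Longrightarrow> x \<in> R \<Longrightarrow> y \<in> R \<Longrightarrow> x * y \<in> R"
  and subring_uminus: "subring_set R \<Longrightarrow> x \<in> R \<Longrightarrow> - x \<in> R"
  by (auto simp: subring_set_def)

lemma subring_diff: "subring_set R \<Longrightarrow> x \<in> R \<Longrightarrow> y \<in> R \<Longrightarrow> x - y \<in> R"
  using subring_add[of R x "- y"] subring_uminus[of R y] by simp

lemma subring_power: "subring_set R \<Longrightarrow> x \<in> R \<Longrightarrow> x ^ n \<in> R"
  by (induction n) (auto intro: subring_1 subring_mult)

lemma subring_sum: "subring_set R \<Longrightarrow> (\<And>i. i \<in> I \<Longrightarrow> f i \<in> R) \<Longrightarrow> (\<Sum>i\<in>I. f i) \<in> R"
  by (induction I rule: infinite_finite_induct) (auto intro: subring_0 subring_add)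

lemma subring_prod: "subring_set R \<Longrightarrow> (\<And>i. i \<in> I \<Longrightarrow> f i \<in> R) \<Longrightarrow> (\<Prod>i\<in>I. f i) \<in> R"
  by (induction I rule: infinite_finite_induct) (auto intro: subring_1 subring_mult)

lemma subring_of_nat: "subring_set R \<Longrightarrow> of_nat n \<in> R"
  by (induction n) (auto intro: subring_0 subring_1 subring_add)

lemma subring_Inter: "(\<And>R. R \<in> \<R> \<Longrightarrow> subring_set R) \<Longrightarrow> subring_set (\<Inter>\<R>)"
  unfolding subring_set_def by blast

lemmas subring_intros = subring_0 subring_1 subring_add subring_mult subring_uminus
  subring_diff subring_power subring_sum subring_prod subring_of_nat

lemma ideal_0: "ideal_in R I \<Longrightarrow> 0 \<in> I"
  and ideal_add: "ideal_in R I \<Longrightarrow> x \<in> I \<Longrightarrow> y \<in> I \<Longrightarrow> x + y \<in> I"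
  and ideal_mult: "ideal_in R I \<Longrightarrow> a \<in> R \<Longrightarrow> x \<in> I \<Longrightarrow> a * x \<in> I"
  and ideal_mult_right: "ideal_in R I \<Longrightarrow> a \<in> R \<Longrightarrow> x \<in> I \<Longrightarrow> x * a \<in> I"
  and ideal_subset: "ideal_in R I \<Longrightarrow> x \<in> I \<Longrightarrow> x \<in> R"
  by (auto simp: ideal_in_def mult.commute)

lemma ideal_uminus: "subring_set R \<Longrightarrow> ideal_in R I \<Longrightarrow> x \<in> I \<Longrightarrow> - x \<in> I"
  using ideal_mult[of R I "- 1" x] subring_1[of R] subring_uminus[of R 1] by simp

lemma ideal_diff: "subring_set R \<Longrightarrow> ideal_in R I \<Longrightarrow> x \<in> I \<Longrightarrow> y \<in> I \<Longrightarrow> x - y \<in> I"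
  using ideal_add[of R I x "- y"] ideal_uminus[of R I y] by simp

lemma ideal_sum: "ideal_in R I \<Longrightarrow> (\<And>i. i \<in> S \<Longrightarrow> f i \<in> I) \<Longrightarrow> (\<Sum>i\<in>S. f i) \<in> I"
  by (induction S rule: infinite_finite_induct) (auto intro: ideal_0 ideal_add)

lemma ideal_one_iff: "subring_set R \<Longrightarrow> ideal_in R I \<Longrightarrow> 1 \<in> I \<longleftrightarrow> I = R"
  unfolding ideal_in_def subring_set_def by (metis mult.right_neutral subset_antisym subsetI)

text \<open>\<open>J\<close> is an additively closed set rather than an ideal of \<open>R\<close>,
  so that one induction serves for preimages under a homomorphism and for images of a multiplication
  map.\<close>

lemma gen_ideal_least:
  assumes "0 \<in> J" and "\<And>x y. x \<in> J \<Longrightarrow> y \<in> J \<Longrightarrow> x + y \<in> J"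
    and "\<And>a x. a \<in> R \<Longrightarrow> x \<in> S \<Longrightarrow> a * x \<in> J"
  shows "gen_ideal R S \<subseteq> J"
proof -
  have "(\<Sum>s\<in>G. c s * s) \<in> J" if "finite G" "G \<subseteq> S" "\<forall>s\<in>G. c s \<in> R" for G c
    using that by (induction G rule: finite_induct) (auto intro: assms)
  then show ?thesis by (auto simp: gen_ideal_def)
qed

lemma gen_ideal_mult_mem:
  assumes "a \<in> R" "s \<in> S"
  shows "a * s \<in> gen_ideal R S"
  unfolding gen_ideal_def using assms by (intro CollectI exI[of _ "{s}"] exI[of _ "\<lambda>_. a"]) auto

lemma gen_ideal_mem: "subring_set R \<Longrightarrow> s \<in> S \<Longrightarrow> s \<in> gen_ideal R S"
  using gen_ideal_mult_mem[of 1 R s S] subring_1[of R] by simp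

lemma gen_ideal_add:
  assumes R: "subring_set R" and "x \<in> gen_ideal R S" "y \<in> gen_ideal R S"
  shows "x + y \<in> gen_ideal R S"
proof -
  obtain G c where G: "finite G" "G \<subseteq> S" "\<forall>s\<in>G. c s \<in> R" "x = (\<Sum>s\<in>G. c s * s)"
    using assms(2) by (auto simp: gen_ideal_def)
  obtain H d where H: "finite H" "H \<subseteq> S" "\<forall>s\<in>H. d s \<in> R" "y = (\<Sum>s\<in>H. d s * s)"
    using assms(3) by (auto simp: gen_ideal_def)
  define c' where "c' s = (if s \<in> G then c s else 0)" for s
  define d' where "d' s = (if s \<in> H then d s else 0)" for s
  have x: "x = (\<Sum>s\<in>G \<union> H. c' s * s)" unfolding G(4)
    by (rule sum.mono_neutral_cong_left) (auto simp: c'_def G H)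
  have y: "y = (\<Sum>s\<in>G \<union> H. d' s * s)" unfolding H(4)
    by (rule sum.mono_neutral_cong_left) (auto simp: d'_def G H)
  have "x + y = (\<Sum>s\<in>G \<union> H. (c' s + d' s) * s)"
    by (simp add: x y sum.distrib distrib_right)
  moreover have "\<forall>s\<in>G \<union> H. c' s + d' s \<in> R"
    using G H R by (auto simp: c'_def d'_def intro!: subring_intros)
  ultimately show ?thesis unfolding gen_ideal_def
    using G H by (intro CollectI exI[of _ "G \<union> H"] exI[of _ "\<lambda>s. c' s + d' s"]) auto
qed

lemma gen_ideal_0: "0 \<in> gen_ideal R S"
  unfolding gen_ideal_def by (intro CollectI exI[of _ "{}"]) auto

lemma gen_ideal_mult:
  assumes R: "subring_set R" and "x \<in> gen_ideal R S" "a \<in> R"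
  shows "a * x \<in> gen_ideal R S"
proof -
  obtain G c where G: "finite G" "G \<subseteq> S" "\<forall>s\<in>G. c s \<in> R" "x = (\<Sum>s\<in>G. c s * s)"
    using assms(2) by (auto simp: gen_ideal_def)
  have "a * x = (\<Sum>s\<in>G. (a * c s) * s)" by (simp add: G sum_distrib_left mult.assoc)
  then show ?thesis unfolding gen_ideal_def
    using G R assms(3)
    by (intro CollectI exI[of _ "G"] exI[of _ "\<lambda>s. a * c s"]) (auto intro: subring_intros)
qed

lemma gen_ideal_ideal:
  assumes "subring_set R" "S \<subseteq> R"
  shows "ideal_in R (gen_ideal R S)"
proof -
  have "gen_ideal R S \<subseteq> R"
    using assms by (intro gen_ideal_least) (auto simp: subring_set_def)
  then show ?thesis
    using assms unfolding ideal_in_def by (simp add: gen_ideal_0 gen_ideal_add gen_ideal_mult)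
qed

lemma gen_ideal_subset: "ideal_in R I \<Longrightarrow> S \<subseteq> I \<Longrightarrow> gen_ideal R S \<subseteq> I"
  by (rule gen_ideal_least) (auto simp: ideal_in_def)

lemma gen_ideal_mono: "S \<subseteq> T \<Longrightarrow> gen_ideal R S \<subseteq> gen_ideal R T"
  unfolding gen_ideal_def by blast

text \<open>\<open>gen_ideal\<close> sums over a set of generators, while a sequence may repeat
  values; here the coefficients are indexed by position.\<close>

lemma gen_ideal_image_lessThan:
  fixes x :: "nat \<Rightarrow> 'a::comm_ring_1"
  assumes R: "subring_set R" and "y \<in> gen_ideal R (x ` {..<N})"
  obtains c where "\<And>i. i < N \<Longrightarrow> c i \<in> R" "y = (\<Sum>i<N. c i * x i)"
proof -
  define J where "J = {\<Sum>i<N. c i * x i | c. \<forall>i<N. c i \<in> R}"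
  have "gen_ideal R (x ` {..<N}) \<subseteq> J"
  proof (rule gen_ideal_least)
    show "0 \<in> J" unfolding J_def using R
      by (intro CollectI exI[of _ "\<lambda>_. 0"]) (auto intro: subring_intros)
    show "u + v \<in> J" if uv: "u \<in> J" "v \<in> J" for u v
    proof -
      obtain c d where "u = (\<Sum>i<N. c i * x i)" "v = (\<Sum>i<N. d i * x i)"
        "\<forall>i<N. c i \<in> R" "\<forall>i<N. d i \<in> R" using uv unfolding J_def by blast
      then show ?thesis unfolding J_def using R
        by (intro CollectI exI[of _ "\<lambda>i. c i + d i"])
          (auto simp: sum.distrib distrib_right intro: subring_intros)
    qed
    show "a * u \<in> J" if au: "a \<in> R" "u \<in> x ` {..<N}" for a u
    proof -
      obtain k where k: "k < N" "u = x k" using au by auto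
      have "(\<Sum>i<N. (if i = k then a else 0) * x i) = (\<Sum>i<N. if i = k then a * x i else 0)"
        by (intro sum.cong) auto
      also have "\<dots> = a * x k" using k(1) by (subst sum.delta) auto
      finally show ?thesis unfolding J_def using R au k
        by (intro CollectI exI[of _ "\<lambda>i. if i = k then a else 0"]) (auto intro: subring_intros)
    qed
  qed
  then show ?thesis using assms(2) that unfolding J_def by blast
qed

section \<open>Chain conditions and maximal ideals\<close>

lemma noetherian_finite_basis:
  assumes "noetherian_set R" "ideal_in R I"
  obtains G where "finite G" "G \<subseteq> I" "I = gen_ideal R G"
  using assms unfolding noetherian_set_def by blast

lemma noetherian_chain:
  fixes I :: "nat \<Rightarrow> 'a::comm_ring_1 set"
  assumes "noetherian_set R" and I: "\<And>n. ideal_in R (I n)" and mono: "\<And>n. I n \<subseteq> I (Suc n)"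
  shows "\<exists>N. \<forall>n. I n \<subseteq> I N"
proof -
  have le: "I n \<subseteq> I m" if "n \<le> m" for n m using lift_Suc_mono_le[of I n m] mono that by blast
  have "ideal_in R (\<Union>n. I n)"
    unfolding ideal_in_def
  proof (intro conjI ballI)
    show "(\<Union>n. I n) \<subseteq> R" using ideal_subset[OF I] by blast
    show "0 \<in> (\<Union>n. I n)" using ideal_0[OF I] by blast
    show "a * x \<in> (\<Union>n. I n)" if "a \<in> R" "x \<in> (\<Union>n. I n)" for a x
      using that ideal_mult[OF I] by blast
    show "x + y \<in> (\<Union>n. I n)" if xy: "x \<in> (\<Union>n. I n)" "y \<in> (\<Union>n. I n)" for x y
    proof -
      obtain n m where "x \<in> I n" "y \<in> I m" using xy by auto
      then have "x \<in> I (max n m)" "y \<in> I (max n m)"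
        using le[of n "max n m"] le[of m "max n m"] by auto
      then show ?thesis using ideal_add[OF I] by blast
    qed
  qed
  then obtain G where G: "finite G" "G \<subseteq> (\<Union>n. I n)" "(\<Union>n. I n) = gen_ideal R G"
    using assms(1)[unfolded noetherian_set_def, rule_format, of "\<Union>n. I n"] by metis
  have "\<exists>N. G \<subseteq> I N" using G(1,2)
  proof (induction G rule: finite_induct)
    case (insert x G)
    then obtain N n where "G \<subseteq> I N" "x \<in> I n" by auto
    then have "insert x G \<subseteq> I (max N n)" using le[of N "max N n"] le[of n "max N n"] by auto
    then show ?case by blast
  qed auto
  then obtain N where "G \<subseteq> I N" by blast
  then have "(\<Union>n. I n) \<subseteq> I N" using G(3) gen_ideal_subset[OF I] by simp
  then show ?thesis by blast
qed

text \<open>The form in which chains of ideals are exploited later: it is applied to leading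
  coefficients, to the multiples d x^n, to the elements t_n a with poles at distinct points, and to
  monomials.\<close>

lemma noetherian_sequence:
  fixes x :: "nat \<Rightarrow> 'a::comm_ring_1"
  assumes "noetherian_set R" and R: "subring_set R" and x: "\<And>n. x n \<in> R"
  obtains N :: nat and c where "\<And>i. i < N \<Longrightarrow> c i \<in> R" "x N = (\<Sum>i<N. c i * x i)"
proof -
  have "\<exists>N. \<forall>n. gen_ideal R (x ` {..<n}) \<subseteq> gen_ideal R (x ` {..<N})"
  proof (rule noetherian_chain[OF assms(1), of "\<lambda>n. gen_ideal R (x ` {..<n})"])
    show "ideal_in R (gen_ideal R (x ` {..<n}))" for n using x by (intro gen_ideal_ideal[OF R]) auto
    show "gen_ideal R (x ` {..<n}) \<subseteq> gen_ideal R (x ` {..<Suc n})" for n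
      by (intro gen_ideal_mono) auto
  qed
  then obtain N where "gen_ideal R (x ` {..<Suc N}) \<subseteq> gen_ideal R (x ` {..<N})" by blast
  then have "x N \<in> gen_ideal R (x ` {..<N})" using gen_ideal_mem[OF R, of "x N"] by auto
  then show ?thesis using that by (rule gen_ideal_image_lessThan[OF R])
qed

text \<open>Dependent choice in which each term depends on the set of all earlier ones: the
  recursion builds these finite sets, and the sequence is read off from them.\<close>

lemma sequence_avoiding_previous:
  assumes "\<And>A. finite A \<Longrightarrow> A \<subseteq> U \<Longrightarrow> \<exists>p\<in>U. Q A p"
  obtains p :: "nat \<Rightarrow> 'b" where "\<And>n. p n \<in> U" "\<And>n. Q (p ` {..<n}) (p n)"
proof -
  obtain f where f: "\<And>A. finite A \<Longrightarrow> A \<subseteq> U \<Longrightarrow> f A \<in> U \<and> Q A (f A)"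
    using assms by metis
  define S where "S = rec_nat {} (\<lambda>_ A. insert (f A) A)"
  have S: "S 0 = {}" "S (Suc n) = insert (f (S n)) (S n)" for n by (auto simp: S_def)
  have fin: "finite (S n) \<and> S n \<subseteq> U" for n by (induction n) (use f S in auto)
  have im: "S n = (\<lambda>k. f (S k)) ` {..<n}" for n
    by (induction n) (auto simp: S lessThan_Suc)
  show ?thesis
  proof (rule that[of "\<lambda>k. f (S k)"])
    show "f (S n) \<in> U" for n using f fin by blast
    show "Q ((\<lambda>k. f (S k)) ` {..<n}) (f (S n))" for n
      using f[of "S n"] fin[of n] im[of n] by simp
  qed
qed

lemma noetherian_maximal:
  assumes "noetherian_set R" and F: "\<forall>I\<in>F. ideal_in R I" and "I0 \<in> F"
  obtains I where "I \<in> F" "I0 \<subseteq> I" "\<And>J. J \<in> F \<Longrightarrow> I \<subseteq> J \<Longrightarrow> J = I"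
proof (rule ccontr)
  assume no: "\<not> thesis"
  note witness = that
  have *: "\<exists>J. (J \<in> F \<and> I0 \<subseteq> J) \<and> I \<subset> J" if I: "I \<in> F \<and> I0 \<subseteq> I" for I
  proof (rule ccontr)
    assume "\<not> ?thesis"
    then have "J = I" if "J \<in> F" "I \<subseteq> J" for J using that I by blast
    then show False using no I witness by blast
  qed
  have "\<exists>f. \<forall>n::nat. (f n \<in> F \<and> I0 \<subseteq> f n) \<and> f n \<subset> f (Suc n)"
    by (rule dependent_nat_choice) (use assms(3) * in auto)
  then obtain f :: "nat \<Rightarrow> 'a set" where f: "\<And>n. f n \<in> F \<and> I0 \<subseteq> f n" "\<And>n. f n \<subset> f (Suc n)"
    by blast
  have "\<exists>N. \<forall>n. f n \<subseteq> f N"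
    using f F by (intro noetherian_chain[OF assms(1)]) auto
  then show False using f(2) by blast
qed

lemma maximal_ideal_exists:
  assumes "noetherian_set R" "subring_set R" "ideal_in R I" "I \<noteq> R"
  obtains P where "maximal_in R P" "I \<subseteq> P"
proof -
  obtain P where P: "P \<in> {J. ideal_in R J \<and> J \<noteq> R}" "I \<subseteq> P"
    "\<And>J. J \<in> {J. ideal_in R J \<and> J \<noteq> R} \<Longrightarrow> P \<subseteq> J \<Longrightarrow> J = P"
    using noetherian_maximal[OF assms(1), of "{J. ideal_in R J \<and> J \<noteq> R}" I] assms by blast
  show ?thesis
  proof (rule that[OF _ P(2)])
    show "maximal_in R P" unfolding maximal_in_def using P(1,3) by simp metis
  qed
qed

lemma maximal_is_prime:
  assumes R: "subring_set R" and P: "maximal_in R P"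
  shows "prime_in R P"
proof -
  have id: "ideal_in R P" and ne: "P \<noteq> R" using P by (auto simp: maximal_in_def)
  have "b \<in> P" if ab: "a \<in> R" "b \<in> R" "a * b \<in> P" "a \<notin> P" for a b
  proof -
    \<comment> \<open>The ideal generated by \<open>P\<close> and \<open>a\<close>. It is all of
      \<open>R\<close>, and multiplying 1 = p + r a by \<open>b\<close> gives
      \<open>b \<in> P\<close>.\<close>
    define J where "J = {p + r * a | p r. p \<in> P \<and> r \<in> R}"
    have "ideal_in R J" unfolding ideal_in_def
    proof (intro conjI ballI subsetI)
      show "x \<in> R" if "x \<in> J" for x
        using that ab(1) ideal_subset[OF id] R by (auto simp: J_def intro!: subring_add subring_mult)
      show "0 \<in> J" unfolding J_def using id R
        by (intro CollectI exI[of _ 0]) (auto intro: ideal_0 subring_0)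
      show "x + y \<in> J" if xy: "x \<in> J" "y \<in> J" for x y
      proof -
        obtain p r p' r' where "x = p + r * a" "y = p' + r' * a" "p \<in> P" "p' \<in> P" "r \<in> R" "r' \<in> R"
          using xy by (auto simp: J_def)
        then show ?thesis unfolding J_def using id R
          by (intro CollectI exI[of _ "p + p'"] exI[of _ "r + r'"])
            (auto simp: algebra_simps intro: ideal_add subring_add)
      qed
      show "c * x \<in> J" if cx: "c \<in> R" "x \<in> J" for c x
      proof -
        obtain p r where "x = p + r * a" "p \<in> P" "r \<in> R" using cx by (auto simp: J_def)
        then show ?thesis unfolding J_def using id R cx
          by (intro CollectI exI[of _ "c * p"] exI[of _ "c * r"])
            (auto simp: algebra_simps intro: ideal_mult subring_mult)
      qed
    qed
    moreover have "P \<subseteq> J" unfolding J_def using subring_0[OF R] by force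
    moreover have "a \<in> J" unfolding J_def using R id
      by (intro CollectI exI[of _ 0] exI[of _ 1]) (auto intro!: subring_1 ideal_0)
    ultimately have "J = R" using P ab(4) unfolding maximal_in_def by metis
    then have "1 \<in> J" using subring_1[OF R] by simp
    then obtain p r where pr: "1 = p + r * a" "p \<in> P" "r \<in> R"
      unfolding J_def by blast
    have "b = b * p + r * (a * b)" using pr(1) by (metis distrib_left mult.assoc mult.commute mult.right_neutral)
    then show ?thesis using id pr ab by (metis ideal_add ideal_mult)
  qed
  then show ?thesis using id ne unfolding prime_in_def by blast
qed

text \<open>The local-global principle in terms of denominators: with \<open>I\<close> the set of
  all \<open>s\<close> that multiply a given element into a ring, a suitable \<open>s\<close>
  outside each maximal ideal makes 1 suitable as well.\<close>

lemma ideal_eq_ring_if_not_in_maximal: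
  assumes "noetherian_set R" "subring_set R" "ideal_in R I"
    and "\<And>P. maximal_in R P \<Longrightarrow> \<exists>s\<in>I. s \<notin> P"
  shows "1 \<in> I"
  using maximal_ideal_exists[OF assms(1-3)] assms(4) ideal_one_iff[OF assms(2,3)] by (metis subsetD)

lemma noetherian_image:
  assumes "noetherian_set R" and R: "subring_set R" and hR: "subring_set (h ` R)"
    and add: "\<And>x y. h (x + y) = h x + h y" and mult: "\<And>x y. h (x * y) = h x * h y"
  shows "noetherian_set (h ` R)"
  unfolding noetherian_set_def
proof (intro allI impI)
  fix I assume I: "ideal_in (h ` R) I"
  have h0: "h 0 = 0" using add[of 0 0] by simp
  let ?J = "{r \<in> R. h r \<in> I}"
  have J: "ideal_in R ?J" unfolding ideal_in_def
    using R h0 ideal_0[OF I] ideal_add[OF I] ideal_mult[OF I]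
    by (auto simp: add mult intro: subring_0 subring_add subring_mult)
  obtain G where G: "finite G" "G \<subseteq> ?J" "?J = gen_ideal R G"
    using noetherian_finite_basis[OF assms(1) J] .
  have "gen_ideal R G \<subseteq> {r. h r \<in> gen_ideal (h ` R) (h ` G)}"
    by (rule gen_ideal_least)
      (auto simp: h0 add mult intro: gen_ideal_0 gen_ideal_add[OF hR] gen_ideal_mult_mem)
  then have "I \<subseteq> gen_ideal (h ` R) (h ` G)" using G(3) ideal_subset[OF I] by blast
  moreover have hG: "h ` G \<subseteq> I" using G(2) by blast
  then have "gen_ideal (h ` R) (h ` G) \<subseteq> I" by (rule gen_ideal_subset[OF I])
  ultimately show "\<exists>G. finite G \<and> G \<subseteq> I \<and> I = gen_ideal (h ` R) G"
    using G(1) hG by (intro exI[of _ "h ` G"]) auto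
qed

subsection \<open>Hilbert's basis theorem\<close>

text \<open>The ring R[y] as an image of evaluation, so that \<open>y\<close> may satisfy relations
  over \<open>R\<close>. Hilbert's theorem is proved directly for this image.\<close>

definition adjoin :: "'a::comm_ring_1 set \<Rightarrow> 'a \<Rightarrow> 'a set" where
  "adjoin R y = {poly p y | p. \<forall>i. coeff p i \<in> R}"

lemma coeff_mult_mem:
  assumes "subring_set R" "\<forall>i. coeff p i \<in> R" "\<forall>i. coeff q i \<in> R"
  shows "coeff (p * q) i \<in> R"
  using assms by (auto simp: coeff_mult intro!: subring_intros)

lemma subring_adjoin:
  assumes R: "subring_set R"
  shows "subring_set (adjoin R y)"
  unfolding subring_set_def
proof (intro conjI ballI)
  show "0 \<in> adjoin R y" using R unfolding adjoin_def
    by (intro CollectI exI[of _ 0]) (auto intro: subring_0)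
  show "1 \<in> adjoin R y" using R unfolding adjoin_def
    by (intro CollectI exI[of _ 1]) (auto simp: coeff_pCons one_pCons split: nat.splits intro: subring_0 subring_1)
  fix u v assume "u \<in> adjoin R y" "v \<in> adjoin R y"
  then obtain p q where pq: "u = poly p y" "v = poly q y" "\<forall>i. coeff p i \<in> R" "\<forall>i. coeff q i \<in> R"
    by (auto simp: adjoin_def)
  show "u + v \<in> adjoin R y" using pq R unfolding adjoin_def
    by (intro CollectI exI[of _ "p + q"]) (auto intro: subring_add)
  show "u * v \<in> adjoin R y" using pq R unfolding adjoin_def
    by (intro CollectI exI[of _ "p * q"]) (auto intro: coeff_mult_mem)
  show "- u \<in> adjoin R y" using pq R unfolding adjoin_def
    by (intro CollectI exI[of _ "- p"]) (auto intro: subring_uminus)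
qed

lemma adjoin_mem: "subring_set R \<Longrightarrow> x \<in> R \<Longrightarrow> x \<in> adjoin R y"
  unfolding adjoin_def
  by (intro CollectI exI[of _ "[:x:]"]) (auto simp: coeff_pCons split: nat.splits intro: subring_0)

lemma adjoin_self: "subring_set R \<Longrightarrow> y \<in> adjoin R y"
  unfolding adjoin_def
  by (intro CollectI exI[of _ "[:0, 1:]"])
    (auto simp: coeff_pCons split: nat.splits intro: subring_0 subring_1)

text \<open>Classical argument: a sequence of elements of minimal degree outside the ideal generated by
  the previous ones contradicts the Noetherian property of the leading coefficients.\<close>

theorem noetherian_adjoin:
  assumes N: "noetherian_set R" and R: "subring_set R"
  shows "noetherian_set (adjoin R y)"
proof (rule ccontr)
  let ?S = "adjoin R y"
  note S = subring_adjoin[OF R, of y]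
  assume "\<not> noetherian_set ?S"
  then obtain I where I: "ideal_in ?S I" and nfg: "\<And>G. finite G \<Longrightarrow> G \<subseteq> I \<Longrightarrow> I \<noteq> gen_ideal ?S G"
    unfolding noetherian_set_def by blast
  \<comment> \<open>The argument runs on polynomials that represent elements of \<open>I\<close>,
    since an element of \<open>adjoin R y\<close> has no degree of its own.\<close>
  define U where "U = {p. (\<forall>i. coeff p i \<in> R) \<and> poly p y \<in> I}"
  define Q where "Q A p \<longleftrightarrow> poly p y \<notin> gen_ideal ?S ((\<lambda>p. poly p y) ` A) \<and>
      (\<forall>q\<in>U. poly q y \<notin> gen_ideal ?S ((\<lambda>p. poly p y) ` A) \<longrightarrow> degree p \<le> degree q)" for A p
  have "\<exists>p\<in>U. Q A p" if A: "finite A" "A \<subseteq> U" for A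
  proof -
    let ?G = "(\<lambda>p. poly p y) ` A"
    have "?G \<subseteq> I" using A by (auto simp: U_def)
    then have "gen_ideal ?S ?G \<subset> I"
      using nfg[of ?G] gen_ideal_subset[OF I] A(1) by auto
    then obtain v where "v \<in> I" "v \<notin> gen_ideal ?S ?G" by blast
    moreover then obtain p where "v = poly p y" "\<forall>i. coeff p i \<in> R"
      using ideal_subset[OF I] by (auto simp: adjoin_def)
    ultimately have ex: "\<exists>p. p \<in> U \<and> poly p y \<notin> gen_ideal ?S ?G" by (auto simp: U_def)
    show ?thesis
      using ex_has_least_nat[of "\<lambda>p. p \<in> U \<and> poly p y \<notin> gen_ideal ?S ?G" _ degree] ex
      unfolding Q_def by blast
  qed
  then obtain p :: "nat \<Rightarrow> 'a poly" where pU: "\<And>n. p n \<in> U" and pQ: "\<And>n. Q (p ` {..<n}) (p n)"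
    using sequence_avoiding_previous[of U Q] by blast
  have notin: "poly (p n) y \<notin> gen_ideal ?S ((\<lambda>k. poly (p k) y) ` {..<n})" for n
    using pQ[of n] by (simp add: Q_def image_image)
  have minimal: "degree (p n) \<le> degree q"
    if "q \<in> U" "poly q y \<notin> gen_ideal ?S ((\<lambda>k. poly (p k) y) ` {..<n})" for n q
    using pQ[of n] that by (simp add: Q_def image_image)
  have deg: "degree (p i) \<le> degree (p n)" if "i < n" for i n
  proof (rule minimal[OF pU])
    have "gen_ideal ?S ((\<lambda>k. poly (p k) y) ` {..<i}) \<subseteq> gen_ideal ?S ((\<lambda>k. poly (p k) y) ` {..<n})"
      using that by (intro gen_ideal_mono) auto
    then show "poly (p n) y \<notin> gen_ideal ?S ((\<lambda>k. poly (p k) y) ` {..<i})" using notin by blast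
  qed
  have "\<And>n. lead_coeff (p n) \<in> R" using pU by (auto simp: U_def)
  then obtain n c where c: "\<And>i. i < n \<Longrightarrow> c i \<in> R"
    and lc: "lead_coeff (p n) = (\<Sum>i<n. c i * lead_coeff (p i))"
    using noetherian_sequence[OF N R, of "\<lambda>n. lead_coeff (p n)"] by blast
  \<comment> \<open>The monomials lift every \<open>p i\<close> to the degree of \<open>p n\<close>,
    so that subtracting \<open>r\<close> cancels the leading term. By \<open>deg\<close> no
    difference of degrees is truncated.\<close>
  define r where "r = (\<Sum>i<n. monom (c i) (degree (p n) - degree (p i)) * p i)"
  define q where "q = p n - r"
  have mon: "\<forall>k. coeff (monom (c i) d) k \<in> R" if "i < n" for i d
    using c[OF that] R by (auto intro: subring_0)
  have rR: "\<forall>k. coeff r k \<in> R" unfolding r_def coeff_sum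
    using mon pU R by (auto intro!: subring_sum coeff_mult_mem simp: U_def)
  have "coeff r (degree (p n)) = lead_coeff (p n)"
    unfolding lc r_def coeff_sum
    using deg by (intro sum.cong) (auto simp: coeff_monom_mult)
  then have cq: "coeff q (degree (p n)) = 0" by (simp add: q_def)
  have "degree r \<le> degree (p n)" unfolding r_def
  proof (rule degree_sum_le)
    show "degree (monom (c i) (degree (p n) - degree (p i)) * p i) \<le> degree (p n)" if "i \<in> {..<n}" for i
      using degree_mult_le[of "monom (c i) (degree (p n) - degree (p i))" "p i"]
        degree_monom_le[of "c i" "degree (p n) - degree (p i)"] deg[of i n] that by auto
  qed auto
  then have dq: "degree q \<le> degree (p n)" unfolding q_def by (intro degree_diff_le) auto
  have rI: "poly r y \<in> gen_ideal ?S ((\<lambda>k. poly (p k) y) ` {..<n})"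
    unfolding r_def poly_sum poly_mult
  proof (rule ideal_sum[OF gen_ideal_ideal[OF S]])
    show "(\<lambda>k. poly (p k) y) ` {..<n} \<subseteq> ?S" using pU by (auto simp: U_def adjoin_def)
    show "poly (monom (c i) (degree (p n) - degree (p i))) y * poly (p i) y
        \<in> gen_ideal ?S ((\<lambda>k. poly (p k) y) ` {..<n})" if "i \<in> {..<n}" for i
      using that mon[of i] by (intro gen_ideal_mult_mem) (auto simp: adjoin_def)
  qed
  have sub: "(\<lambda>k. poly (p k) y) ` {..<n} \<subseteq> I" using pU by (auto simp: U_def)
  have "poly r y \<in> I" using rI gen_ideal_subset[OF I sub] by blast
  then have "q \<in> U" unfolding U_def q_def
    using pU[of n] rR R I by (auto simp: U_def intro: subring_diff ideal_diff[OF S])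
  moreover have qn: "poly q y \<notin> gen_ideal ?S ((\<lambda>k. poly (p k) y) ` {..<n})"
  proof
    assume "poly q y \<in> gen_ideal ?S ((\<lambda>k. poly (p k) y) ` {..<n})"
    then have "poly q y + poly r y \<in> gen_ideal ?S ((\<lambda>k. poly (p k) y) ` {..<n})"
      using rI gen_ideal_add[OF S] by blast
    then show False using notin[of n] by (simp add: q_def)
  qed
  ultimately have "degree q = degree (p n)" using minimal dq by (simp add: eq_iff)
  \<comment> \<open>The coefficient of \<open>q\<close> at its own degree vanishes, which also
    settles degree 0; but the value of the zero polynomial lies in every ideal.\<close>
  then have "q = 0" using cq by (metis leading_coeff_0_iff)
  then show False using qn gen_ideal_0 by auto
qed

section \<open>Finitely generated ring extensions\<close>

lemma subring_gen_subring: "subring_set (gen_subring S)"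
  unfolding gen_subring_def subring_set_def by auto

lemma gen_subring_mem: "x \<in> S \<Longrightarrow> x \<in> gen_subring S"
  by (auto simp: gen_subring_def)

lemma gen_subring_least: "subring_set R \<Longrightarrow> S \<subseteq> R \<Longrightarrow> gen_subring S \<subseteq> R"
  by (auto simp: gen_subring_def)

lemma gen_subring_mono: "S \<subseteq> T \<Longrightarrow> gen_subring S \<subseteq> gen_subring T"
  by (auto simp: gen_subring_def)

lemma gen_subring_insert: "gen_subring (insert y S) = adjoin (gen_subring S) y"
proof
  show "gen_subring (insert y S) \<subseteq> adjoin (gen_subring S) y"
    by (intro gen_subring_least subring_adjoin subring_gen_subring)
      (auto intro: adjoin_mem adjoin_self subring_gen_subring gen_subring_mem)
  show "adjoin (gen_subring S) y \<subseteq> gen_subring (insert y S)"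
  proof
    fix x assume "x \<in> adjoin (gen_subring S) y"
    then obtain p where p: "x = poly p y" "\<forall>i. coeff p i \<in> gen_subring S" by (auto simp: adjoin_def)
    have "coeff p i \<in> gen_subring (insert y S)" for i
      using p gen_subring_mono[of S "insert y S"] by auto
    then show "x \<in> gen_subring (insert y S)" unfolding p(1) poly_altdef
      by (intro subring_intros subring_gen_subring) (auto intro: gen_subring_mem)
  qed
qed

lemma noetherian_gen_subring:
  assumes "noetherian_set R" "subring_set R" "finite Y"
  shows "noetherian_set (gen_subring (R \<union> Y))"
  using assms(3)
proof (induction Y rule: finite_induct)
  case empty
  have "gen_subring R = R" using gen_subring_least[OF assms(2), of R] by (auto intro: gen_subring_mem)
  then show ?case using assms(1) by simp
next
  case (insert y Y)
  then show ?case by (simp add: gen_subring_insert noetherian_adjoin subring_gen_subring)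
qed

subsection \<open>Integral and almost integral elements\<close>

text \<open>Some d x^N is an \<open>R\<close>-combination of the earlier multiples d x^i; cancelling
  \<open>d\<close> leaves a monic equation for \<open>x\<close>.\<close>

lemma noetherian_almost_integral:
  assumes "noetherian_set R" "subring_set R" and d: "\<And>x. d * x = 0 \<Longrightarrow> x = 0"
    and "\<And>n. d * x ^ n \<in> R"
  obtains N :: nat and c where "\<And>i. i < N \<Longrightarrow> c i \<in> R" "x ^ N = (\<Sum>i<N. c i * x ^ i)"
proof -
  obtain N :: nat and c where c: "\<And>i. i < N \<Longrightarrow> c i \<in> R" "d * x ^ N = (\<Sum>i<N. c i * (d * x ^ i))"
    using noetherian_sequence[OF assms(1,2), of "\<lambda>n. d * x ^ n"] assms(4) by blast
  have "d * (x ^ N - (\<Sum>i<N. c i * x ^ i)) = 0"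
    by (simp add: right_diff_distrib c(2) sum_distrib_left mult.left_commute)
  then show ?thesis using d that c(1) by (metis eq_iff_diff_eq_0)
qed

lemma frac_integralI:
  assumes R: "subring_set R" and c: "\<And>i. i < N \<Longrightarrow> c i \<in> R" and x: "x ^ N = (\<Sum>i<N. c i * x ^ i)"
    and p: "p = q * x"
  shows "frac_integral R p q"
  unfolding frac_integral_def
proof (intro exI conjI allI impI)
  show "- c i \<in> R" if "i < N" for i using c R that by (auto intro: subring_uminus)
  have "p ^ N = (\<Sum>i<N. q ^ N * (c i * x ^ i))"
    unfolding p power_mult_distrib x by (rule sum_distrib_left)
  also have "\<dots> = (\<Sum>i<N. c i * p ^ i * q ^ (N - i))"
  proof (rule sum.cong)
    fix i assume "i \<in> {..<N}"
    then have "q ^ N = q ^ i * q ^ (N - i)" by (simp flip: power_add)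
    then show "q ^ N * (c i * x ^ i) = c i * p ^ i * q ^ (N - i)"
      by (simp add: p power_mult_distrib mult_ac)
  qed simp
  finally show "p ^ N + (\<Sum>i<N. - c i * p ^ i * q ^ (N - i)) = 0"
    by (simp add: sum_negf)
qed

text \<open>The fraction p/q is almost integral with denominator \<open>d\<close>. This condition
  consists of products only and is therefore preserved by passing to leading coefficients.\<close>

definition completely_int_closed :: "'a::comm_ring_1 set \<Rightarrow> bool" where
  "completely_int_closed R \<longleftrightarrow> (\<forall>p\<in>R. \<forall>q\<in>R. \<forall>d\<in>R. q \<noteq> 0 \<and> d \<noteq> 0 \<and> (\<forall>n. \<exists>a\<in>R. d * p ^ n = q ^ n * a)
      \<longrightarrow> (\<exists>a\<in>R. p = q * a))"

text \<open>A monic equation of degree N bounds the denominators: strong induction rewrites the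
  powers of p/q from the N-th on through lower ones, so that q^N clears them all.\<close>

lemma frac_integral_almost:
  assumes R: "subring_set R" and pq: "p \<in> R" "q \<in> R" and "frac_integral R p q"
  obtains k where "\<And>n. \<exists>a\<in>R. q ^ k * p ^ n = q ^ n * a"
proof -
  obtain N :: nat and c where c: "\<And>i. i < N \<Longrightarrow> c i \<in> R" and eq: "p ^ N + (\<Sum>i<N. c i * p ^ i * q ^ (N - i)) = 0"
    using assms(4) unfolding frac_integral_def by blast
  have "\<exists>a\<in>R. q ^ N * p ^ n = q ^ n * a" for n
  proof (induction n rule: less_induct)
    case (less n)
    show ?case
    proof (cases "n < N")
      case True
      then have "q ^ N = q ^ n * q ^ (N - n)" by (simp flip: power_add)
      then show ?thesis using R pq
        by (intro bexI[of _ "q ^ (N - n) * p ^ n"]) (auto simp: mult_ac intro: subring_intros)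
    next
      case False
      have "\<exists>b\<in>R. q ^ N * p ^ (n - N + i) = q ^ (n - N + i) * b" if "i < N" for i
        using less[of "n - N + i"] that False by auto
      then obtain b where b: "\<And>i. i < N \<Longrightarrow> b i \<in> R \<and> q ^ N * p ^ (n - N + i) = q ^ (n - N + i) * b i"
        by metis
      have pN: "p ^ N = - (\<Sum>i<N. c i * p ^ i * q ^ (N - i))" using eq by (simp add: eq_neg_iff_add_eq_0)
      have "q ^ N * p ^ n = q ^ N * p ^ (n - N) * p ^ N"
        using False by (simp add: mult.assoc flip: power_add)
      also have "\<dots> = - (\<Sum>i<N. q ^ N * p ^ (n - N) * (c i * p ^ i * q ^ (N - i)))"
        unfolding pN by (simp add: sum_distrib_left)
      also have "\<dots> = - (\<Sum>i<N. q ^ n * (c i * b i))"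
      proof -
        have "q ^ N * p ^ (n - N) * (c i * p ^ i * q ^ (N - i)) = q ^ n * (c i * b i)" if "i < N" for i
        proof -
          have "q ^ N * p ^ (n - N) * (c i * p ^ i * q ^ (N - i)) = (q ^ N * p ^ (n - N + i)) * (c i * q ^ (N - i))"
            by (simp add: power_add mult_ac)
          also have "\<dots> = q ^ (n - N + i + (N - i)) * (c i * b i)"
            using b[OF that] by (simp add: power_add mult_ac)
          also have "n - N + i + (N - i) = n" using that False by simp
          finally show ?thesis .
        qed
        then show ?thesis by (intro arg_cong[of _ _ uminus] sum.cong) auto
      qed
      also have "\<dots> = q ^ n * - (\<Sum>i<N. c i * b i)" by (simp add: sum_distrib_left)
      finally show ?thesis using R b c by (intro bexI[of _ "- (\<Sum>i<N. c i * b i)"]) (auto intro!: subring_intros)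
    qed
  qed
  then show ?thesis using that by blast
qed

lemma frac_integral_mono: "R \<subseteq> S \<Longrightarrow> frac_integral R p q \<Longrightarrow> frac_integral S p q"
  unfolding frac_integral_def by blast

section \<open>Valuations of a Dedekind domain\<close>

locale dedekind =
  fixes A :: "'k::field set"
  assumes dedekind: "dedekind_set A"
    and fractions: "\<forall>x::'k. \<exists>a\<in>A. \<exists>b\<in>A. b \<noteq> 0 \<and> x = a / b"
begin

lemma subring: "subring_set A" and noetherian: "noetherian_set A" and normal: "normal_set A"
  using dedekind by (auto simp: dedekind_set_def)

lemmas A_intros = subring_0[OF subring] subring_1[OF subring] subring_add[OF subring]
  subring_mult[OF subring] subring_uminus[OF subring] subring_diff[OF subring] subring_power[OF subring]

text \<open>Noetherian and integrally closed give completely integrally closed. This excludes that a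
  nonzero \<open>d\<close> be multiplied into \<open>A\<close> by all powers of an element outside
  \<open>A\<close>.\<close>

lemma almost_integral_mem:
  assumes "d \<noteq> 0" "\<And>n. d * x ^ n \<in> A"
  shows "x \<in> A"
proof -
  obtain N :: nat and c where c: "\<And>i. i < N \<Longrightarrow> c i \<in> A" "x ^ N = (\<Sum>i<N. c i * x ^ i)"
    using noetherian_almost_integral[OF noetherian subring, of d x] assms by (metis mult_eq_0_iff)
  obtain p q where pq: "p \<in> A" "q \<in> A" "q \<noteq> 0" "x = p / q" using fractions by blast
  then have p: "p = q * x" by simp
  have "frac_integral A p q" by (rule frac_integralI[OF subring c p])
  then obtain a where "a \<in> A" "p = q * a" using normal pq unfolding normal_set_def by blast
  then show ?thesis using p pq(3) by simp
qed

section \<open>The order at a single closed point\<close>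

context
  fixes z assumes z: "z \<in> closed_pts A"
begin

lemma maximal: "maximal_in A z" and ideal: "ideal_in A z"
  using z by (auto simp: closed_pts_def maximal_in_def)

lemma point_subset: "x \<in> z \<Longrightarrow> x \<in> A"
  using ideal_subset[OF ideal] .

lemma prime: "a \<in> A \<Longrightarrow> b \<in> A \<Longrightarrow> a * b \<in> z \<Longrightarrow> a \<in> z \<or> b \<in> z"
  using maximal_is_prime[OF subring maximal] by (auto simp: prime_in_def)

lemma one_notin: "1 \<notin> z"
  using maximal ideal_one_iff[OF subring ideal] by (auto simp: maximal_in_def)

lemma zero_in: "0 \<in> z"
  using ideal_0[OF ideal] .

lemma notin_mult: "a \<in> A - z \<Longrightarrow> b \<in> A - z \<Longrightarrow> a * b \<in> A - z"
  using prime[of a b] A_intros by auto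

lemma notin_power: "a \<in> A - z \<Longrightarrow> a ^ n \<in> A - z"
proof (induction n)
  case 0 then show ?case using one_notin A_intros by simp
next
  case (Suc n) then show ?case using notin_mult[of a "a ^ n"] by simp
qed

text \<open>If {0} were maximal, every nonzero element would be invertible; here it matters that a
  Dedekind domain is not a field.\<close>

lemma point_nonzero: "\<exists>a\<in>z. a \<noteq> 0"
proof (rule ccontr)
  assume "\<not> ?thesis"
  then have z0: "z = {0}" using zero_in by blast
  obtain a where a: "a \<in> A" "a \<noteq> 0" "inverse a \<notin> A" using dedekind by (auto simp: dedekind_set_def)
  let ?J = "(\<lambda>r. a * r) ` A"
  have "ideal_in A ?J" unfolding ideal_in_def
  proof (intro conjI ballI)
    show "?J \<subseteq> A" using a A_intros by auto
    show "0 \<in> ?J" using A_intros by (intro image_eqI[of _ _ 0]) auto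
    show "x + y \<in> ?J" if "x \<in> ?J" "y \<in> ?J" for x y
      using that A_intros by (auto simp flip: distrib_left)
    show "r * x \<in> ?J" if "r \<in> A" "x \<in> ?J" for r x
      using that A_intros by (auto simp: mult.left_commute)
  qed
  moreover have "1 \<notin> ?J" using a by (metis image_iff inverse_unique)
  then have "?J \<noteq> A" using A_intros by auto
  moreover have "z \<subseteq> ?J" using z0 A_intros(1) by force
  ultimately have "?J = z" using maximal unfolding maximal_in_def by blast
  moreover have "a \<in> ?J" using A_intros(2) by force
  ultimately show False using z0 a by auto
qed

text \<open>A maximal element among the colon ideals \<open>(a : b)\<close> contained in \<open>z\<close> is prime, hence equals \<open>z\<close>;
  then \<open>b / a\<close> is the required element.\<close>

lemma ex_inverse_element: "\<exists>t. t \<notin> A \<and> (\<forall>x\<in>z. t * x \<in> A)"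
proof -
  obtain a where a: "a \<in> z" "a \<noteq> 0" using point_nonzero by blast
  have aA: "a \<in> A" using a point_subset by blast
  define C where "C b = {c \<in> A. \<exists>e\<in>A. c * b = a * e}" for b
  have idC: "ideal_in A (C b)" if "b \<in> A" for b unfolding ideal_in_def
  proof (intro conjI ballI)
    show "C b \<subseteq> A" by (auto simp: C_def)
    show "0 \<in> C b" using A_intros by (auto simp: C_def intro!: bexI[of _ 0])
    show "x + y \<in> C b" if xy: "x \<in> C b" "y \<in> C b" for x y
    proof -
      obtain e f where "x \<in> A" "y \<in> A" "e \<in> A" "f \<in> A" "x * b = a * e" "y * b = a * f"
        using xy by (auto simp: C_def)
      then show ?thesis using A_intros by (auto simp: C_def algebra_simps intro!: bexI[of _ "e + f"])
    qed
    show "r * x \<in> C b" if xy: "r \<in> A" "x \<in> C b" for r x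
    proof -
      obtain e where "x \<in> A" "e \<in> A" "x * b = a * e" using xy by (auto simp: C_def)
      then show ?thesis using xy A_intros by (auto simp: C_def mult_ac intro!: bexI[of _ "r * e"])
    qed
  qed
  let ?F = "{C b | b. b \<in> A \<and> C b \<subseteq> z}"
  have C1: "C 1 \<in> ?F"
  proof -
    have "C 1 \<subseteq> z" using a ideal_mult_right[OF ideal] by (auto simp: C_def)
    then show ?thesis using A_intros(2) by blast
  qed
  have idF: "\<forall>I\<in>?F. ideal_in A I" using idC by blast
  obtain I where I: "I \<in> ?F" "C 1 \<subseteq> I" "\<And>J. J \<in> ?F \<Longrightarrow> I \<subseteq> J \<Longrightarrow> J = I"
    by (fact noetherian_maximal[OF noetherian idF C1])
  then obtain b where b: "b \<in> A" "C b \<subseteq> z" "I = C b" by blast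
  have max: "C b' = C b" if "b' \<in> A" "C b' \<subseteq> z" "C b \<subseteq> C b'" for b'
    using that b(3) I(3)[of "C b'"] by blast
  have sub: "C b \<subseteq> C (y * b)" if "y \<in> A" for y
  proof
    fix c assume "c \<in> C b"
    then obtain e where "c \<in> A" "e \<in> A" "c * b = a * e" by (auto simp: C_def)
    then show "c \<in> C (y * b)" using that A_intros
      by (auto simp: C_def mult_ac intro!: bexI[of _ "y * e"])
  qed
  have "x \<in> C b \<or> y \<in> C b" if xy: "x \<in> A" "y \<in> A" "x * y \<in> C b" for x y
  proof (cases "C (y * b) \<subseteq> z")
    case True
    then have "C (y * b) = C b" by (intro max A_intros(4) xy(2) b(1) True sub)
    moreover have "x \<in> C (y * b)" using xy by (auto simp: C_def mult_ac)
    ultimately show ?thesis by blast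
  next
    case False
    then obtain w where w: "w \<in> C (y * b)" "w \<notin> z" by blast
    then have wA: "w \<in> A" by (auto simp: C_def)
    \<comment> \<open>As \<open>w\<close> is outside the prime \<open>z\<close>, multiplying
      \<open>b\<close> by it keeps the colon ideal inside \<open>z\<close>. Maximality gives
      \<open>C (w * b) = C b\<close>, and this contains \<open>y\<close> because
      \<open>w \<in> C (y * b)\<close>.\<close>
    have Cw: "C (w * b) \<subseteq> z"
    proof
      fix c assume c: "c \<in> C (w * b)"
      then have "c * w \<in> C b" using wA A_intros by (auto simp: C_def mult_ac)
      then have "c * w \<in> z" using b by blast
      then show "c \<in> z" using prime[of c w] w c wA by (auto simp: C_def)
    qed
    then have "C (w * b) = C b" by (intro max A_intros(4) wA b(1) Cw sub)
    moreover have "y \<in> C (w * b)" using w xy by (auto simp: C_def mult_ac)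
    ultimately show ?thesis by blast
  qed
  moreover have "C b \<noteq> A" using b(2) one_notin A_intros(2) by blast
  ultimately have "prime_in A (C b)" unfolding prime_in_def using idC b(1) by blast
  moreover have "a \<in> C b" using aA b(1) by (auto simp: C_def)
  ultimately have "maximal_in A (C b)" using dedekind a(2) unfolding dedekind_set_def by blast
  then have eq: "C b = z" using b(2) maximal unfolding maximal_in_def by metis
  show ?thesis
  proof (intro exI conjI ballI)
    show "b / a \<notin> A"
    proof
      assume "b / a \<in> A"
      then have "1 \<in> C b" using a A_intros(2) by (auto simp: C_def intro!: bexI[of _ "b / a"])
      then show False using eq one_notin by simp
    qed
    show "b / a * x \<in> A" if "x \<in> z" for x
    proof -
      obtain e where "e \<in> A" "x * b = a * e" using \<open>x \<in> z\<close> eq by (auto simp: C_def)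
      then have "b / a * x = e" using a by (simp add: field_simps)
      then show ?thesis using \<open>e \<in> A\<close> by simp
    qed
  qed
qed

text \<open>If \<open>t\<close> mapped \<open>z\<close> into itself, then a t^n would stay in
  \<open>z\<close> for a nonzero \<open>a\<close>, and \<open>t\<close> would be almost integral,
  hence in \<open>A\<close>. So t p is a unit at \<open>z\<close> for some \<open>p\<close>, which
  becomes the uniformizer.\<close>

lemma ex_local_generator:
  "\<exists>t p. t \<notin> A \<and> (\<forall>x\<in>z. t * x \<in> A) \<and> p \<in> z \<and> t * p \<in> A - z"
proof -
  obtain t where t: "t \<notin> A" "\<And>x. x \<in> z \<Longrightarrow> t * x \<in> A" using ex_inverse_element by blast
  have "\<exists>p\<in>z. t * p \<notin> z"
  proof (rule ccontr)
    assume *: "\<not> ?thesis"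
    obtain a where a: "a \<in> z" "a \<noteq> 0" using point_nonzero by blast
    have "a * t ^ n \<in> z" for n by (induction n) (use a * in \<open>auto simp: mult_ac\<close>)
    then show False using almost_integral_mem[of a t] a t point_subset by blast
  qed
  then show ?thesis using t by blast
qed

lemma ideal_idpow: "ideal_in A (idpow A z n)"
proof (induction n)
  case 0 show ?case using A_intros by (auto simp: ideal_in_def)
next
  case (Suc n)
  then show ?case using ideal point_subset ideal_subset[OF Suc] A_intros
    by (auto intro!: gen_ideal_ideal[OF subring])
qed

lemma idpow_mult: "x \<in> z \<Longrightarrow> y \<in> idpow A z n \<Longrightarrow> x * y \<in> idpow A z (Suc n)"
  by (auto intro!: gen_ideal_mem[OF subring])

lemma idpow_Suc_subset: "idpow A z (Suc n) \<subseteq> idpow A z n"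
proof -
  have "gen_ideal A {x * y |x y. x \<in> z \<and> y \<in> idpow A z n} \<subseteq> idpow A z n"
    using ideal_mult[OF ideal_idpow] point_subset
    by (intro gen_ideal_subset[OF ideal_idpow]) auto
  then show ?thesis by simp
qed

lemma power_mem_idpow: "x \<in> z \<Longrightarrow> x ^ n \<in> idpow A z n"
  by (induction n) (use A_intros idpow_mult in auto)

text \<open>As \<open>z\<close> is maximal, 1 = w + s y with \<open>w \<in> z\<close>. Then a = w a
  + y (s a), and \<open>w\<close> raises the known power of \<open>z\<close> containing
  \<open>a\<close> by one.\<close>

lemma idpow_primary:
  assumes s: "s \<in> A - z" and "a \<in> A" "s * a \<in> idpow A z n"
  shows "a \<in> idpow A z n"
proof -
  let ?J = "{x + s * y | x y. x \<in> z \<and> y \<in> A}"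
  have "ideal_in A ?J" unfolding ideal_in_def
  proof (intro conjI ballI)
    show "?J \<subseteq> A" using s A_intros point_subset by auto
    show "0 \<in> ?J" using zero_in A_intros(1) by force
    show "u + v \<in> ?J" if uv: "u \<in> ?J" "v \<in> ?J" for u v
    proof -
      obtain x y x' y' where "u = x + s * y" "v = x' + s * y'" "x \<in> z" "x' \<in> z" "y \<in> A" "y' \<in> A"
        using uv by blast
      then show ?thesis using ideal_add[OF ideal] A_intros
        by (intro CollectI exI[of _ "x + x'"] exI[of _ "y + y'"]) (auto simp: algebra_simps)
    qed
    show "r * u \<in> ?J" if ru: "r \<in> A" "u \<in> ?J" for r u
    proof -
      obtain x y where "u = x + s * y" "x \<in> z" "y \<in> A" using ru by blast
      then show ?thesis using ideal_mult[OF ideal] A_intros ru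
        by (intro CollectI exI[of _ "r * x"] exI[of _ "r * y"]) (auto simp: algebra_simps)
    qed
  qed
  moreover have "z \<subseteq> ?J" using A_intros(1) by force
  moreover have "?J \<noteq> z"
  proof
    assume "?J = z"
    moreover have "s \<in> ?J" using zero_in A_intros(2) by force
    ultimately show False using s by blast
  qed
  ultimately have "?J = A" using maximal unfolding maximal_in_def by blast
  then have "1 \<in> ?J" using A_intros(2) by simp
  then obtain w y where w: "w \<in> z" "y \<in> A" "1 = w + s * y" by blast
  show ?thesis using assms(3)
  proof (induction n)
    case 0 then show ?case using assms by simp
  next
    case (Suc n)
    then have "a \<in> idpow A z n" using idpow_Suc_subset by blast
    then have "w * a \<in> idpow A z (Suc n)" using idpow_mult w by blast
    moreover have "y * (s * a) \<in> idpow A z (Suc n)" using Suc.prems w ideal_mult[OF ideal_idpow] by blast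
    ultimately have "w * a + y * (s * a) \<in> idpow A z (Suc n)" using ideal_add[OF ideal_idpow] by blast
    moreover have "w * a + y * (s * a) = (w + s * y) * a" by (simp add: algebra_simps)
    ultimately show ?case using w(3) by simp
  qed
qed

text \<open>Trades the definition of \<open>ord_at\<close> by ideal powers and a chosen fraction for
  its local description: \<open>f\<close> is p^e up to the factors \<open>s\<close> and
  \<open>b\<close>, which are units at \<open>z\<close>. Later facts about orders rest on
  this.\<close>

lemma ex_uniformizer:
  obtains p where "p \<in> z" "p \<noteq> 0"
    "\<And>f. f \<noteq> 0 \<Longrightarrow> \<exists>s\<in>A - z. \<exists>b\<in>A - z. s * f = p powi ord_at A z f * b"
    "\<And>f e s b. s \<in> A - z \<Longrightarrow> b \<in> A - z \<Longrightarrow> s * f = p powi e * b \<Longrightarrow> ord_at A z f = e"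
proof -
  obtain t p where t: "t \<notin> A" "\<And>x. x \<in> z \<Longrightarrow> t * x \<in> A" and p: "p \<in> z" and u: "t * p \<in> A - z"
    using ex_local_generator by blast
  have p0: "p \<noteq> 0" using u zero_in by auto
  have A0: "a \<noteq> 0" if "a \<in> A - z" for a using that zero_in by auto
  have pow_mem: "p ^ k * b \<in> z" if "k > 0" "b \<in> A" for k b
  proof -
    have "p ^ k = p ^ (k - 1) * p" using that(1) by (metis Suc_diff_1 power_Suc2)
    then show ?thesis using ideal_mult[OF ideal, of "b * p ^ (k - 1)" p] p that point_subset A_intros
      by (simp add: mult_ac)
  qed
  \<comment> \<open>Since \<open>t\<close> maps \<open>z\<close> into \<open>A\<close>, t^n maps the
    n-th power of \<open>z\<close> into \<open>A\<close>; the unit (t p)^n at \<open>z\<close> thus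
    turns membership in that power into divisibility by p^n.\<close>
  have idpow: "(t * p) ^ n * a \<in> (\<lambda>b. p ^ n * b) ` A" if "a \<in> idpow A z n" for n a
    using that
  proof (induction n arbitrary: a)
    case (Suc n)
    have J: "ideal_in A {a \<in> A. (t * p) ^ Suc n * a \<in> (\<lambda>b. p ^ Suc n * b) ` A}"
      unfolding ideal_in_def
    proof (intro conjI ballI)
      show "0 \<in> {a \<in> A. (t * p) ^ Suc n * a \<in> (\<lambda>b. p ^ Suc n * b) ` A}"
        using A_intros(1) by (auto intro!: image_eqI[of _ _ 0])
      show "x + y \<in> {a \<in> A. (t * p) ^ Suc n * a \<in> (\<lambda>b. p ^ Suc n * b) ` A}"
        if xy: "x \<in> {a \<in> A. (t * p) ^ Suc n * a \<in> (\<lambda>b. p ^ Suc n * b) ` A}"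
          "y \<in> {a \<in> A. (t * p) ^ Suc n * a \<in> (\<lambda>b. p ^ Suc n * b) ` A}" for x y
      proof -
        obtain b c where "x \<in> A" "y \<in> A" "b \<in> A" "c \<in> A"
          "(t * p) ^ Suc n * x = p ^ Suc n * b" "(t * p) ^ Suc n * y = p ^ Suc n * c" using xy by blast
        then have "(t * p) ^ Suc n * (x + y) = p ^ Suc n * (b + c)" by (simp only: distrib_left)
        then show ?thesis using \<open>x \<in> A\<close> \<open>y \<in> A\<close> \<open>b \<in> A\<close> \<open>c \<in> A\<close> A_intros by blast
      qed
      show "r * x \<in> {a \<in> A. (t * p) ^ Suc n * a \<in> (\<lambda>b. p ^ Suc n * b) ` A}"
        if rx: "r \<in> A" "x \<in> {a \<in> A. (t * p) ^ Suc n * a \<in> (\<lambda>b. p ^ Suc n * b) ` A}" for r x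
      proof -
        obtain b where "b \<in> A" "x \<in> A" "(t * p) ^ Suc n * x = p ^ Suc n * b" using rx by blast
        then have "(t * p) ^ Suc n * (r * x) = p ^ Suc n * (r * b)" by (simp add: mult.left_commute)
        then show ?thesis using \<open>b \<in> A\<close> \<open>x \<in> A\<close> rx(1) A_intros by blast
      qed
    qed auto
    have "{x * y |x y. x \<in> z \<and> y \<in> idpow A z n} \<subseteq> {a \<in> A. (t * p) ^ Suc n * a \<in> (\<lambda>b. p ^ Suc n * b) ` A}"
    proof (clarify, intro CollectI conjI)
      fix x y assume xy: "x \<in> z" "y \<in> idpow A z n"
      then show "x * y \<in> A" using A_intros(4) point_subset ideal_subset[OF ideal_idpow] by blast
      obtain b where b: "b \<in> A" "(t * p) ^ n * y = p ^ n * b" using Suc.IH[OF xy(2)] by auto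
      have "(t * p) ^ Suc n * (x * y) = p * (t * x) * ((t * p) ^ n * y)" by (simp add: mult_ac)
      also have "\<dots> = p ^ Suc n * (t * x * b)" unfolding b(2) by (simp add: mult_ac)
      finally show "(t * p) ^ Suc n * (x * y) \<in> (\<lambda>b. p ^ Suc n * b) ` A"
        using t(2)[OF xy(1)] b A_intros by blast
    qed
    then have "gen_ideal A {x * y |x y. x \<in> z \<and> y \<in> idpow A z n}
        \<subseteq> {a \<in> A. (t * p) ^ Suc n * a \<in> (\<lambda>b. p ^ Suc n * b) ` A}"
      by (rule gen_ideal_subset[OF J])
    then show ?case using Suc.prems unfolding idpow.simps by blast
  qed auto
  have mem_idpow: "\<exists>s\<in>A - z. \<exists>b\<in>A. s * a = p ^ n * b" if "a \<in> idpow A z n" for n a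
    using idpow[OF that] notin_power[OF u, of n] by blast
  have rep: "\<exists>n. \<exists>s\<in>A - z. \<exists>b\<in>A - z. s * a = p ^ n * b" if a: "a \<in> A" "a \<noteq> 0" for a
  proof -
    \<comment> \<open>The intersection of all powers of \<open>z\<close> is zero: otherwise a t^n
      would lie in \<open>A\<close> for every n, and so would \<open>t\<close>.\<close>
    have "\<exists>n. a \<notin> idpow A z n"
    proof (rule ccontr)
      assume "\<not> ?thesis"
      then have "a * t ^ n \<in> A" for n
        using idpow[of a n] p0 by (auto simp: power_mult_distrib mult.commute)
      then show False using almost_integral_mem[of a t] t a by blast
    qed
    then obtain m where "a \<notin> idpow A z m" by blast
    moreover have "a \<in> idpow A z 0" using a by simp
    ultimately obtain n where n: "a \<in> idpow A z n" "a \<notin> idpow A z (Suc n)"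
      by (induction m) auto
    obtain s b where sb: "s \<in> A - z" "b \<in> A" "s * a = p ^ n * b" using mem_idpow[OF n(1)] by blast
    have "b \<notin> z"
    proof
      assume "b \<in> z"
      then have "b * p ^ n \<in> idpow A z (Suc n)" using idpow_mult power_mem_idpow[OF p] by blast
      then have "s * a \<in> idpow A z (Suc n)" using sb by (simp add: mult.commute)
      then show False using idpow_primary[OF sb(1) a(1)] n by blast
    qed
    then show ?thesis using sb by blast
  qed
  \<comment> \<open>Asking only \<open>b' \<in> A\<close> makes the inequality bound every power of
    \<open>z\<close> that contains a given element, as required by \<open>GREATEST\<close>.\<close>
  have unique_le: "e' \<le> e" if "s \<in> A - z" "b \<in> A - z" "s * f = p powi e * b"
    "s' \<in> A - z" "b' \<in> A" "s' * f = p powi e' * b'" for s b s' b' f e e'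
  proof (rule ccontr)
    assume "\<not> e' \<le> e"
    then have e: "e' = e + int (nat (e' - e))" "nat (e' - e) > 0" by auto
    have "p powi e * (s' * b) = s' * (s * f)" unfolding that(3) by (simp add: mult_ac)
    also have "\<dots> = s * (p powi e' * b')" using that(6) by (metis mult.left_commute)
    also have "p powi e' = p powi e * p ^ nat (e' - e)"
      using power_int_add[of p e "int (nat (e' - e))", unfolded power_int_of_nat] p0 e(1) by metis
    also have "s * (p powi e * p ^ nat (e' - e) * b') = p powi e * (p ^ nat (e' - e) * (s * b'))"
      by (simp add: mult_ac)
    finally have "s' * b = p ^ nat (e' - e) * (s * b')" using p0 by simp
    moreover have "p ^ nat (e' - e) * (s * b') \<in> z" using pow_mem e that A_intros by auto
    moreover have "s' * b \<in> A - z" using notin_mult that by blast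
    ultimately show False by simp
  qed
  have ord_ring: "ord_ring A z a = n" if "s \<in> A - z" "b \<in> A - z" "s * a = p ^ n * b" "a \<in> A" for s b a n
    unfolding ord_ring_def
  proof (rule Greatest_equality)
    have "p ^ n * b \<in> idpow A z n"
      using ideal_mult_right[OF ideal_idpow] power_mem_idpow[OF p] that by blast
    then show "a \<in> idpow A z n" using idpow_primary that by metis
    show "k \<le> n" if k: "a \<in> idpow A z k" for k
    proof -
      obtain s' b' where "s' \<in> A - z" "b' \<in> A" "s' * a = p ^ k * b'" using mem_idpow[OF k] by blast
      then show ?thesis using unique_le[of s b a "int n" s' b' "int k"] \<open>s \<in> A - z\<close> \<open>b \<in> A - z\<close> \<open>s * a = p ^ n * b\<close>
        by simp
    qed
  qed
  have ord_at: "\<exists>s\<in>A - z. \<exists>b\<in>A - z. s * f = p powi ord_at A z f * b" if f: "f \<noteq> 0" for f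
  proof -
    have "\<exists>x. (case x of (a, b) \<Rightarrow> a \<in> A \<and> b \<in> A \<and> b \<noteq> 0 \<and> f = a / b)"
      using fractions by force
    then have "case (SOME (a, b). a \<in> A \<and> b \<in> A \<and> b \<noteq> 0 \<and> f = a / b) of
        (a, b) \<Rightarrow> a \<in> A \<and> b \<in> A \<and> b \<noteq> 0 \<and> f = a / b"
      by (rule someI_ex)
    then obtain a b where ab: "(SOME (a, b). a \<in> A \<and> b \<in> A \<and> b \<noteq> 0 \<and> f = a / b) = (a, b)"
      "a \<in> A" "b \<in> A" "b \<noteq> 0" "f = a / b" by (auto split: prod.splits)
    obtain n s c where 1: "s \<in> A - z" "c \<in> A - z" "s * a = p ^ n * c" using rep[of a] ab f by auto
    obtain m s' c' where 2: "s' \<in> A - z" "c' \<in> A - z" "s' * b = p ^ m * c'" using rep[of b] ab by auto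
    have "ord_at A z f = int n - int m"
      unfolding ord_at_def ab(1) using ord_ring[OF 1] ord_ring[OF 2] ab by simp
    moreover have "(s * c') * f = p powi (int n - int m) * (s' * c)"
    proof -
      have "s \<noteq> 0" "s' \<noteq> 0" "c' \<noteq> 0" using A0 1 2 by auto
      then have a: "a = p ^ n * c / s" and b: "b = p ^ m * c' / s'" using 1 2 by (auto simp: field_simps)
      show ?thesis unfolding ab(5) a b using p0 \<open>s \<noteq> 0\<close> \<open>s' \<noteq> 0\<close> \<open>c' \<noteq> 0\<close>
        by (simp add: power_int_diff field_simps)
    qed
    moreover have "s * c' \<in> A - z" "s' * c \<in> A - z" using 1 2 notin_mult by auto
    ultimately show ?thesis by metis
  qed
  show ?thesis
  proof (rule that[OF p p0 ord_at])
    fix f e s b assume 1: "s \<in> A - z" "b \<in> A - z" "s * f = p powi e * b"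
    then have "f \<noteq> 0" using A0 p0 by auto
    then obtain s' b' where 2: "s' \<in> A - z" "b' \<in> A - z" "s' * f = p powi ord_at A z f * b'" using ord_at by blast
    show "ord_at A z f = e" using unique_le[OF 1] unique_le[OF 2] 1 2 by (meson DiffE order_antisym)
  qed
qed

lemma ord_mult:
  assumes "f \<noteq> 0" "g \<noteq> 0"
  shows "ord_at A z (f * g) = ord_at A z f + ord_at A z g"
proof -
  obtain p where "p \<in> z" and p: "p \<noteq> 0"
    "\<And>f. f \<noteq> 0 \<Longrightarrow> \<exists>s\<in>A - z. \<exists>b\<in>A - z. s * f = p powi ord_at A z f * b"
    "\<And>f e s b. s \<in> A - z \<Longrightarrow> b \<in> A - z \<Longrightarrow> s * f = p powi e * b \<Longrightarrow> ord_at A z f = e"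
    by (fact ex_uniformizer)
  obtain s b s' b' where *: "s \<in> A - z" "b \<in> A - z" "s * f = p powi ord_at A z f * b"
     "s' \<in> A - z" "b' \<in> A - z" "s' * g = p powi ord_at A z g * b'"
    using p(2) assms by metis
  have "(s * s') * (f * g) = (s * f) * (s' * g)" by (simp add: mult_ac)
  also have "\<dots> = (p powi ord_at A z f * b) * (p powi ord_at A z g * b')" by (simp only: *)
  also have "\<dots> = p powi (ord_at A z f + ord_at A z g) * (b * b')"
    by (simp add: power_int_add p(1) mult_ac)
  finally show ?thesis by (rule p(3)[OF notin_mult[OF *(1,4)] notin_mult[OF *(2,5)]])
qed

lemma ord_one: "ord_at A z 1 = 0"
  using ord_mult[of 1 1] by simp

lemma ord_power: "f \<noteq> 0 \<Longrightarrow> ord_at A z (f ^ n) = int n * ord_at A z f"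
  by (induction n) (auto simp: ord_one ord_mult algebra_simps)

lemma ord_inverse: "f \<noteq> 0 \<Longrightarrow> ord_at A z (inverse f) = - ord_at A z f"
  using ord_mult[of f "inverse f"] by (simp add: ord_one)

lemma ord_divide: "f \<noteq> 0 \<Longrightarrow> g \<noteq> 0 \<Longrightarrow> ord_at A z (f / g) = ord_at A z f - ord_at A z g"
  by (simp add: divide_inverse ord_mult ord_inverse)

lemma ord_prod: "(\<And>i. i \<in> I \<Longrightarrow> f i \<noteq> 0) \<Longrightarrow> ord_at A z (\<Prod>i\<in>I. f i) = (\<Sum>i\<in>I. ord_at A z (f i))"
  by (induction I rule: infinite_finite_induct) (auto simp: ord_one ord_mult)

text \<open>The right-hand side is membership in the localization at \<open>z\<close>, expressed by
  a denominator outside \<open>z\<close>.\<close>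

lemma ord_nonneg_iff:
  assumes "f \<noteq> 0"
  shows "ord_at A z f \<ge> 0 \<longleftrightarrow> (\<exists>s\<in>A - z. s * f \<in> A)"
proof -
  obtain p where p: "p \<in> z" "p \<noteq> 0"
    "\<And>f. f \<noteq> 0 \<Longrightarrow> \<exists>s\<in>A - z. \<exists>b\<in>A - z. s * f = p powi ord_at A z f * b"
    "\<And>f e s b. s \<in> A - z \<Longrightarrow> b \<in> A - z \<Longrightarrow> s * f = p powi e * b \<Longrightarrow> ord_at A z f = e"
    by (fact ex_uniformizer)
  obtain s b where sb: "s \<in> A - z" "b \<in> A - z" "s * f = p powi ord_at A z f * b" using p(3) assms by blast
  show ?thesis
  proof
    assume "ord_at A z f \<ge> 0"
    then have "p powi ord_at A z f \<in> A" using p(1) point_subset A_intros by (simp add: power_int_def)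
    then show "\<exists>s\<in>A - z. s * f \<in> A" using sb A_intros by (intro bexI[of _ s]) auto
  next
    assume "\<exists>s\<in>A - z. s * f \<in> A"
    then obtain s' where s': "s' \<in> A - z" "s' * f \<in> A" by blast
    show "ord_at A z f \<ge> 0"
    proof (rule ccontr)
      assume neg: "\<not> ?thesis"
      then obtain k where k: "ord_at A z f = - int (Suc k)" by (metis negD not_le)
      have "p ^ Suc k * (s * f) = b"
        using p(2) unfolding sb(3) k by (simp add: power_int_minus field_simps del: of_nat_Suc)
      then have "s' * b = p * (p ^ k * (s * (s' * f)))" by (metis mult.assoc mult.left_commute power_Suc)
      moreover have "p * (p ^ k * (s * (s' * f))) \<in> z"
        using ideal_mult_right[OF ideal] p(1) s' sb A_intros point_subset by simp
      moreover have "s' * b \<in> A - z" using notin_mult s' sb by blast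
      ultimately show False by (metis DiffD2)
    qed
  qed
qed

lemma ord_nonneg: "a \<in> A \<Longrightarrow> a \<noteq> 0 \<Longrightarrow> ord_at A z a \<ge> 0"
  using ord_nonneg_iff[of a] one_notin A_intros(2) by (metis DiffI mult_1)

lemma ex_ord_eq_1: "\<exists>p\<in>z. p \<noteq> 0 \<and> ord_at A z p = 1"
proof -
  obtain p where p: "p \<in> z" "p \<noteq> 0"
    "\<And>f. f \<noteq> 0 \<Longrightarrow> \<exists>s\<in>A - z. \<exists>b\<in>A - z. s * f = p powi ord_at A z f * b"
    "\<And>f e s b. s \<in> A - z \<Longrightarrow> b \<in> A - z \<Longrightarrow> s * f = p powi e * b \<Longrightarrow> ord_at A z f = e"
    by (fact ex_uniformizer)
  have "ord_at A z p = 1" using p(4)[of 1 1 p 1] one_notin A_intros(2) by simp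
  then show ?thesis using p by blast
qed

lemma ord_eq_0:
  assumes "a \<in> A - z"
  shows "ord_at A z a = 0"
proof -
  have a0: "a \<noteq> 0" using assms zero_in by auto
  have "ord_at A z (inverse a) \<ge> 0"
    using ord_nonneg_iff[of "inverse a"] a0 assms A_intros(2) by (auto intro!: bexI[of _ a])
  then show ?thesis using ord_nonneg[of a] assms a0 by (simp add: ord_inverse)
qed

lemma ord_pos:
  assumes "a \<in> z" "a \<noteq> 0"
  shows "ord_at A z a \<ge> 1"
proof (rule ccontr)
  assume "\<not> ?thesis"
  then have "ord_at A z (inverse a) \<ge> 0" using assms by (simp add: ord_inverse)
  then obtain s where s: "s \<in> A - z" "s * inverse a \<in> A" using ord_nonneg_iff[of "inverse a"] assms by auto
  then have "(s * inverse a) * a \<in> z" using ideal_mult[OF ideal] assms by blast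
  then show False using s assms by (simp add: mult.assoc)
qed

lemma ord_add_nonneg:
  assumes "f \<noteq> 0" "g \<noteq> 0" "f + g \<noteq> 0" "ord_at A z f \<ge> 0" "ord_at A z g \<ge> 0"
  shows "ord_at A z (f + g) \<ge> 0"
proof -
  obtain s s' where s: "s \<in> A - z" "s * f \<in> A" "s' \<in> A - z" "s' * g \<in> A"
    using assms ord_nonneg_iff by metis
  have "(s * s') * (f + g) = s' * (s * f) + s * (s' * g)" by (simp add: algebra_simps)
  also have "\<dots> \<in> A" using s A_intros by auto
  finally show ?thesis using ord_nonneg_iff[OF assms(3)] notin_mult s by blast
qed

lemma ord_add:
  assumes "f \<noteq> 0" "g \<noteq> 0" "f + g \<noteq> 0"
  shows "ord_at A z (f + g) \<ge> min (ord_at A z f) (ord_at A z g)"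
proof -
  have *: "ord_at A z (f + g) \<ge> ord_at A z f"
    if "f \<noteq> 0" "g \<noteq> 0" "f + g \<noteq> 0" "ord_at A z f \<le> ord_at A z g" for f g
  proof -
    \<comment> \<open>Factoring out the term of smaller order reduces the claim to summands of
      nonnegative order.\<close>
    have eq: "f + g = f * (1 + g / f)" using that by (simp add: field_simps)
    then have "1 + g / f \<noteq> 0" using that by auto
    then have "ord_at A z (1 + g / f) \<ge> 0"
      using that by (intro ord_add_nonneg) (auto simp: ord_one ord_divide)
    then show ?thesis using \<open>1 + g / f \<noteq> 0\<close> that(1) by (subst eq) (simp add: ord_mult)
  qed
  show ?thesis using *[of f g] *[of g f] assms by (auto simp: min_def add.commute)
qed

end

section \<open>All closed points together: membership, finiteness and approximation\<close>

lemma closed_pts_nonempty: "closed_pts A \<noteq> {}"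
proof -
  have "ideal_in A {0}" using A_intros by (auto simp: ideal_in_def)
  moreover have "{0} \<noteq> A" using A_intros(2) by auto
  ultimately obtain P where "maximal_in A P" using maximal_ideal_exists[OF noetherian subring] by blast
  then show ?thesis by (auto simp: closed_pts_def)
qed

text \<open>The denominators of \<open>f\<close> form an ideal of \<open>A\<close>, and nonnegative
  order at \<open>z\<close> provides one outside \<open>z\<close>; so 1 is a denominator.\<close>

lemma mem_iff_ord_nonneg:
  assumes "f \<noteq> 0"
  shows "f \<in> A \<longleftrightarrow> (\<forall>z\<in>closed_pts A. ord_at A z f \<ge> 0)"
proof
  assume ord: "\<forall>z\<in>closed_pts A. ord_at A z f \<ge> 0"
  let ?I = "{s \<in> A. s * f \<in> A}"
  have "ideal_in A ?I"
    unfolding ideal_in_def using A_intros by (auto simp: distrib_right mult.assoc)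
  then have "1 \<in> ?I"
  proof (rule ideal_eq_ring_if_not_in_maximal[OF noetherian subring])
    fix P assume "maximal_in A P"
    then show "\<exists>s\<in>?I. s \<notin> P"
      using ord ord_nonneg_iff[of P f] assms by (auto simp: closed_pts_def)
  qed
  then show "f \<in> A" by simp
qed (use ord_nonneg assms in blast)

text \<open>Infinitely many such points would give elements t_n with a pole at the n-th point only.
  All t_n a lie in \<open>A\<close>, so some t_N is an \<open>A\<close>-combination of earlier ones,
  none of which has a pole at the N-th point.\<close>

lemma finite_points_containing:
  assumes a: "a \<in> A" "a \<noteq> 0"
  shows "finite {z \<in> closed_pts A. a \<in> z}"
proof (rule ccontr)
  assume "infinite {z \<in> closed_pts A. a \<in> z}"
  then obtain Z :: "nat \<Rightarrow> 'k set" where Z: "inj Z" "\<And>n. Z n \<in> closed_pts A" "\<And>n. a \<in> Z n"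
    using infinite_countable_subset[of "{z \<in> closed_pts A. a \<in> z}"] by blast
  have "\<exists>t. t \<notin> A \<and> (\<forall>x\<in>Z n. t * x \<in> A)" for n using ex_inverse_element Z by blast
  then obtain t where t: "\<And>n. t n \<notin> A" "\<And>n x. x \<in> Z n \<Longrightarrow> t n * x \<in> A" by metis
  have t0: "t n \<noteq> 0" for n using t(1)[of n] A_intros(1) by auto
  have nonneg: "ord_at A (Z m) (t n) \<ge> 0" if "m \<noteq> n" for m n
  proof -
    have "Z m \<noteq> Z n" using Z(1) that by (auto dest: injD)
    then have "\<not> Z n \<subseteq> Z m"
      using Z(2)[of m] Z(2)[of n] by (auto simp: closed_pts_def maximal_in_def)
    then obtain w where "w \<in> Z n" "w \<notin> Z m" by blast
    then show ?thesis using ord_nonneg_iff[OF Z(2) t0] t(2)[of w n] point_subset[OF Z(2)]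
      by (auto simp: mult.commute)
  qed
  have neg: "ord_at A (Z n) (t n) < 0" for n
  proof (rule ccontr)
    assume "\<not> ?thesis"
    then have "\<forall>z\<in>closed_pts A. ord_at A z (t n) \<ge> 0"
    proof (intro ballI)
      fix z assume z: "z \<in> closed_pts A"
      assume *: "\<not> ord_at A (Z n) (t n) < 0"
      show "ord_at A z (t n) \<ge> 0"
      proof (cases "z = Z n")
        case False
        then have "\<not> Z n \<subseteq> z" using z Z(2)[of n] by (auto simp: closed_pts_def maximal_in_def)
        then obtain w where "w \<in> Z n" "w \<notin> z" by blast
        then show ?thesis using ord_nonneg_iff[OF z t0] t(2)[of w n] point_subset[OF Z(2)]
          by (auto simp: mult.commute)
      qed (use * in simp)
    qed
    then show False using mem_iff_ord_nonneg[OF t0] t(1) by blast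
  qed
  obtain N :: nat and c where c: "\<And>i. i < N \<Longrightarrow> c i \<in> A" "t N * a = (\<Sum>i<N. c i * (t i * a))"
    using noetherian_sequence[OF noetherian subring, of "\<lambda>n. t n * a"] t(2) Z(3) by blast
  have "t N = (\<Sum>i<N. c i * t i)"
  proof -
    have "t N * a = (\<Sum>i<N. c i * t i) * a" unfolding c(2) sum_distrib_right by (simp add: mult_ac)
    then show ?thesis using a by simp
  qed
  moreover have "(\<Sum>i\<in>I. c i * t i) = 0 \<or> ord_at A (Z N) (\<Sum>i\<in>I. c i * t i) \<ge> 0" if "finite I" "I \<subseteq> {..<N}" for I
    using that
  proof (induction I rule: finite_induct)
    case (insert i I)
    have i: "c i = 0 \<or> ord_at A (Z N) (c i * t i) \<ge> 0"
      using c(1)[of i] ord_nonneg[OF Z(2), of "c i" N] nonneg[of N i] insert.prems t0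
      by (cases "c i = 0") (auto simp: ord_mult[OF Z(2)])
    show ?case using insert i ord_add_nonneg[OF Z(2), of "c i * t i" "\<Sum>i\<in>I. c i * t i" N] t0 by fastforce
  qed auto
  ultimately show False using neg[of N] t0[of N] by (metis finite_lessThan not_le order_refl)
qed

lemma finite_ord_nonzero:
  assumes "f \<noteq> 0"
  shows "finite {z \<in> closed_pts A. ord_at A z f \<noteq> 0}"
proof -
  obtain a b where ab: "a \<in> A" "b \<in> A" "b \<noteq> 0" "f = a / b" using fractions by blast
  then have "a \<noteq> 0" using assms by auto
  have "{z \<in> closed_pts A. ord_at A z f \<noteq> 0} \<subseteq> {z \<in> closed_pts A. a \<in> z} \<union> {z \<in> closed_pts A. b \<in> z}"
  proof -
    have "ord_at A z f = 0" if "z \<in> closed_pts A" "a \<notin> z" "b \<notin> z" for z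
      using that ab \<open>a \<noteq> 0\<close> ord_eq_0[of z a] ord_eq_0[of z b] by (simp add: ord_divide)
    then show ?thesis by blast
  qed
  then show ?thesis
    using finite_points_containing ab \<open>a \<noteq> 0\<close> by (meson finite_UnI finite_subset)
qed

lemma ex_large_ord:
  assumes "finite Z" "Z \<subseteq> closed_pts A"
  obtains d where "d \<in> A" "d \<noteq> 0" "\<And>z. z \<in> Z \<Longrightarrow> ord_at A z d \<ge> int n"
proof -
  have "\<exists>w. w \<in> z \<and> w \<noteq> 0" if "z \<in> Z" for z using point_nonzero assms that by blast
  then obtain w where w: "\<And>z. z \<in> Z \<Longrightarrow> w z \<in> z \<and> w z \<noteq> 0" by metis
  define d where "d = (\<Prod>z\<in>Z. w z ^ n)"
  have wA: "w z \<in> A" if "z \<in> Z" for z using w that assms point_subset by blast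
  have ordw: "ord_at A z' (w z) \<ge> 0" if "z' \<in> closed_pts A" "z \<in> Z" for z z'
    using ord_nonneg that w wA by blast
  show ?thesis
  proof (rule that[of d])
    show "d \<in> A" unfolding d_def using wA by (auto intro!: subring_prod[OF subring] subring_power[OF subring])
    show "d \<noteq> 0" unfolding d_def using w assms by simp
    fix z assume z: "z \<in> Z"
    then have zc: "z \<in> closed_pts A" using assms by blast
    have "int n \<le> int n * ord_at A z (w z)"
      using ord_pos[OF zc] w[OF z] mult_left_mono[of 1 "ord_at A z (w z)" "int n"] by simp
    also have "\<dots> = (\<Sum>y\<in>{z}. ord_at A z (w y ^ n))" using w[OF z] by (simp add: ord_power[OF zc])
    also have "\<dots> \<le> (\<Sum>y\<in>Z. ord_at A z (w y ^ n))"
      using assms z w ordw[OF zc] by (intro sum_mono2) (auto simp: ord_power[OF zc])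
    also have "\<dots> = ord_at A z d" unfolding d_def using w by (subst ord_prod[OF zc]) auto
    finally show "ord_at A z d \<ge> int n" .
  qed
qed

text \<open>A power of a uniformizer has order \<open>j\<close> at \<open>z0\<close>. A product of
  elements that lie in the other relevant points but not in \<open>z0\<close> then repairs the
  orders there and leaves \<open>z0\<close> untouched.\<close>

lemma ex_ord_prescribed:
  assumes z0: "z0 \<in> closed_pts A" and Z: "finite Z" "Z \<subseteq> closed_pts A"
  obtains g where "g \<noteq> 0" "ord_at A z0 g = j"
    "\<And>z. z \<in> closed_pts A \<Longrightarrow> z \<noteq> z0 \<Longrightarrow> ord_at A z g \<ge> 0"
    "\<And>z. z \<in> Z \<Longrightarrow> z \<noteq> z0 \<Longrightarrow> ord_at A z g \<ge> int n"
proof -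
  obtain p where p: "p \<noteq> 0" "ord_at A z0 p = 1" using ex_ord_eq_1[OF z0] by blast
  define q where "q = p powi j"
  have q0: "q \<noteq> 0" using p by (simp add: q_def)
  have ordq: "ord_at A z0 q = j"
    using p by (auto simp: q_def power_int_def ord_power[OF z0] ord_inverse[OF z0])
  define T where "T = (Z \<union> {z \<in> closed_pts A. ord_at A z q \<noteq> 0}) - {z0}"
  have T: "finite T" "T \<subseteq> closed_pts A" unfolding T_def using Z finite_ord_nonzero[OF q0] by auto
  \<comment> \<open>Outweighs every pole of \<open>q\<close> in \<open>T\<close> and still leaves
    \<open>n\<close> to spare.\<close>
  define N where "N = n + (\<Sum>z\<in>T. nat \<bar>ord_at A z q\<bar>)"
  have "\<exists>w. w \<in> z \<and> w \<in> A - z0" if "z \<in> T" for z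
  proof -
    have "\<not> z \<subseteq> z0" using that T(2) z0 by (auto simp: closed_pts_def maximal_in_def T_def)
    then show ?thesis using point_subset that T(2) by blast
  qed
  then obtain w where w: "\<And>z. z \<in> T \<Longrightarrow> w z \<in> z \<and> w z \<in> A - z0" by metis
  have w0: "w z \<noteq> 0" if "z \<in> T" for z using w[OF that] zero_in[OF z0] by auto
  define d where "d = (\<Prod>z\<in>T. w z ^ N)"
  have d0: "d \<noteq> 0" unfolding d_def using w0 T by simp
  have ordw: "ord_at A z' (w z) \<ge> 0" if "z' \<in> closed_pts A" "z \<in> T" for z z'
    using ord_nonneg that w w0 by blast
  have ordd: "ord_at A z d = (\<Sum>y\<in>T. int N * ord_at A z (w y))" if "z \<in> closed_pts A" for z
    unfolding d_def using w0 by (subst ord_prod[OF that]) (auto simp: ord_power[OF that] intro!: sum.cong)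
  have dge: "ord_at A z d \<ge> 0" if "z \<in> closed_pts A" for z
    unfolding ordd[OF that] using ordw[OF that] by (intro sum_nonneg) auto
  have big: "ord_at A z d \<ge> int N" if "z \<in> T" for z
  proof -
    have zc: "z \<in> closed_pts A" using T that by blast
    have "int N \<le> int N * ord_at A z (w z)"
      using ord_pos[OF zc] w[OF that] w0[OF that] mult_left_mono[of 1 "ord_at A z (w z)" "int N"] by simp
    also have "\<dots> \<le> (\<Sum>y\<in>T. int N * ord_at A z (w y))"
      using sum_mono2[of T "{z}" "\<lambda>y. int N * ord_at A z (w y)"] T(1) that ordw[OF zc] by simp
    finally show ?thesis using ordd[OF zc] by simp
  qed
  have sumT: "int n \<le> ord_at A z (q * d)" if "z \<in> T" for z
  proof -
    have zc: "z \<in> closed_pts A" using T that by blast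
    have "\<bar>ord_at A z q\<bar> \<le> (\<Sum>z\<in>T. \<bar>ord_at A z q\<bar>)"
      using T(1) that by (intro member_le_sum) auto
    then show ?thesis using big[OF that] q0 d0 by (simp add: ord_mult[OF zc] N_def)
  qed
  show ?thesis
  proof (rule that[of "q * d"])
    show "q * d \<noteq> 0" using q0 d0 by simp
    have "ord_at A z0 d = 0" unfolding ordd[OF z0] using w ord_eq_0[OF z0] by (intro sum.neutral) auto
    then show "ord_at A z0 (q * d) = j" using q0 d0 ordq by (simp add: ord_mult[OF z0])
    fix z assume z: "z \<noteq> z0"
    { assume zc: "z \<in> closed_pts A"
      show "ord_at A z (q * d) \<ge> 0"
      proof (cases "z \<in> T")
        case False
        then have "ord_at A z q = 0" using z zc by (auto simp: T_def)
        then show ?thesis using dge[OF zc] q0 d0 by (simp add: ord_mult[OF zc])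
      qed (use sumT in force) }
    { assume "z \<in> Z"
      then show "ord_at A z (q * d) \<ge> int n" using sumT z by (auto simp: T_def) }
  qed
qed

end

section \<open>Laurent polynomials\<close>

lemma poly_mapping_eq_sum_single: "x = (\<Sum>m\<in>Poly_Mapping.keys x. Poly_Mapping.single m (Poly_Mapping.lookup x m))"
  by (rule poly_mapping_eqI) (auto simp: lookup_sum lookup_single when_def in_keys_iff)

lemma lookup_single_mult:
  fixes y :: "'m::ab_group_add \<Rightarrow>\<^sub>0 'k::comm_ring_1"
  shows "Poly_Mapping.lookup (Poly_Mapping.single a c * y) m = c * Poly_Mapping.lookup y (m - a)"
proof -
  have "m = a + q \<longleftrightarrow> q = m - a" for q by (auto simp: algebra_simps)
  then show ?thesis
    by (simp add: lookup_mult lookup_single when_mult)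
qed

lemma lookup_mult_sum:
  fixes x y :: "'m::ab_group_add \<Rightarrow>\<^sub>0 'k::comm_ring_1"
  assumes "finite K" "Poly_Mapping.keys x \<subseteq> K"
  shows "Poly_Mapping.lookup (x * y) m = (\<Sum>a\<in>K. Poly_Mapping.lookup x a * Poly_Mapping.lookup y (m - a))"
proof -
  have "x * y = (\<Sum>a\<in>Poly_Mapping.keys x. Poly_Mapping.single a (Poly_Mapping.lookup x a) * y)"
    by (subst poly_mapping_eq_sum_single[of x]) (rule sum_distrib_right)
  then have "Poly_Mapping.lookup (x * y) m
      = (\<Sum>a\<in>Poly_Mapping.keys x. Poly_Mapping.lookup x a * Poly_Mapping.lookup y (m - a))"
    by (simp add: lookup_sum lookup_single_mult)
  also have "\<dots> = (\<Sum>a\<in>K. Poly_Mapping.lookup x a * Poly_Mapping.lookup y (m - a))"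
    using assms by (intro sum.mono_neutral_left) (auto simp: in_keys_iff)
  finally show ?thesis .
qed

text \<open>If \<open>c\<close> vanishes on the new vector \<open>s\<close>, it is replaced by K c +
  s. On \<open>s\<close> this is the positive number s.s; on an old vector x the nonzero integer
  c.x, multiplied by K, exceeds s.x in absolute value.\<close>

lemma ex_nonvanishing_functional:
  fixes S :: "(int^'n::finite) set"
  assumes "finite S" "0 \<notin> S"
  shows "\<exists>c::int^'n. \<forall>s\<in>S. (\<Sum>i\<in>UNIV. c $ i * s $ i) \<noteq> 0"
  using assms
proof (induction S rule: finite_induct)
  case (insert s S)
  then obtain c :: "int^'n" where c: "\<And>x. x \<in> S \<Longrightarrow> (\<Sum>i\<in>UNIV. c $ i * x $ i) \<noteq> 0" by auto
  show ?case
  proof (cases "(\<Sum>i\<in>UNIV. c $ i * s $ i) = 0")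
    case False
    then show ?thesis using c by auto
  next
    case True
    define K where "K = 1 + (\<Sum>x\<in>S. \<bar>\<Sum>i\<in>UNIV. s $ i * x $ i\<bar>)"
    define c' where "c' = (\<chi> i. K * c $ i + s $ i)"
    have c': "(\<Sum>i\<in>UNIV. c' $ i * x $ i) = K * (\<Sum>i\<in>UNIV. c $ i * x $ i) + (\<Sum>i\<in>UNIV. s $ i * x $ i)" for x
      by (simp add: c'_def algebra_simps sum.distrib sum_distrib_left)
    have "(\<Sum>i\<in>UNIV. c' $ i * x $ i) \<noteq> 0" if x: "x \<in> S" for x
    proof
      assume "(\<Sum>i\<in>UNIV. c' $ i * x $ i) = 0"
      then have "K * (\<Sum>i\<in>UNIV. c $ i * x $ i) = - (\<Sum>i\<in>UNIV. s $ i * x $ i)" unfolding c' by simp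
      then have "\<bar>K\<bar> * \<bar>\<Sum>i\<in>UNIV. c $ i * x $ i\<bar> = \<bar>\<Sum>i\<in>UNIV. s $ i * x $ i\<bar>"
        by (metis abs_minus_cancel abs_mult)
      moreover have "\<bar>\<Sum>i\<in>UNIV. s $ i * x $ i\<bar> < K"
        unfolding K_def using member_le_sum[OF x, of "\<lambda>x. \<bar>\<Sum>i\<in>UNIV. s $ i * x $ i\<bar>"] insert.hyps by simp
      moreover have "\<bar>\<Sum>i\<in>UNIV. c $ i * x $ i\<bar> \<ge> 1" using c[OF x] by linarith
      then have "\<bar>K\<bar> * 1 \<le> \<bar>K\<bar> * \<bar>\<Sum>i\<in>UNIV. c $ i * x $ i\<bar>" by (intro mult_left_mono) auto
      ultimately show False by linarith
    qed
    moreover have "(\<Sum>i\<in>UNIV. c' $ i * s $ i) \<noteq> 0"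
    proof
      assume "(\<Sum>i\<in>UNIV. c' $ i * s $ i) = 0"
      then have "(\<Sum>i\<in>UNIV. s $ i * s $ i) = 0" unfolding c' True by simp
      then have "\<forall>i\<in>UNIV. s $ i * s $ i = 0" by (subst (asm) sum_nonneg_eq_0_iff) auto
      then show False using insert.prems by (auto simp: vec_eq_iff)
    qed
    ultimately show ?thesis by auto
  qed
qed auto

subsection \<open>Monomial valuations\<close>

text \<open>Covers the order at \<open>z\<close> combined with a rational point v of N_Q, and also,
  with trivial \<open>val\<close>, a vector of the cone. With both functions zero, Gauss' lemma says
  that Laurent polynomials have no zero divisors.\<close>

locale monomial_valuation =
  fixes val :: "'k::field \<Rightarrow> rat" and wt :: "int^'n::finite \<Rightarrow> rat"
  assumes val_mult: "a \<noteq> 0 \<Longrightarrow> b \<noteq> 0 \<Longrightarrow> val (a * b) = val a + val b"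
    and val_add: "a \<noteq> 0 \<Longrightarrow> b \<noteq> 0 \<Longrightarrow> a + b \<noteq> 0 \<Longrightarrow> min (val a) (val b) \<le> val (a + b)"
    and wt_add: "wt (m + m') = wt m + wt m'"
begin

lemma val_1: "val 1 = 0" using val_mult[of 1 1] by simp

lemma val_uminus: "a \<noteq> 0 \<Longrightarrow> val (- a) = val a"
  using val_mult[of "- 1" a] val_mult[of "- 1" "- 1"] val_1 by simp

lemma wt_0: "wt 0 = 0" using wt_add[of 0 0] by simp

lemma wt_diff: "wt (m - m') = wt m - wt m'" using wt_add[of "m - m'" m'] by simp

lemma val_sum_ge:
  assumes "\<And>i. i \<in> I \<Longrightarrow> f i = 0 \<or> val (f i) \<ge> t"
  shows "(\<Sum>i\<in>I. f i) = 0 \<or> val (\<Sum>i\<in>I. f i) \<ge> t"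
  using assms
proof (induction I rule: infinite_finite_induct)
  case (insert i I)
  have "f i = 0 \<or> val (f i) \<ge> t" "(\<Sum>i\<in>I. f i) = 0 \<or> val (\<Sum>i\<in>I. f i) \<ge> t"
    using insert by auto
  then show ?case using insert.hyps val_add[of "f i" "\<Sum>i\<in>I. f i"]
    by (cases "f i = 0"; cases "(\<Sum>i\<in>I. f i) = 0"; cases "f i + (\<Sum>i\<in>I. f i) = 0") (auto simp: min_def split: if_splits)
qed auto

lemma val_sum_gt:
  assumes "\<And>i. i \<in> I \<Longrightarrow> f i = 0 \<or> val (f i) > t"
  shows "(\<Sum>i\<in>I. f i) = 0 \<or> val (\<Sum>i\<in>I. f i) > t"
  using assms
proof (induction I rule: infinite_finite_induct)
  case (insert i I)
  have "f i = 0 \<or> val (f i) > t" "(\<Sum>i\<in>I. f i) = 0 \<or> val (\<Sum>i\<in>I. f i) > t"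
    using insert by auto
  then show ?case using insert.hyps val_add[of "f i" "\<Sum>i\<in>I. f i"]
    by (cases "f i = 0"; cases "(\<Sum>i\<in>I. f i) = 0"; cases "f i + (\<Sum>i\<in>I. f i) = 0") (auto simp: min_def split: if_splits)
qed auto

definition weight :: "(int^'n \<Rightarrow>\<^sub>0 'k) \<Rightarrow> int^'n \<Rightarrow> rat" where
  "weight x m = val (Poly_Mapping.lookup x m) + wt m"

definition ge :: "rat \<Rightarrow> (int^'n \<Rightarrow>\<^sub>0 'k) \<Rightarrow> bool" where
  "ge t x \<longleftrightarrow> (\<forall>m\<in>Poly_Mapping.keys x. weight x m \<ge> t)"

text \<open>The valuation of \<open>x\<close> equals \<open>t\<close>. A relation is used so that 0
  needs no value.\<close>

definition attains :: "rat \<Rightarrow> (int^'n \<Rightarrow>\<^sub>0 'k) \<Rightarrow> bool" where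
  "attains t x \<longleftrightarrow> ge t x \<and> (\<exists>m\<in>Poly_Mapping.keys x. weight x m = t)"

lemma ex_attains:
  assumes "x \<noteq> 0"
  shows "\<exists>t. attains t x"
proof -
  let ?W = "weight x ` Poly_Mapping.keys x"
  have "Min ?W \<in> ?W" using assms by (intro Min_in) auto
  then have "attains (Min ?W) x" unfolding attains_def ge_def by auto
  then show ?thesis by blast
qed

lemma attains_imp_nonzero: "attains t x \<Longrightarrow> x \<noteq> 0"
  by (auto simp: attains_def)

lemma ge_attains: "ge t x \<Longrightarrow> attains t' x \<Longrightarrow> t \<le> t'"
  by (auto simp: attains_def ge_def)

lemma ge_mono: "ge t x \<Longrightarrow> t' \<le> t \<Longrightarrow> ge t' x"
  by (force simp: ge_def)

lemma ge_sum: "(\<And>i. i \<in> I \<Longrightarrow> ge t (f i)) \<Longrightarrow> ge t (\<Sum>i\<in>I. f i)"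
  unfolding ge_def
proof
  fix m assume f: "\<And>i. i \<in> I \<Longrightarrow> \<forall>m\<in>Poly_Mapping.keys (f i). t \<le> weight (f i) m"
    and m: "m \<in> Poly_Mapping.keys (\<Sum>i\<in>I. f i)"
  have "(\<Sum>i\<in>I. Poly_Mapping.lookup (f i) m) = 0 \<or> val (\<Sum>i\<in>I. Poly_Mapping.lookup (f i) m) \<ge> t - wt m"
    using f by (intro val_sum_ge) (force simp: weight_def in_keys_iff)
  then show "t \<le> weight (\<Sum>i\<in>I. f i) m"
    using m by (auto simp: in_keys_iff lookup_sum weight_def)
qed

lemma ge_mult:
  assumes "ge t x" "ge t' y"
  shows "ge (t + t') (x * y)"
  unfolding ge_def
proof
  fix m assume m: "m \<in> Poly_Mapping.keys (x * y)"
  have "(\<Sum>a\<in>Poly_Mapping.keys x. Poly_Mapping.lookup x a * Poly_Mapping.lookup y (m - a)) = 0 \<or>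
    val (\<Sum>a\<in>Poly_Mapping.keys x. Poly_Mapping.lookup x a * Poly_Mapping.lookup y (m - a)) \<ge> t + t' - wt m"
  proof (rule val_sum_ge)
    fix a assume a: "a \<in> Poly_Mapping.keys x"
    show "Poly_Mapping.lookup x a * Poly_Mapping.lookup y (m - a) = 0 \<or>
        t + t' - wt m \<le> val (Poly_Mapping.lookup x a * Poly_Mapping.lookup y (m - a))"
    proof (cases "Poly_Mapping.lookup y (m - a) = 0")
      case False
      then have "weight x a \<ge> t" "weight y (m - a) \<ge> t'" using assms a by (auto simp: ge_def in_keys_iff)
      then show ?thesis using False a by (simp add: weight_def wt_diff val_mult in_keys_iff)
    qed simp
  qed
  then show "t + t' \<le> weight (x * y) m"
    using m by (auto simp: in_keys_iff lookup_mult_sum[of "Poly_Mapping.keys x"] weight_def)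
qed

text \<open>Gauss' lemma: among the terms of minimal weight, a generic linear functional singles out
  one leading term in each factor, whose product cannot be cancelled.\<close>

theorem attains_mult:
  assumes x: "attains t x" and y: "attains t' y"
  shows "attains (t + t') (x * y)"
proof -
  let ?kx = "Poly_Mapping.keys x" and ?ky = "Poly_Mapping.keys y"
  let ?lx = "Poly_Mapping.lookup x" and ?ly = "Poly_Mapping.lookup y"
  define S where "S = (\<lambda>(a, b). a - b) ` (?kx \<times> ?kx) - {0}"
  have S: "finite S" "0 \<notin> S" by (auto simp: S_def)
  obtain c :: "int^'n" where c: "\<And>s. s \<in> S \<Longrightarrow> (\<Sum>i\<in>UNIV. c $ i * s $ i) \<noteq> 0"
    using ex_nonvanishing_functional[OF S] by blast
  define \<phi> where "\<phi> m = (\<Sum>i\<in>UNIV. c $ i * m $ i)" for m :: "int^'n"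
  have \<phi>_add: "\<phi> (m + m') = \<phi> m + \<phi> m'" and \<phi>_diff: "\<phi> (m - m') = \<phi> m - \<phi> m'" for m m'
    by (simp_all add: \<phi>_def algebra_simps sum.distrib sum_subtractf)
  have inj: "a = b" if "a \<in> ?kx" "b \<in> ?kx" "\<phi> a = \<phi> b" for a b
  proof (rule ccontr)
    assume "a \<noteq> b"
    then have "a - b \<in> S" using that by (auto simp: S_def)
    then have "\<phi> (a - b) \<noteq> 0" unfolding \<phi>_def by (rule c)
    then show False using that by (simp add: \<phi>_diff)
  qed
  have max: "\<exists>m\<in>M. \<forall>m'\<in>M. \<phi> m' \<le> \<phi> m" if "finite M" "M \<noteq> {}" for M
  proof -
    have "Max (\<phi> ` M) \<in> \<phi> ` M" using that by (intro Max_in) auto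
    then obtain m where "m \<in> M" "Max (\<phi> ` M) = \<phi> m" by blast
    moreover have "\<phi> m' \<le> Max (\<phi> ` M)" if "m' \<in> M" for m' using \<open>finite M\<close> that by simp
    ultimately show ?thesis by auto
  qed
  have "{m\<in>?kx. weight x m = t} \<noteq> {}" using x by (auto simp: attains_def)
  then obtain m0 where m0: "m0 \<in> ?kx" "weight x m0 = t" "\<And>m. m \<in> ?kx \<Longrightarrow> weight x m = t \<Longrightarrow> \<phi> m \<le> \<phi> m0"
    using max[of "{m\<in>?kx. weight x m = t}"] by auto
  have "{m\<in>?ky. weight y m = t'} \<noteq> {}" using y by (auto simp: attains_def)
  then obtain n0 where n0: "n0 \<in> ?ky" "weight y n0 = t'" "\<And>m. m \<in> ?ky \<Longrightarrow> weight y m = t' \<Longrightarrow> \<phi> m \<le> \<phi> n0"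
    using max[of "{m\<in>?ky. weight y m = t'}"] by auto
  define T where "T = t + t' - wt (m0 + n0)"
  define R where "R = (\<Sum>a\<in>?kx - {m0}. ?lx a * ?ly (m0 + n0 - a))"
  have R: "R = 0 \<or> val R > T" unfolding R_def
  proof (rule val_sum_gt)
    fix a assume a: "a \<in> ?kx - {m0}"
    show "?lx a * ?ly (m0 + n0 - a) = 0 \<or> T < val (?lx a * ?ly (m0 + n0 - a))"
    proof (cases "?ly (m0 + n0 - a) = 0")
      case False
      then have b: "m0 + n0 - a \<in> ?ky" by (simp add: in_keys_iff)
      have "weight x a \<ge> t" "weight y (m0 + n0 - a) \<ge> t'" using x y a b by (auto simp: attains_def ge_def)
      \<comment> \<open>The \<open>\<phi>\<close>-values of the two degrees add up to those of
        \<open>m0\<close> and \<open>n0\<close>, each of which is maximal. Equality would follow in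
        both, and \<open>\<phi>\<close> is injective on the degrees of \<open>x\<close>.\<close>
      moreover have "\<not> (weight x a = t \<and> weight y (m0 + n0 - a) = t')"
      proof
        assume "weight x a = t \<and> weight y (m0 + n0 - a) = t'"
        then have "\<phi> a \<le> \<phi> m0" "\<phi> (m0 + n0 - a) \<le> \<phi> n0" using m0(3) n0(3) a b by auto
        then have "\<phi> a = \<phi> m0" by (simp add: \<phi>_add \<phi>_diff)
        then show False using inj a m0 by blast
      qed
      ultimately have "weight x a + weight y (m0 + n0 - a) > t + t'" by linarith
      then show ?thesis using a False by (simp add: T_def weight_def val_mult in_keys_iff wt_diff wt_add)
    qed simp
  qed
  have eq: "Poly_Mapping.lookup (x * y) (m0 + n0) = ?lx m0 * ?ly n0 + R"
    using m0(1) by (simp add: lookup_mult_sum[of ?kx] R_def sum.remove[of ?kx m0])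
  have nz: "?lx m0 \<noteq> 0" "?ly n0 \<noteq> 0" using m0 n0 by (auto simp: in_keys_iff)
  have lead: "val (?lx m0 * ?ly n0) = T"
    using m0(2) n0(2) nz by (simp add: T_def weight_def val_mult wt_add)
  have "\<not> (Poly_Mapping.lookup (x * y) (m0 + n0) = 0 \<or> val (Poly_Mapping.lookup (x * y) (m0 + n0)) > T)"
  proof
    assume *: "Poly_Mapping.lookup (x * y) (m0 + n0) = 0 \<or> val (Poly_Mapping.lookup (x * y) (m0 + n0)) > T"
    have nR: "- R = 0 \<or> val (- R) > T" using R val_uminus[of R] by fastforce
    have "(\<Sum>b\<in>{True, False}. if b then Poly_Mapping.lookup (x * y) (m0 + n0) else - R) = 0 \<or>
       val (\<Sum>b\<in>{True, False}. if b then Poly_Mapping.lookup (x * y) (m0 + n0) else - R) > T"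
      using * nR by (intro val_sum_gt) auto
    then have "?lx m0 * ?ly n0 = 0 \<or> val (?lx m0 * ?ly n0) > T" by (simp add: eq)
    then show False using nz lead by simp
  qed
  then have key: "m0 + n0 \<in> Poly_Mapping.keys (x * y)" and le: "weight (x * y) (m0 + n0) \<le> t + t'"
    by (auto simp: in_keys_iff weight_def T_def)
  moreover have g: "ge (t + t') (x * y)" using x y by (intro ge_mult) (auto simp: attains_def)
  ultimately have "weight (x * y) (m0 + n0) = t + t'" by (force simp: ge_def)
  then show ?thesis using g key by (auto simp: attains_def)
qed

lemma attains_one: "attains 0 1"
  by (auto simp: attains_def ge_def weight_def val_1 wt_0)

lemma attains_power: "attains t x \<Longrightarrow> attains (of_nat n * t) (x ^ n)"
  by (induction n) (use attains_one attains_mult in \<open>auto simp: algebra_simps\<close>)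

text \<open>If \<open>x\<close> had value t < 0, the right-hand side would have value at least (N -
  1) t, which is greater than the value N t of the left-hand side.\<close>

lemma integral_ge_0:
  assumes c: "\<And>i. i < N \<Longrightarrow> ge 0 (c i)" and eq: "x ^ N = (\<Sum>i<N. c i * x ^ i)"
  shows "ge 0 x"
proof (cases "x = 0")
  case False
  then obtain t where t: "attains t x" using ex_attains by blast
  show ?thesis
  proof (cases "t < 0")
    case True
    have "N \<noteq> 0" using eq by (intro notI) simp
    have "ge (of_nat (N - 1) * t) (\<Sum>i<N. c i * x ^ i)"
    proof (rule ge_sum)
      fix i assume i: "i \<in> {..<N}"
      have "ge (of_nat i * t) (x ^ i)" using attains_power[OF t] by (simp add: attains_def)
      then have "ge (of_nat i * t) (c i * x ^ i)" using ge_mult[OF c, of i "of_nat i * t" "x ^ i"] i by simp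
      moreover have "of_nat (N - 1) * t \<le> of_nat i * t"
        using True i by (intro mult_right_mono_neg) auto
      ultimately show "ge (of_nat (N - 1) * t) (c i * x ^ i)" by (rule ge_mono)
    qed
    then have "of_nat (N - 1) * t \<le> of_nat N * t"
      unfolding eq[symmetric] using ge_attains attains_power[OF t] by blast
    then have "t \<ge> 0" using \<open>N \<noteq> 0\<close> by (simp add: of_nat_diff algebra_simps)
    then show ?thesis using True by simp
  qed (use t ge_mono in \<open>auto simp: attains_def\<close>)
qed (auto simp: ge_def)

end

lemma laurent_mult_eq_0:
  fixes x y :: "int^'n::finite \<Rightarrow>\<^sub>0 'k::field"
  assumes "x * y = 0"
  shows "x = 0 \<or> y = 0"
proof -
  interpret monomial_valuation "\<lambda>_::'k. 0" "\<lambda>_::int^'n. 0" by unfold_locales auto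
  show ?thesis using ex_attains[of x] ex_attains[of y] attains_mult attains_imp_nonzero assms by metis
qed

lemma laurent_power_eq_0:
  fixes x :: "int^'n::finite \<Rightarrow>\<^sub>0 'k::field"
  shows "x ^ n = 0 \<Longrightarrow> x = 0"
  by (induction n) (auto dest: laurent_mult_eq_0)

lemma laurent_mult_cancel:
  fixes x y z :: "int^'n::finite \<Rightarrow>\<^sub>0 'k::field"
  assumes "x \<noteq> 0" "x * y = x * z"
  shows "y = z"
  using laurent_mult_eq_0[of x "y - z"] assms by (simp add: right_diff_distrib)

subsection \<open>Leading forms\<close>

definition part :: "('m \<Rightarrow> int) \<Rightarrow> int \<Rightarrow> ('m \<Rightarrow>\<^sub>0 'k::comm_ring_1) \<Rightarrow> 'm \<Rightarrow>\<^sub>0 'k" where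
  "part \<phi> k x = (\<Sum>m\<in>{m\<in>Poly_Mapping.keys x. \<phi> m = k}. Poly_Mapping.single m (Poly_Mapping.lookup x m))"

definition top_deg :: "('m \<Rightarrow> int) \<Rightarrow> ('m \<Rightarrow>\<^sub>0 'k::comm_ring_1) \<Rightarrow> int" where
  "top_deg \<phi> x = Max (\<phi> ` Poly_Mapping.keys x)"

lemma lookup_part: "Poly_Mapping.lookup (part \<phi> k x) m = (if \<phi> m = k then Poly_Mapping.lookup x m else 0)"
  by (auto simp: part_def lookup_sum lookup_single when_def in_keys_iff)

lemma keys_part: "Poly_Mapping.keys (part \<phi> k x) = {m\<in>Poly_Mapping.keys x. \<phi> m = k}"
  by (auto simp: in_keys_iff lookup_part split: if_splits)

lemma top_deg_ge: "m \<in> Poly_Mapping.keys x \<Longrightarrow> \<phi> m \<le> top_deg \<phi> x"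
  by (simp add: top_deg_def)

lemma part_top_deg: "x \<noteq> 0 \<Longrightarrow> part \<phi> (top_deg \<phi> x) x \<noteq> 0"
proof -
  assume "x \<noteq> 0"
  then have "top_deg \<phi> x \<in> \<phi> ` Poly_Mapping.keys x" unfolding top_deg_def by (intro Max_in) auto
  then have "Poly_Mapping.keys (part \<phi> (top_deg \<phi> x) x) \<noteq> {}" unfolding keys_part by auto
  then show ?thesis by auto
qed

lemma top_deg_eqI:
  assumes "\<And>m. m \<in> Poly_Mapping.keys x \<Longrightarrow> \<phi> m \<le> k" "part \<phi> k x \<noteq> 0"
  shows "top_deg \<phi> x = k"
  unfolding top_deg_def
proof (rule Max_eqI)
  have "Poly_Mapping.keys (part \<phi> k x) \<noteq> {}" using assms(2) by simp
  then show "k \<in> \<phi> ` Poly_Mapping.keys x" unfolding keys_part by auto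
qed (use assms(1) in auto)

lemma part_mult:
  fixes x y :: "'m::ab_group_add \<Rightarrow>\<^sub>0 'k::comm_ring_1"
  assumes \<phi>: "\<And>m m'. \<phi> (m + m') = \<phi> m + \<phi> m'"
    and x: "\<And>m. m \<in> Poly_Mapping.keys x \<Longrightarrow> \<phi> m \<le> k" and y: "\<And>m. m \<in> Poly_Mapping.keys y \<Longrightarrow> \<phi> m \<le> l"
  shows "part \<phi> (k + l) (x * y) = part \<phi> k x * part \<phi> l y"
proof (rule poly_mapping_eqI)
  fix m
  have diff: "\<phi> (m - a) = \<phi> m - \<phi> a" for a using \<phi>[of "m - a" a] by simp
  have R: "Poly_Mapping.lookup (part \<phi> k x * part \<phi> l y) m
      = (\<Sum>a\<in>Poly_Mapping.keys x. Poly_Mapping.lookup (part \<phi> k x) a * Poly_Mapping.lookup (part \<phi> l y) (m - a))"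
    by (rule lookup_mult_sum) (auto simp: keys_part)
  have L: "Poly_Mapping.lookup (part \<phi> (k + l) (x * y)) m
      = (if \<phi> m = k + l then \<Sum>a\<in>Poly_Mapping.keys x. Poly_Mapping.lookup x a * Poly_Mapping.lookup y (m - a) else 0)"
    by (simp add: lookup_part lookup_mult_sum[of "Poly_Mapping.keys x"])
  show "Poly_Mapping.lookup (part \<phi> (k + l) (x * y)) m = Poly_Mapping.lookup (part \<phi> k x * part \<phi> l y) m"
  proof (cases "\<phi> m = k + l")
    case True
    have "Poly_Mapping.lookup x a * Poly_Mapping.lookup y (m - a)
        = Poly_Mapping.lookup (part \<phi> k x) a * Poly_Mapping.lookup (part \<phi> l y) (m - a)"
      if a: "a \<in> Poly_Mapping.keys x" for a
    proof (cases "\<phi> a = k")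
      case False
      then have "\<phi> (m - a) > l" using x[OF a] True by (simp add: diff)
      then have "Poly_Mapping.lookup y (m - a) = 0" using y[of "m - a"] by (auto simp: in_keys_iff)
      then show ?thesis using False by (simp add: lookup_part)
    qed (use True in \<open>simp add: lookup_part diff\<close>)
    then show ?thesis unfolding L R using True by (auto intro: sum.cong)
  next
    case False
    then have "Poly_Mapping.lookup (part \<phi> k x) a * Poly_Mapping.lookup (part \<phi> l y) (m - a) = 0" for a
      by (auto simp: lookup_part diff)
    then show ?thesis unfolding L R using False by simp
  qed
qed

context
  fixes \<phi> :: "int^'n::finite \<Rightarrow> int"
  assumes \<phi>: "\<And>m m'. \<phi> (m + m') = \<phi> m + \<phi> m'"
begin

lemma top_deg_mult:
  fixes x y :: "int^'n \<Rightarrow>\<^sub>0 'k::field"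
  assumes "x \<noteq> 0" "y \<noteq> 0"
  shows "top_deg \<phi> (x * y) = top_deg \<phi> x + top_deg \<phi> y"
    and "part \<phi> (top_deg \<phi> (x * y)) (x * y) = part \<phi> (top_deg \<phi> x) x * part \<phi> (top_deg \<phi> y) y"
proof -
  have eq: "part \<phi> (top_deg \<phi> x + top_deg \<phi> y) (x * y) = part \<phi> (top_deg \<phi> x) x * part \<phi> (top_deg \<phi> y) y"
    by (rule part_mult) (auto simp: \<phi> top_deg_ge)
  show top: "top_deg \<phi> (x * y) = top_deg \<phi> x + top_deg \<phi> y"
  proof (rule top_deg_eqI)
    show "\<phi> m \<le> top_deg \<phi> x + top_deg \<phi> y" if m: "m \<in> Poly_Mapping.keys (x * y)" for m
    proof -
      obtain a b where "m = a + b" "a \<in> Poly_Mapping.keys x" "b \<in> Poly_Mapping.keys y"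
        using m keys_mult[of x y] by blast
      then show ?thesis using top_deg_ge[of a x \<phi>] top_deg_ge[of b y \<phi>] by (simp add: \<phi>)
    qed
    show "part \<phi> (top_deg \<phi> x + top_deg \<phi> y) (x * y) \<noteq> 0"
      unfolding eq using laurent_mult_eq_0 part_top_deg assms by blast
  qed
  show "part \<phi> (top_deg \<phi> (x * y)) (x * y) = part \<phi> (top_deg \<phi> x) x * part \<phi> (top_deg \<phi> y) y"
    unfolding top eq ..
qed

lemma top_deg_one: "top_deg \<phi> (1 :: int^'n \<Rightarrow>\<^sub>0 'k::field) = 0"
  and part_one: "part \<phi> 0 (1 :: int^'n \<Rightarrow>\<^sub>0 'k::field) = 1"
proof -
  have "\<phi> 0 = 0" using \<phi>[of 0 0] by simp
  then show "top_deg \<phi> (1 :: int^'n \<Rightarrow>\<^sub>0 'k::field) = 0" by (simp add: top_deg_def)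
  show "part \<phi> 0 (1 :: int^'n \<Rightarrow>\<^sub>0 'k::field) = 1"
    using \<open>\<phi> 0 = 0\<close> by (intro poly_mapping_eqI) (auto simp: lookup_part lookup_one when_def)
qed

lemma top_deg_power:
  fixes x :: "int^'n \<Rightarrow>\<^sub>0 'k::field"
  assumes "x \<noteq> 0"
  shows "top_deg \<phi> (x ^ n) = int n * top_deg \<phi> x
    \<and> part \<phi> (top_deg \<phi> (x ^ n)) (x ^ n) = part \<phi> (top_deg \<phi> x) x ^ n"
proof (induction n)
  case (Suc n)
  have "x ^ n \<noteq> 0" using assms laurent_power_eq_0 by blast
  then show ?case using top_deg_mult[OF assms, of "x ^ n"] Suc.IH[THEN conjunct1] Suc.IH[THEN conjunct2]
    by (simp add: algebra_simps)
qed (simp add: top_deg_one part_one)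

end

subsection \<open>Complete integral closedness of Laurent polynomial rings\<close>

text \<open>The subring in the variables of \<open>I\<close>, kept inside the full ring so that an
  induction on the number of variables stays within one type.\<close>

definition laurent_in :: "'n::finite set \<Rightarrow> (int^'n \<Rightarrow>\<^sub>0 'k::field) set" where
  "laurent_in I = {x. \<forall>m\<in>Poly_Mapping.keys x. \<forall>i. i \<notin> I \<longrightarrow> m $ i = 0}"

lemma subring_laurent_in: "subring_set (laurent_in I :: (int^'n::finite \<Rightarrow>\<^sub>0 'k::field) set)"
proof -
  have "x * y \<in> laurent_in I" if "x \<in> laurent_in I" "y \<in> laurent_in I" for x y :: "int^'n \<Rightarrow>\<^sub>0 'k"
  proof -
    have "m $ i = 0" if m: "m \<in> Poly_Mapping.keys (x * y)" and i: "i \<notin> I" for m i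
    proof -
      obtain a b where "m = a + b" "a \<in> Poly_Mapping.keys x" "b \<in> Poly_Mapping.keys y"
        using m keys_mult[of x y] by blast
      then show ?thesis using \<open>x \<in> laurent_in I\<close> \<open>y \<in> laurent_in I\<close> i by (simp add: laurent_in_def)
    qed
    then show ?thesis by (simp add: laurent_in_def)
  qed
  moreover have "x + y \<in> laurent_in I" if "x \<in> laurent_in I" "y \<in> laurent_in I" for x y :: "int^'n \<Rightarrow>\<^sub>0 'k"
    using that Poly_Mapping.keys_add[of x y] by (auto simp: laurent_in_def)
  moreover have "- x \<in> laurent_in I" if "x \<in> laurent_in I" for x :: "int^'n \<Rightarrow>\<^sub>0 'k"
    using that by (simp add: laurent_in_def in_keys_iff)
  moreover have "(0 :: int^'n \<Rightarrow>\<^sub>0 'k) \<in> laurent_in I" "(1 :: int^'n \<Rightarrow>\<^sub>0 'k) \<in> laurent_in I"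
    by (simp_all add: laurent_in_def)
  ultimately show ?thesis unfolding subring_set_def by blast
qed

text \<open>In the binomial expansion the k-th power of \<open>p\<close> takes q^k out of
  \<open>d\<close>-multiples, and the remaining factor supplies q^(n-k); so every summand is
  divisible by q^n.\<close>

lemma almost_integral_diff:
  assumes R: "subring_set R" and "c \<in> R" "q \<in> R" and almost: "\<And>n. \<exists>a\<in>R. d * p ^ n = q ^ n * a"
  shows "\<exists>a\<in>R. d * (p - q * c) ^ n = q ^ n * a"
proof -
  obtain a where a: "\<And>n. a n \<in> R" "\<And>n. d * p ^ n = q ^ n * a n" using almost by metis
  have "d * (p + - (q * c)) ^ n = (\<Sum>k\<le>n. of_nat (n choose k) * (d * p ^ k) * (- (q * c)) ^ (n - k))"
    unfolding binomial_ring sum_distrib_left by (simp add: mult_ac)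
  also have "\<dots> = (\<Sum>k\<le>n. q ^ n * (of_nat (n choose k) * a k * (- c) ^ (n - k)))"
  proof (rule sum.cong)
    fix k assume k: "k \<in> {..n}"
    have "(- (q * c)) ^ (n - k) = q ^ (n - k) * (- c) ^ (n - k)"
      by (simp flip: power_mult_distrib)
    then have "of_nat (n choose k) * (d * p ^ k) * (- (q * c)) ^ (n - k)
        = (q ^ k * q ^ (n - k)) * (of_nat (n choose k) * a k * (- c) ^ (n - k))"
      by (simp add: a(2) mult_ac)
    also have "q ^ k * q ^ (n - k) = q ^ n" using k by (simp flip: power_add)
    finally show "of_nat (n choose k) * (d * p ^ k) * (- (q * c)) ^ (n - k)
        = q ^ n * (of_nat (n choose k) * a k * (- c) ^ (n - k))" .
  qed simp
  also have "\<dots> = q ^ n * (\<Sum>k\<le>n. of_nat (n choose k) * a k * (- c) ^ (n - k))"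
    by (simp add: sum_distrib_left)
  finally show ?thesis using R a(1) assms(2)
    by (intro bexI[of _ "\<Sum>k\<le>n. of_nat (n choose k) * a k * (- c) ^ (n - k)"])
      (auto intro!: subring_sum subring_mult subring_power subring_uminus subring_of_nat)
qed

text \<open>Induction on the number of variables: comparing leading coefficients with respect to the new
  variable lowers the width of the numerator, which can never drop below the width of the
  denominator unless the numerator vanishes.\<close>

theorem completely_int_closed_laurent_in:
  fixes I :: "'n::finite set"
  shows "completely_int_closed (laurent_in I :: (int^'n \<Rightarrow>\<^sub>0 'k::field) set)"
  using finite[of I]
proof (induction I rule: finite_induct)
  case empty
  show ?case unfolding completely_int_closed_def
  proof (intro ballI impI)
    fix p q d :: "int^'n \<Rightarrow>\<^sub>0 'k"
    assume "p \<in> laurent_in {}" "q \<in> laurent_in {}" "d \<in> laurent_in {}"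
      "q \<noteq> 0 \<and> d \<noteq> 0 \<and> (\<forall>n. \<exists>a\<in>laurent_in {}. d * p ^ n = q ^ n * a)"
    then have q: "Poly_Mapping.keys q \<subseteq> {0}" "q \<noteq> 0" by (auto simp: laurent_in_def vec_eq_iff)
    define c where "c = Poly_Mapping.lookup q 0"
    have qc: "q = Poly_Mapping.single 0 c"
      by (rule poly_mapping_eqI) (use q in \<open>auto simp: c_def lookup_single when_def in_keys_iff\<close>)
    then have "c \<noteq> 0" using q by auto
    then have "q * (Poly_Mapping.single 0 (inverse c) * p) = p"
      unfolding qc by (simp add: mult_single flip: mult.assoc)
    moreover have "Poly_Mapping.single 0 (inverse c) \<in> laurent_in {}" by (auto simp: laurent_in_def)
    then have "Poly_Mapping.single 0 (inverse c) * p \<in> laurent_in {}"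
      using subring_mult[OF subring_laurent_in] \<open>p \<in> _\<close> by blast
    ultimately show "\<exists>a\<in>laurent_in {}. p = q * a" by metis
  qed
next
  case (insert j I)
  let ?R = "laurent_in (insert j I) :: (int^'n \<Rightarrow>\<^sub>0 'k) set"
  have R: "subring_set ?R" by (rule subring_laurent_in)
  \<comment> \<open>\<open>?b x\<close> below is minus the lowest degree of \<open>x\<close> in the
    new variable, hence \<open>?t x + ?b x\<close> is the width of \<open>x\<close>.\<close>
  let ?\<phi> = "\<lambda>m::int^'n. m $ j" and ?\<psi> = "\<lambda>m::int^'n. - m $ j"
  let ?t = "top_deg ?\<phi>" and ?b = "top_deg ?\<psi>"
  have \<phi>: "?\<phi> (m + m') = ?\<phi> m + ?\<phi> m'" and \<psi>: "?\<psi> (m + m') = ?\<psi> m + ?\<psi> m'" for m m' by auto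
  define s where "s k = Poly_Mapping.single (axis j k :: int^'n) (1::'k)" for k
  have s_add: "s k * s l = s (k + l)" for k l
  proof -
    have "axis j k + axis j l = (axis j (k + l) :: int^'n)" by (auto simp: vec_eq_iff axis_def)
    then show ?thesis by (simp add: s_def mult_single)
  qed
  have s0: "s 0 = 1" by (simp add: s_def axis_def flip: zero_vec_def)
  have sR: "s k \<in> ?R" for k by (auto simp: s_def laurent_in_def axis_def)
  \<comment> \<open>Dividing the leading form by the power \<open>s (?t x)\<close> of the new
    variable leaves a coefficient in the variables of \<open>I\<close>, where the induction
    hypothesis applies.\<close>
  define lc where "lc x = part ?\<phi> (?t x) x * s (- ?t x)" for x
  have s_nz: "s k \<noteq> 0" for k by (metis s_def keys_single keys_zero insert_not_empty one_neq_zero)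
  have lcI: "lc x \<in> laurent_in I" if "x \<in> ?R" for x
  proof -
    have "m $ i = 0" if m: "m \<in> Poly_Mapping.keys (lc x)" and i: "i \<notin> I" for m i
    proof -
      obtain a b where ab: "m = a + b" "a \<in> Poly_Mapping.keys (part ?\<phi> (?t x) x)" "b \<in> Poly_Mapping.keys (s (- ?t x))"
        using m keys_mult unfolding lc_def by blast
      have "b = axis j (- ?t x)" using ab(3) by (simp add: s_def)
      moreover have "a \<in> Poly_Mapping.keys x" "a $ j = ?t x" using ab(2) by (auto simp: keys_part)
      ultimately show ?thesis using ab(1) \<open>x \<in> ?R\<close> i by (cases "i = j") (auto simp: laurent_in_def axis_def)
    qed
    then show ?thesis by (simp add: laurent_in_def)
  qed
  have lc_nz: "lc x \<noteq> 0" if "x \<noteq> 0" for x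
    unfolding lc_def using laurent_mult_eq_0 part_top_deg[OF that] s_nz by blast
  have lc_mult: "lc (x * y) = lc x * lc y" if "x \<noteq> 0" "y \<noteq> 0" for x y
  proof -
    have "s (- ?t (x * y)) = s (- ?t x) * s (- ?t y)"
      using top_deg_mult(1)[of ?\<phi>, OF \<phi> that] by (simp add: s_add)
    then show ?thesis unfolding lc_def top_deg_mult(2)[of ?\<phi>, OF \<phi> that] by (simp only: mult_ac)
  qed
  have lc_power: "lc (x ^ n) = lc x ^ n" if "x \<noteq> 0" for x n
  proof (induction n)
    case 0 show ?case by (simp add: lc_def top_deg_one[of ?\<phi>, OF \<phi>] part_one[of ?\<phi>, OF \<phi>] s0)
  next
    case (Suc n)
    have "x ^ n \<noteq> 0" using that laurent_power_eq_0 by blast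
    then show ?case using lc_mult[OF that, of "x ^ n"] Suc by simp
  qed
  \<comment> \<open>The support of \<open>p\<close> lies in a window of length \<open>w\<close> with
    fixed lower end \<open>b\<close>; each step lowers the upper end by one.\<close>
  have main: "\<exists>a\<in>?R. p = q * a"
    if "p \<in> ?R" "q \<in> ?R" "d \<in> ?R" "q \<noteq> 0" "d \<noteq> 0" "\<And>n. \<exists>a\<in>?R. d * p ^ n = q ^ n * a"
      "\<And>m. m \<in> Poly_Mapping.keys p \<Longrightarrow> b \<le> m $ j \<and> m $ j < b + int w" for p q d b w
    using that
  proof (induction w arbitrary: p)
    case 0
    then have "p = 0" by (metis add_0_right all_not_in_conv keys_eq_empty leD of_nat_0)
    then show ?case using R by (intro bexI[of _ 0]) (auto intro: subring_0)
  next
    case (Suc w)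
    show ?case
    proof (cases "part ?\<phi> (b + int w) p = 0")
      case True
      have "b \<le> m $ j \<and> m $ j < b + int w" if "m \<in> Poly_Mapping.keys p" for m
      proof -
        have "m \<notin> Poly_Mapping.keys (part ?\<phi> (b + int w) p)" using True by simp
        then show ?thesis using Suc.prems(7)[OF that] that by (auto simp: keys_part)
      qed
      then show ?thesis using Suc.IH[OF Suc.prems(1-6)] by blast
    next
      case False
      then have p0: "p \<noteq> 0" by (auto simp: part_def)
      have tp: "?t p = b + int w" using Suc.prems(7) False by (intro top_deg_eqI) force+
      obtain a where a: "\<And>n. a n \<in> ?R" "\<And>n. d * p ^ n = q ^ n * a n" using Suc.prems(6) by metis
      have pn: "p ^ n \<noteq> 0" "q ^ n \<noteq> 0" for n using p0 Suc.prems(4) laurent_power_eq_0 by blast+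
      have an: "a n \<noteq> 0" for n
        using a(2)[of n] laurent_mult_eq_0[of d "p ^ n"] pn Suc.prems(5) by auto
      have "\<exists>c\<in>laurent_in I. lc d * lc p ^ n = lc q ^ n * c" for n
      proof
        show "lc d * lc p ^ n = lc q ^ n * lc (a n)"
          using arg_cong[OF a(2)[of n], of lc] pn an Suc.prems(4,5) p0 by (simp add: lc_mult lc_power)
      qed (rule lcI[OF a(1)])
      then have "\<exists>c\<in>laurent_in I. lc p = lc q * c"
        using lcI[OF Suc.prems(1)] lcI[OF Suc.prems(2)] lcI[OF Suc.prems(3)]
          lc_nz[OF Suc.prems(4)] lc_nz[OF Suc.prems(5)]
        by (intro insert.IH[unfolded completely_int_closed_def, rule_format, of "lc p" "lc q" "lc d"]) auto
      then obtain c where c: "c \<in> laurent_in I" "lc p = lc q * c" by blast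
      have "I \<subseteq> insert j I" by auto
      then have cR: "c \<in> ?R" using c(1) by (auto simp: laurent_in_def)
      define e where "e = c * s (?t p - ?t q)"
      have eR: "e \<in> ?R" unfolding e_def using cR sR R by (intro subring_mult)
      \<comment> \<open>Top and bottom degrees are additive. Comparing widths in d p^n = q^n a_n,
        for n one more than the width of \<open>d\<close>, shows that \<open>q\<close> is no wider
        than \<open>p\<close>; so \<open>q * e\<close> does not leave the window at its lower
        end.\<close>
      have width: "?t q + ?b q \<le> ?t p + ?b p"
      proof (rule ccontr)
        assume "\<not> ?thesis"
        then have less: "?t p + ?b p + 1 \<le> ?t q + ?b q" by simp
        have deg: "top_deg \<theta> d + int n * top_deg \<theta> p = int n * top_deg \<theta> q + top_deg \<theta> (a n)"
          if \<theta>: "\<And>m m'. \<theta> (m + m') = \<theta> m + \<theta> m'" for n and \<theta> :: "int^'n \<Rightarrow> int"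
          using arg_cong[OF a(2)[of n], of "top_deg \<theta>"] pn an Suc.prems(4,5) p0
            top_deg_power[OF \<theta>, of p n] top_deg_power[OF \<theta>, of q n]
          by (simp add: top_deg_mult(1)[OF \<theta>])
        have nonneg: "?t x + ?b x \<ge> 0" if "x \<noteq> 0" for x :: "int^'n \<Rightarrow>\<^sub>0 'k"
        proof -
          obtain m where m: "m \<in> Poly_Mapping.keys x" using \<open>x \<noteq> 0\<close> by (metis keys_eq_empty ex_in_conv)
          then show ?thesis using top_deg_ge[of m x ?\<phi>] top_deg_ge[of m x ?\<psi>] by simp
        qed
        define n where "n = nat (?t d + ?b d + 1)"
        have "int n * (?t q + ?b q) \<le> ?t d + ?b d + int n * (?t p + ?b p)"
          using deg[of ?\<phi> n] deg[of ?\<psi> n] nonneg[OF an[of n]] by (simp add: algebra_simps)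
        moreover have "int n * (?t p + ?b p + 1) \<le> int n * (?t q + ?b q)" using less by (intro mult_left_mono) auto
        moreover have "int n = ?t d + ?b d + 1" unfolding n_def using nonneg[OF Suc.prems(5)] by simp
        ultimately show False by (simp add: algebra_simps)
      qed
      have keys_qe: "b \<le> m $ j \<and> m $ j \<le> ?t p" if m: "m \<in> Poly_Mapping.keys (q * e)" for m
      proof -
        obtain x y where xy: "m = x + y" "x \<in> Poly_Mapping.keys q" "y \<in> Poly_Mapping.keys e"
          using m keys_mult by blast
        obtain u v where uv: "y = u + v" "u \<in> Poly_Mapping.keys c" "v \<in> Poly_Mapping.keys (s (?t p - ?t q))"
          using xy(3) keys_mult unfolding e_def by blast
        have "u $ j = 0" using c(1) uv(2) insert.hyps(2) by (simp add: laurent_in_def)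
        moreover have "v $ j = ?t p - ?t q" using uv(3) by (simp add: s_def axis_def)
        moreover have "x $ j \<le> ?t q" "- x $ j \<le> ?b q" using top_deg_ge[OF xy(2), of ?\<phi>] top_deg_ge[OF xy(2), of ?\<psi>] by auto
        moreover have "?b p \<le> - b"
        proof -
          have "?b p \<in> ?\<psi> ` Poly_Mapping.keys p" unfolding top_deg_def using p0 by (intro Max_in) auto
          then show ?thesis using Suc.prems(7) by auto
        qed
        ultimately show ?thesis using width xy(1) uv(1) by simp
      qed
      have part_e: "part ?\<phi> (?t p - ?t q) e = e"
      proof (rule poly_mapping_eqI)
        fix m
        have "m $ j = ?t p - ?t q" if m: "m \<in> Poly_Mapping.keys e"
        proof -
          obtain u v where uv: "m = u + v" "u \<in> Poly_Mapping.keys c" "v \<in> Poly_Mapping.keys (s (?t p - ?t q))"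
            using m keys_mult unfolding e_def by blast
          then show ?thesis using c(1) insert.hyps(2) by (simp add: laurent_in_def s_def axis_def)
        qed
        then show "Poly_Mapping.lookup (part ?\<phi> (?t p - ?t q) e) m = Poly_Mapping.lookup e m"
          by (auto simp: lookup_part in_keys_iff)
      qed
      have keys_e: "m $ j \<le> ?t p - ?t q" if "m \<in> Poly_Mapping.keys e" for m
      proof -
        have "m \<in> Poly_Mapping.keys (part ?\<phi> (?t p - ?t q) e)" using that part_e by simp
        then show ?thesis unfolding keys_part by simp
      qed
      have "part ?\<phi> (?t p) (q * e) = part ?\<phi> (?t q + (?t p - ?t q)) (q * e)" by simp
      also have "\<dots> = part ?\<phi> (?t q) q * part ?\<phi> (?t p - ?t q) e"
        by (rule part_mult[of ?\<phi>]) (use keys_e top_deg_ge[of _ q ?\<phi>] in auto)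
      also have "\<dots> = part ?\<phi> (?t q) q * s (- ?t q) * c * s (?t p)"
      proof -
        have "s (?t p - ?t q) = s (- ?t q) * s (?t p)" by (simp add: s_add)
        then show ?thesis unfolding part_e unfolding e_def by (simp only: mult_ac)
      qed
      also have "\<dots> = lc p * s (?t p)" unfolding c(2) by (simp add: lc_def mult_ac)
      also have "\<dots> = part ?\<phi> (?t p) p" using s_add[of "- ?t p" "?t p"] by (simp add: lc_def mult.assoc s0)
      finally have top_eq: "part ?\<phi> (?t p) (q * e) = part ?\<phi> (?t p) p" .
      have keys': "b \<le> m $ j \<and> m $ j < b + int w" if m: "m \<in> Poly_Mapping.keys (p - q * e)" for m
      proof -
        have "m \<in> Poly_Mapping.keys p \<or> m \<in> Poly_Mapping.keys (q * e)"
          using m by (auto simp: in_keys_iff lookup_minus)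
        then have "b \<le> m $ j" "m $ j \<le> b + int w" using keys_qe Suc.prems(7) tp by force+
        moreover have "m $ j \<noteq> b + int w"
        proof
          assume "m $ j = b + int w"
          then have "Poly_Mapping.lookup (q * e) m = Poly_Mapping.lookup p m"
            using arg_cong[OF top_eq, of "\<lambda>x. Poly_Mapping.lookup x m"] tp by (simp add: lookup_part)
          then show False using m by (simp add: in_keys_iff lookup_minus)
        qed
        ultimately show ?thesis by simp
      qed
      have "\<exists>a\<in>?R. p - q * e = q * a"
      proof (rule Suc.IH[OF _ Suc.prems(2-5) _ keys'])
        show "p - q * e \<in> ?R" using Suc.prems eR R by (intro subring_diff subring_mult)
        show "\<exists>a\<in>?R. d * (p - q * e) ^ n = q ^ n * a" for n
          using Suc.prems(6) by (intro almost_integral_diff R eR Suc.prems(2))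
      qed auto
      then obtain a' where "a' \<in> ?R" "p - q * e = q * a'" by blast
      then have "p = q * (a' + e)" by (simp add: algebra_simps)
      then show ?thesis using \<open>a' \<in> ?R\<close> eR R by (metis subring_add)
    qed
  qed
  show ?case unfolding completely_int_closed_def
  proof (intro ballI impI)
    fix p q d assume pqd: "p \<in> ?R" "q \<in> ?R" "d \<in> ?R" "q \<noteq> 0 \<and> d \<noteq> 0 \<and> (\<forall>n. \<exists>a\<in>?R. d * p ^ n = q ^ n * a)"
    have "- ?b p \<le> m $ j \<and> m $ j < - ?b p + int (nat (?t p + ?b p + 1))" if m: "m \<in> Poly_Mapping.keys p" for m
      using top_deg_ge[OF m, of ?\<phi>] top_deg_ge[OF m, of ?\<psi>] by simp
    then show "\<exists>a\<in>?R. p = q * a" using main[OF pqd(1-3)] pqd(4) by blast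
  qed
qed

lemma laurent_in_UNIV: "laurent_in UNIV = UNIV"
  by (simp add: laurent_in_def)

text \<open>Integrality over \<open>R\<close> implies integrality over the whole Laurent ring, so
  the quotient is a Laurent polynomial; dividing the cleared equation by q^N gives a monic one for
  it over \<open>R\<close>, to which valuations can be applied.\<close>

theorem laurent_integral_quotient:
  fixes p q :: "int^'n::finite \<Rightarrow>\<^sub>0 'k::field"
  assumes "q \<noteq> 0" "frac_integral R p q" "subring_set R"
  obtains x and N :: nat and c where "p = q * x" "\<And>i. i < N \<Longrightarrow> c i \<in> R" "x ^ N = (\<Sum>i<N. c i * x ^ i)"
proof -
  have "frac_integral UNIV p q" using assms(2) frac_integral_mono by blast
  then obtain k where "\<And>n. \<exists>a. q ^ k * p ^ n = q ^ n * a"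
    using frac_integral_almost[of UNIV p q] by (auto simp: subring_set_def)
  moreover have "q ^ k \<noteq> 0" using assms(1) laurent_power_eq_0 by blast
  moreover have "completely_int_closed (UNIV :: (int^'n \<Rightarrow>\<^sub>0 'k) set)"
    using completely_int_closed_laurent_in[of UNIV] by (simp add: laurent_in_UNIV)
  ultimately obtain x where x: "p = q * x"
    using assms(1) unfolding completely_int_closed_def by blast
  obtain N c where c: "\<forall>i<N. c i \<in> R" "p ^ N + (\<Sum>i<N. c i * p ^ i * q ^ (N - i)) = 0"
    using assms(2) unfolding frac_integral_def by blast
  have "q ^ N * (x ^ N + (\<Sum>i<N. c i * x ^ i)) = p ^ N + (\<Sum>i<N. c i * p ^ i * q ^ (N - i))"
  proof -
    have "q ^ N * (c i * x ^ i) = c i * p ^ i * q ^ (N - i)" if "i < N" for i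
    proof -
      have "q ^ N = q ^ i * q ^ (N - i)" using that by (simp flip: power_add)
      then show ?thesis by (simp add: x power_mult_distrib mult_ac)
    qed
    then show ?thesis by (simp add: distrib_left sum_distrib_left x power_mult_distrib)
  qed
  then have "x ^ N + (\<Sum>i<N. c i * x ^ i) = 0"
    using c(2) laurent_mult_eq_0 laurent_power_eq_0 assms(1) by metis
  then have "x ^ N = (\<Sum>i<N. - c i * x ^ i)" by (simp add: sum_negf eq_neg_iff_add_eq_0)
  then show ?thesis using that[OF x, of N "\<lambda>i. - c i"] c(1) subring_uminus[OF assms(3)] by simp
qed

section \<open>Rational polyhedral cones\<close>

lemma pairQ_add_left: "pairQ (u + u') v = pairQ u v + pairQ u' v"
  and pairQ_add_right: "pairQ u (v + v') = pairQ u v + pairQ u v'"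
  and pairQ_diff_left: "pairQ (u - u') v = pairQ u v - pairQ u' v"
  and pairQ_diff_right: "pairQ u (v - v') = pairQ u v - pairQ u v'"
  and pairQ_uminus_left: "pairQ (- u) v = - pairQ u v"
  and pairQ_uminus_right: "pairQ u (- v) = - pairQ u v"
  and pairQ_scale_left: "pairQ (c *s u) v = c * pairQ u v"
  and pairQ_scale_right: "pairQ u (c *s v) = c * pairQ u v"
  and pairQ_zero_left: "pairQ 0 v = 0"
  and pairQ_zero_right: "pairQ u 0 = 0"
  by (simp_all add: pairQ_def algebra_simps sum.distrib sum_subtractf sum_negf sum_distrib_left)

lemma pairQ_commute: "pairQ u v = pairQ v u"
  by (simp add: pairQ_def mult.commute)

lemma pairQ_sum_left: "pairQ (\<Sum>i\<in>I. f i) v = (\<Sum>i\<in>I. pairQ (f i) v)"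
  by (induction I rule: infinite_finite_induct) (auto simp: pairQ_zero_left pairQ_add_left)

lemma pairQ_sum_right: "pairQ u (\<Sum>i\<in>I. f i) = (\<Sum>i\<in>I. pairQ u (f i))"
  by (induction I rule: infinite_finite_induct) (auto simp: pairQ_zero_right pairQ_add_right)

lemmas pairQ_simps = pairQ_add_left pairQ_add_right pairQ_diff_left pairQ_diff_right
  pairQ_uminus_left pairQ_uminus_right pairQ_scale_left pairQ_scale_right pairQ_zero_left
  pairQ_zero_right pairQ_sum_left pairQ_sum_right

lemma pairQ_axis: "pairQ (axis i 1) v = v $ i"
  by (simp add: pairQ_def axis_def if_distrib if_distribR sum.delta cong: if_cong)

lemma lincomb_eq: "(\<chi> i. \<Sum>s\<in>F. c s * s $ i) = (\<Sum>s\<in>F. c s *s s)"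
  by (simp add: vec_eq_iff)

lemma cone_gen_eq: "cone_gen S = {(\<Sum>s\<in>F. c s *s s) | F c. finite F \<and> F \<subseteq> S \<and> (\<forall>s\<in>F. c s \<ge> 0)}"
  by (simp add: cone_gen_def lincomb_eq)

lemma cone_gen_0: "0 \<in> cone_gen S"
  unfolding cone_gen_eq by (intro CollectI exI[of _ "{}"]) auto

lemma cone_gen_finite:
  assumes "finite S"
  shows "cone_gen S = {(\<Sum>s\<in>S. c s *s s) | c. \<forall>s\<in>S. c s \<ge> 0}"
proof
  show "cone_gen S \<subseteq> {(\<Sum>s\<in>S. c s *s s) | c. \<forall>s\<in>S. c s \<ge> 0}"
  proof
    fix x assume "x \<in> cone_gen S"
    then obtain F c where F: "F \<subseteq> S" "\<forall>s\<in>F. c s \<ge> 0" "x = (\<Sum>s\<in>F. c s *s s)"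
      unfolding cone_gen_eq by blast
    have "x = (\<Sum>s\<in>S. (if s \<in> F then c s else 0) *s s)" unfolding F(3)
      using assms F(1) by (intro sum.mono_neutral_cong_left) auto
    then show "x \<in> {(\<Sum>s\<in>S. c s *s s) | c. \<forall>s\<in>S. c s \<ge> 0}"
      using F(2) by (intro CollectI exI[of _ "\<lambda>s. if s \<in> F then c s else 0"]) auto
  qed
qed (use assms in \<open>auto simp: cone_gen_eq\<close>)

lemma cone_gen_scale:
  assumes "x \<in> cone_gen S" "a \<ge> 0"
  shows "a *s x \<in> cone_gen S"
proof -
  obtain F c where F: "finite F" "F \<subseteq> S" "\<forall>s\<in>F. c s \<ge> 0" "x = (\<Sum>s\<in>F. c s *s s)"
    using assms unfolding cone_gen_eq by blast
  then show ?thesis unfolding cone_gen_eq using assms(2)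
    by (intro CollectI exI[of _ F] exI[of _ "\<lambda>s. a * c s"])
      (auto simp: vec_eq_iff sum_distrib_left mult.assoc)
qed

lemma cone_gen_add:
  assumes "x \<in> cone_gen S" "y \<in> cone_gen S"
  shows "x + y \<in> cone_gen S"
proof -
  obtain F c where F: "finite F" "F \<subseteq> S" "\<forall>s\<in>F. c s \<ge> 0" "x = (\<Sum>s\<in>F. c s *s s)"
    using assms unfolding cone_gen_eq by blast
  obtain G d where G: "finite G" "G \<subseteq> S" "\<forall>s\<in>G. d s \<ge> 0" "y = (\<Sum>s\<in>G. d s *s s)"
    using assms unfolding cone_gen_eq by blast
  have x: "x \<in> cone_gen (F \<union> G)" and y: "y \<in> cone_gen (F \<union> G)"
    unfolding cone_gen_eq using F G by blast+
  obtain c' d' where "\<forall>s\<in>F \<union> G. c' s \<ge> 0" "x = (\<Sum>s\<in>F \<union> G. c' s *s s)"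
      "\<forall>s\<in>F \<union> G. d' s \<ge> 0" "y = (\<Sum>s\<in>F \<union> G. d' s *s s)"
    using x y F(1) G(1) unfolding cone_gen_finite[OF finite_UnI[OF F(1) G(1)]] by blast
  then show ?thesis unfolding cone_gen_eq using F G
    by (intro CollectI exI[of _ "F \<union> G"] exI[of _ "\<lambda>s. c' s + d' s"])
      (auto simp: vector_sadd_rdistrib sum.distrib intro!: add_nonneg_nonneg)
qed

lemma cone_gen_mem: "x \<in> S \<Longrightarrow> x \<in> cone_gen S"
  unfolding cone_gen_eq by (intro CollectI exI[of _ "{x}"] exI[of _ "\<lambda>_. 1"]) auto

lemma cone_gen_least:
  assumes "0 \<in> C" "\<And>x y. x \<in> C \<Longrightarrow> y \<in> C \<Longrightarrow> x + y \<in> C" "\<And>a x. a \<ge> 0 \<Longrightarrow> x \<in> S \<Longrightarrow> a *s x \<in> C"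
  shows "cone_gen S \<subseteq> C"
proof -
  have "(\<Sum>s\<in>F. c s *s s) \<in> C" if "finite F" "F \<subseteq> S" "\<forall>s\<in>F. c s \<ge> 0" for F c
    using that by (induction F rule: finite_induct) (auto intro: assms)
  then show ?thesis unfolding cone_gen_eq by blast
qed

lemma cone_gen_subset: "S \<subseteq> cone_gen T \<Longrightarrow> cone_gen S \<subseteq> cone_gen T"
  by (rule cone_gen_least) (auto intro: cone_gen_0 cone_gen_add cone_gen_scale)

lemma cone_gen_mono: "S \<subseteq> T \<Longrightarrow> cone_gen S \<subseteq> cone_gen T"
  unfolding cone_gen_eq by blast

lemma pairQ_cone_gen_nonneg:
  assumes "\<And>s. s \<in> S \<Longrightarrow> pairQ u s \<ge> 0" "x \<in> cone_gen S"
  shows "pairQ u x \<ge> 0"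
proof -
  have "cone_gen S \<subseteq> {x. pairQ u x \<ge> 0}"
    by (rule cone_gen_least) (use assms in \<open>auto simp: pairQ_simps\<close>)
  then show ?thesis using assms by blast
qed

lemma cone_gen_insert:
  assumes "finite F"
  shows "cone_gen (insert w F) = {v. \<exists>l\<ge>0. v - l *s w \<in> cone_gen F}"
proof (intro set_eqI iffI CollectI)
  fix v assume "v \<in> cone_gen (insert w F)"
  moreover have "cone_gen (insert w F) \<subseteq> {v. \<exists>l\<ge>0. v - l *s w \<in> cone_gen F}"
  proof (rule cone_gen_least)
    show "0 \<in> {v. \<exists>l\<ge>0. v - l *s w \<in> cone_gen F}"
      by (auto intro!: exI[of _ 0] cone_gen_0)
    show "x + y \<in> {v. \<exists>l\<ge>0. v - l *s w \<in> cone_gen F}"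
      if xy: "x \<in> {v. \<exists>l\<ge>0. v - l *s w \<in> cone_gen F}" "y \<in> {v. \<exists>l\<ge>0. v - l *s w \<in> cone_gen F}" for x y
    proof -
      obtain l k where lk: "l \<ge> 0" "k \<ge> 0" "x - l *s w \<in> cone_gen F" "y - k *s w \<in> cone_gen F"
        using xy by blast
      have "(x + y) - (l + k) *s w = (x - l *s w) + (y - k *s w)"
        by (simp add: vec_eq_iff algebra_simps)
      then show ?thesis using lk cone_gen_add[OF lk(3,4)] by (metis (mono_tags, lifting) add_nonneg_nonneg mem_Collect_eq)
    qed
    show "a *s x \<in> {v. \<exists>l\<ge>0. v - l *s w \<in> cone_gen F}" if "a \<ge> 0" "x \<in> insert w F" for a x
    proof (cases "x = w")
      case True
      then show ?thesis using that by (auto intro!: exI[of _ a] cone_gen_0)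
    next
      case False
      then have "a *s x - 0 *s w \<in> cone_gen F" using that cone_gen_scale[OF cone_gen_mem] by auto
      then show ?thesis by blast
    qed
  qed
  ultimately show "\<exists>l\<ge>0. v - l *s w \<in> cone_gen F" by blast
next
  fix v assume "v \<in> {v. \<exists>l\<ge>0. v - l *s w \<in> cone_gen F}"
  then obtain l where "l \<ge> 0" "v - l *s w \<in> cone_gen F" by blast
  then have "l *s w + (v - l *s w) \<in> cone_gen (insert w F)"
    using cone_gen_mono[of F "insert w F"] cone_gen_scale[OF cone_gen_mem[of w "insert w F"], of l]
    by (intro cone_gen_add) auto
  then show "v \<in> cone_gen (insert w F)" by simp
qed

lemma ex_between_rat:
  fixes L U :: "rat set"
  assumes "finite L" "finite U" "\<And>l u. l \<in> L \<Longrightarrow> u \<in> U \<Longrightarrow> l \<le> u" "L \<noteq> {}"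
  obtains x where "\<And>l. l \<in> L \<Longrightarrow> l \<le> x" "\<And>u. u \<in> U \<Longrightarrow> x \<le> u"
  using that[of "Max L"] assms by auto

text \<open>Fourier-Motzkin elimination of the coefficient of the last generator.\<close>

theorem cone_gen_halfspaces:
  assumes "finite F"
  obtains G where "finite G" "cone_gen F = {v. \<forall>u\<in>G. pairQ u v \<ge> 0}"
proof -
  have "\<exists>G. finite G \<and> cone_gen F = {v. \<forall>u\<in>G. pairQ u v \<ge> 0}"
    using assms
  proof (induction F rule: finite_induct)
    case empty
    let ?G = "range (\<lambda>i. axis i 1) \<union> range (\<lambda>i. - axis i (1::rat))"
    have "cone_gen {} = {v. \<forall>u\<in>?G. pairQ u v \<ge> 0}"
      by (auto simp: cone_gen_eq ball_Un pairQ_axis pairQ_uminus_left vec_eq_iff order_antisym)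
    then show ?case by (intro exI[of _ ?G]) auto
  next
    case (insert w F)
    then obtain G where G: "finite G" "cone_gen F = {v. \<forall>u\<in>G. pairQ u v \<ge> 0}" by blast
    let ?P = "{u\<in>G. pairQ u w > 0}" and ?N = "{u\<in>G. pairQ u w < 0}"
    \<comment> \<open>Forms nonnegative on \<open>w\<close> are kept; each pair of opposite signs on
      \<open>w\<close> contributes its positive combination vanishing on \<open>w\<close>.\<close>
    let ?G' = "{u\<in>G. pairQ u w \<ge> 0} \<union> (\<lambda>(u, u'). pairQ u w *s u' - pairQ u' w *s u) ` (?P \<times> ?N)"
    have "cone_gen (insert w F) = {v. \<forall>u\<in>?G'. pairQ u v \<ge> 0}"
      unfolding cone_gen_insert[OF insert.hyps(1)] G(2)
    proof (intro set_eqI iffI CollectI ballI)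
      fix v u assume v: "v \<in> {v. \<exists>l\<ge>0. v - l *s w \<in> {v. \<forall>u\<in>G. pairQ u v \<ge> 0}}" and u: "u \<in> ?G'"
      then obtain l where l: "l \<ge> 0" "\<And>u. u \<in> G \<Longrightarrow> l * pairQ u w \<le> pairQ u v"
        by (auto simp: pairQ_simps)
      from u show "pairQ u v \<ge> 0"
      proof
        assume "u \<in> {u\<in>G. pairQ u w \<ge> 0}"
        then have u: "u \<in> G" "pairQ u w \<ge> 0" by auto
        have "0 \<le> l * pairQ u w" using l(1) u(2) by simp
        also have "\<dots> \<le> pairQ u v" using l(2) u(1) .
        finally show ?thesis .
      next
        assume "u \<in> (\<lambda>(u, u'). pairQ u w *s u' - pairQ u' w *s u) ` (?P \<times> ?N)"
        then obtain a b where ab: "a \<in> G" "pairQ a w > 0" "b \<in> G" "pairQ b w < 0"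
          "u = pairQ a w *s b - pairQ b w *s a" by auto
        have "pairQ a w * (l * pairQ b w) \<le> pairQ a w * pairQ b v"
          using ab l by (intro mult_left_mono) auto
        moreover have "pairQ b w * pairQ a v \<le> pairQ b w * (l * pairQ a w)"
          using ab l by (intro mult_left_mono_neg) auto
        ultimately show ?thesis by (simp add: ab(5) pairQ_simps algebra_simps)
      qed
    next
      fix v assume v: "v \<in> {v. \<forall>u\<in>?G'. pairQ u v \<ge> 0}"
      \<comment> \<open>The entry 0 encodes \<open>l \<ge> 0\<close>. The forms negative on
        \<open>w\<close> bound \<open>l\<close> from below, those positive on \<open>w\<close> bound
        it from above.\<close>
      define L where "L = insert 0 ((\<lambda>u. pairQ u v / pairQ u w) ` ?N)"
      define U where "U = (\<lambda>u. pairQ u v / pairQ u w) ` ?P"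
      have LU: "l \<le> u" if lu: "l \<in> L" "u \<in> U" for l u
      proof -
        obtain a where a: "a \<in> G" "pairQ a w > 0" "u = pairQ a v / pairQ a w" using lu by (auto simp: U_def)
        show ?thesis
        proof (cases "l = 0")
          case True
          then show ?thesis using v a by auto
        next
          case False
          then obtain b where b: "b \<in> G" "pairQ b w < 0" "l = pairQ b v / pairQ b w" using lu by (auto simp: L_def)
          have "pairQ a w *s b - pairQ b w *s a \<in> ?G'" using a b by force
          then have "pairQ (pairQ a w *s b - pairQ b w *s a) v \<ge> 0" using v by blast
          then have "pairQ b w * pairQ a v \<le> pairQ a w * pairQ b v" by (simp add: pairQ_simps)
          then show ?thesis unfolding a(3) b(3) using a(2) b(2) by (simp add: field_simps)
        qed
      qed
      have "finite L" "finite U" "L \<noteq> {}" using G(1) by (auto simp: L_def U_def)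
      with LU obtain l where l: "\<And>x. x \<in> L \<Longrightarrow> x \<le> l" "\<And>x. x \<in> U \<Longrightarrow> l \<le> x"
        using ex_between_rat[of L U] by metis
      have "pairQ u (v - l *s w) \<ge> 0" if u: "u \<in> G" for u
      proof -
        consider "pairQ u w = 0" | "pairQ u w > 0" | "pairQ u w < 0" by linarith
        then show ?thesis
        proof cases
          case 1
          then show ?thesis using v u by (auto simp: pairQ_simps)
        next
          case 2
          then have "l \<le> pairQ u v / pairQ u w" using l(2) u by (auto simp: U_def)
          then show ?thesis using 2 by (simp add: pairQ_simps field_simps)
        next
          case 3
          then have "pairQ u v / pairQ u w \<le> l" using l(1) u by (auto simp: L_def)
          then show ?thesis using 3 by (simp add: pairQ_simps field_simps)
        qed
      qed
      moreover have "l \<ge> 0" using l(1) by (auto simp: L_def)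
      ultimately show "\<exists>l\<ge>0. v - l *s w \<in> {v. \<forall>u\<in>G. pairQ u v \<ge> 0}" by blast
    qed
    moreover have "finite ?G'" using G(1) by auto
    ultimately show ?case by blast
  qed
  then show ?thesis using that by blast
qed

lemma farkas:
  assumes "finite F" "v \<notin> cone_gen F"
  obtains u where "\<And>f. f \<in> F \<Longrightarrow> pairQ u f \<ge> 0" "pairQ u v < 0"
proof -
  obtain G where G: "finite G" "cone_gen F = {v. \<forall>u\<in>G. pairQ u v \<ge> 0}"
    using cone_gen_halfspaces[OF assms(1)] .
  then obtain u where "u \<in> G" "\<not> pairQ u v \<ge> 0" using assms(2) by auto
  then show ?thesis using that[of u] G(2) cone_gen_mem[of _ F] by force
qed

text \<open>By duality: the normals \<open>G\<close> generate a cone, and the normals of its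
  halfspace description are the required generators, as Farkas' lemma shows.\<close>

theorem halfspaces_cone_gen:
  assumes "finite G"
  obtains F where "finite F" "{v. \<forall>u\<in>G. pairQ u v \<ge> 0} = cone_gen F"
proof -
  obtain F where F: "finite F" "cone_gen G = {v. \<forall>u\<in>F. pairQ u v \<ge> 0}"
    using cone_gen_halfspaces[OF assms] .
  have "v \<in> cone_gen F" if v: "\<forall>u\<in>G. pairQ u v \<ge> 0" for v
  proof (rule ccontr)
    assume "v \<notin> cone_gen F"
    then obtain x where x: "\<And>f. f \<in> F \<Longrightarrow> pairQ x f \<ge> 0" "pairQ x v < 0" using farkas F(1) by blast
    then have "x \<in> cone_gen G" unfolding F(2) by (simp add: pairQ_commute)
    then have "pairQ v x \<ge> 0"
      by (rule pairQ_cone_gen_nonneg[rotated]) (use v in \<open>simp add: pairQ_commute\<close>)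
    then show False using x(2) by (simp add: pairQ_commute)
  qed
  moreover have "pairQ u v \<ge> 0" if "v \<in> cone_gen F" "u \<in> G" for u v
  proof (rule pairQ_cone_gen_nonneg[OF _ that(1)])
    have "u \<in> cone_gen G" using that cone_gen_mem by blast
    then show "pairQ u s \<ge> 0" if "s \<in> F" for s using F(2) that by (auto simp: pairQ_commute)
  qed
  ultimately have "{v. \<forall>u\<in>G. pairQ u v \<ge> 0} = cone_gen F" by blast
  then show ?thesis using that F(1) by blast
qed

lemma dualN_eq_dualQ: "dualN = dualQ"
  by (auto simp: fun_eq_iff dualN_def dualQ_def pairQ_commute)

lemma dualQ_cone_gen: "dualQ (cone_gen F) = {u. \<forall>v\<in>F. pairQ u v \<ge> 0}"
  unfolding dualQ_def using pairQ_cone_gen_nonneg[of F] cone_gen_mem[of _ F] by blast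

lemma dualQ_dualQ:
  assumes "finite F"
  shows "dualQ (dualQ (cone_gen F)) = cone_gen F"
proof
  show "cone_gen F \<subseteq> dualQ (dualQ (cone_gen F))" by (auto simp: dualQ_def pairQ_commute)
  show "dualQ (dualQ (cone_gen F)) \<subseteq> cone_gen F"
  proof
    fix v assume v: "v \<in> dualQ (dualQ (cone_gen F))"
    show "v \<in> cone_gen F"
    proof (rule ccontr)
      assume "v \<notin> cone_gen F"
      then obtain u where "\<And>f. f \<in> F \<Longrightarrow> pairQ u f \<ge> 0" "pairQ u v < 0" using farkas assms by blast
      then have "u \<in> dualQ (cone_gen F)" by (simp add: dualQ_cone_gen)
      then show False using v \<open>pairQ u v < 0\<close> by (force simp: dualQ_def pairQ_commute)
    qed
  qed
qed

subsection \<open>Homogenization\<close>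

text \<open>The extra coordinate turns the affine condition \<open>pairQ u v + c \<ge> 0\<close>
  into the pairing of \<open>homog u c\<close> with \<open>homog v 1\<close>.\<close>

definition homog :: "rat^'n::finite \<Rightarrow> rat \<Rightarrow> rat^('n option)" where
  "homog v s = (\<chi> i. case i of None \<Rightarrow> s | Some j \<Rightarrow> v $ j)"

definition dehomog :: "rat^('n::finite option) \<Rightarrow> rat^'n" where
  "dehomog x = (\<chi> j. x $ Some j)"

lemma homog_nth [simp]: "homog v s $ None = s" "homog v s $ Some j = v $ j"
  by (auto simp: homog_def)

lemma dehomog_nth [simp]: "dehomog x $ j = x $ Some j"
  by (simp add: dehomog_def)

lemma vec_option_eq_iff: "x = y \<longleftrightarrow> x $ None = y $ None \<and> dehomog x = dehomog y"
  by (auto simp: vec_eq_iff split_option_all)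

lemma dehomog_homog [simp]: "dehomog (homog v s) = v"
  by (simp add: vec_eq_iff)

lemma pairQ_option: "pairQ x y = x $ None * y $ None + pairQ (dehomog x) (dehomog y)"
  by (simp add: pairQ_def UNIV_option_conv sum.reindex)

lemma dehomog_linear: "dehomog (x + y) = dehomog x + dehomog y" "dehomog (c *s x) = c *s dehomog x"
    "dehomog 0 = 0" "dehomog (x - y) = dehomog x - dehomog y"
  by (simp_all add: vec_eq_iff)

lemma dehomog_sum: "dehomog (\<Sum>i\<in>I. f i) = (\<Sum>i\<in>I. dehomog (f i))"
  by (simp add: vec_eq_iff)

section \<open>Polyhedra and lattices\<close>

lemma pairing_eq: "pairing m v = pairQ (toQ m) v"
  by (simp add: pairing_def pairQ_def toQ_def)

lemma toQ_nth [simp]: "toQ m $ i = of_int (m $ i)"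
  by (simp add: toQ_def)

lemma toQ_linear: "toQ (m + m') = toQ m + toQ m'" "toQ (c *s m) = of_int c *s toQ m" "toQ 0 = 0"
    "toQ (m - m') = toQ m - toQ m'" "toQ (- m) = - toQ m"
  by (simp_all add: vec_eq_iff)

lemma toQ_sum: "toQ (\<Sum>i\<in>I. f i) = (\<Sum>i\<in>I. toQ (f i))"
  by (simp add: vec_eq_iff)

lemma toQ_inj: "toQ m = toQ m' \<longleftrightarrow> m = m'"
  by (simp add: vec_eq_iff)

lemma dualM_eq: "m \<in> dualM \<sigma> \<longleftrightarrow> toQ m \<in> dualQ \<sigma>"
  by (simp add: dualM_def dualQ_def pairing_eq)

lemma dualM_0: "0 \<in> dualM \<sigma>"
  by (simp add: dualM_def pairing_eq toQ_linear pairQ_simps)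

lemma ex_int_multiple: "\<exists>k::nat. k > 0 \<and> (\<exists>j::int. of_nat k * x = (of_int j :: rat))"
proof -
  obtain a b where ab: "quotient_of x = (a, b)" by force
  then have "b > 0" "x = of_int a / of_int b" using quotient_of_denom_pos quotient_of_div by auto
  then show ?thesis by (intro exI[of _ "nat b"] conjI exI[of _ a]) auto
qed

lemma ex_int_multiple_vec:
  fixes u :: "rat^'n::finite"
  shows "\<exists>k::nat. k > 0 \<and> (\<exists>m. of_nat k *s u = toQ m)"
proof -
  have "\<forall>i. \<exists>k::nat. k > 0 \<and> (\<exists>j::int. of_nat k * (u $ i) = of_int j)"
    using ex_int_multiple by blast
  then obtain k where k: "\<And>i. k i > (0::nat)" "\<And>i. \<exists>j::int. of_nat (k i) * (u $ i) = of_int j"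
    unfolding choice_iff by blast
  define K where "K = (\<Prod>i\<in>UNIV. k i)"
  have "\<exists>j::int. of_nat K * (u $ i) = of_int j" for i
  proof -
    obtain j :: int where j: "of_nat (k i) * (u $ i) = of_int j" using k(2) by blast
    have "K = k i * (\<Prod>i\<in>UNIV - {i}. k i)" unfolding K_def by (rule prod.remove) auto
    then have "of_nat K * (u $ i) = of_int (j * int (\<Prod>i\<in>UNIV - {i}. k i))"
      using j by (simp add: mult_ac)
    then show ?thesis by blast
  qed
  then obtain j :: "'n \<Rightarrow> int" where "\<And>i. of_nat K * (u $ i) = of_int (j i)" by metis
  then have "of_nat K *s u = toQ (\<chi> i. j i)" by (simp add: vec_eq_iff)
  moreover have "K > 0" unfolding K_def using k(1) by (simp add: prod_pos)
  ultimately show ?thesis by blast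
qed

lemma cone_gen_image:
  assumes "finite I" "x \<in> cone_gen (g ` I)"
  obtains l where "\<And>i. i \<in> I \<Longrightarrow> l i \<ge> 0" "x = (\<Sum>i\<in>I. l i *s g i)"
proof -
  have "cone_gen (g ` I) \<subseteq> {(\<Sum>i\<in>I. l i *s g i) | l. \<forall>i\<in>I. l i \<ge> 0}"
  proof (rule cone_gen_least)
    show "0 \<in> {(\<Sum>i\<in>I. l i *s g i) | l. \<forall>i\<in>I. l i \<ge> 0}"
      by (intro CollectI exI[of _ "\<lambda>_. 0"]) auto
    show "x + y \<in> {(\<Sum>i\<in>I. l i *s g i) | l. \<forall>i\<in>I. l i \<ge> 0}"
      if xy: "x \<in> {(\<Sum>i\<in>I. l i *s g i) | l. \<forall>i\<in>I. l i \<ge> 0}" "y \<in> {(\<Sum>i\<in>I. l i *s g i) | l. \<forall>i\<in>I. l i \<ge> 0}" for x y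
    proof -
      obtain l k where "x = (\<Sum>i\<in>I. l i *s g i)" "y = (\<Sum>i\<in>I. k i *s g i)" "\<forall>i\<in>I. l i \<ge> 0" "\<forall>i\<in>I. k i \<ge> 0"
        using xy by blast
      then show ?thesis
        by (intro CollectI exI[of _ "\<lambda>i. l i + k i"])
          (auto simp: vector_sadd_rdistrib sum.distrib)
    qed
    show "a *s x \<in> {(\<Sum>i\<in>I. l i *s g i) | l. \<forall>i\<in>I. l i \<ge> 0}" if a: "a \<ge> 0" "x \<in> g ` I" for a x
    proof -
      obtain k where k: "k \<in> I" "x = g k" using a(2) by auto
      have "(\<Sum>i\<in>I. (if i = k then a else 0) *s g i) = (\<Sum>i\<in>I. if i = k then a *s g i else 0)"
        by (intro sum.cong) auto
      also have "\<dots> = a *s x" using k assms(1) by simp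
      finally show ?thesis using a(1) by (intro CollectI exI[of _ "\<lambda>i. if i = k then a else 0"]) auto
    qed
  qed
  then show ?thesis using assms(2) that by blast
qed

lemma cone_gen_scale_gens:
  assumes "\<And>i. i \<in> I \<Longrightarrow> k i > 0"
  shows "cone_gen ((\<lambda>i. k i *s i) ` I) = cone_gen I"
proof
  show "cone_gen ((\<lambda>i. k i *s i) ` I) \<subseteq> cone_gen I"
  proof (rule cone_gen_subset, rule image_subsetI)
    fix i assume "i \<in> I"
    then show "k i *s i \<in> cone_gen I" using assms[of i] by (intro cone_gen_scale cone_gen_mem) auto
  qed
  show "cone_gen I \<subseteq> cone_gen ((\<lambda>i. k i *s i) ` I)"
  proof (rule cone_gen_subset, rule subsetI)
    fix i assume i: "i \<in> I"
    then have "(1 / k i) *s (k i *s i) \<in> cone_gen ((\<lambda>i. k i *s i) ` I)"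
      using assms[OF i] by (intro cone_gen_scale cone_gen_mem) auto
    then show "i \<in> cone_gen ((\<lambda>i. k i *s i) ` I)"
      using assms[OF i] by (simp add: vector_smult_assoc)
  qed
qed

text \<open>The homogeneous Farkas lemma applied to the vectors \<open>(a i, b i)\<close> and \<open>(0, 1)\<close>.\<close>

lemma affine_farkas:
  assumes I: "finite I"
    and cone: "\<And>v. (\<And>i. i \<in> I \<Longrightarrow> pairQ (a i) v \<ge> 0) \<Longrightarrow> pairQ u v \<ge> 0"
    and poly: "\<And>v. (\<And>i. i \<in> I \<Longrightarrow> pairQ (a i) v + b i \<ge> 0) \<Longrightarrow> pairQ u v + c \<ge> 0"
  obtains l where "\<And>i. i \<in> I \<Longrightarrow> l i \<ge> 0" "(\<Sum>i\<in>I. l i *s a i) = u" "(\<Sum>i\<in>I. l i * b i) \<le> c"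
proof -
  define g where "g i = (case i of None \<Rightarrow> homog 0 1 | Some i \<Rightarrow> homog (a i) (b i))" for i
  let ?J = "insert None (Some ` I)"
  have "homog u c \<in> cone_gen (g ` ?J)"
  proof (rule ccontr)
    assume "\<not> ?thesis"
    then obtain x where x: "\<And>f. f \<in> g ` ?J \<Longrightarrow> pairQ x f \<ge> 0" "pairQ x (homog u c) < 0"
      using farkas[of "g ` ?J" "homog u c"] I by blast
    define s v where "s = x $ None" and "v = dehomog x"
    have s: "s \<ge> 0" using x(1)[of "g None"] by (simp add: g_def pairQ_option s_def pairQ_simps)
    have ab: "s * b i + pairQ (a i) v \<ge> 0" if "i \<in> I" for i
    proof -
      have "g (Some i) \<in> g ` ?J" using that by blast
      from x(1)[OF this] show ?thesis by (simp add: g_def pairQ_option s_def v_def pairQ_commute)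
    qed
    have neg: "s * c + pairQ u v < 0"
      using x(2) by (simp add: pairQ_option s_def v_def pairQ_commute)
    show False
    proof (cases "s = 0")
      \<comment> \<open>At height 0 the separating vector is a direction of the tail cone, where
        only \<open>cone\<close> can help. For an empty polyhedron this is the only case that
        occurs.\<close>
      case True
      then have "pairQ u v \<ge> 0" using ab by (intro cone) auto
      then show False using neg True by simp
    next
      case False
      then have "s > 0" using s by simp
      have "pairQ u ((1 / s) *s v) + c \<ge> 0"
      proof (rule poly)
        fix i assume "i \<in> I"
        then show "pairQ (a i) ((1 / s) *s v) + b i \<ge> 0"
          using ab[of i] \<open>s > 0\<close> by (simp add: pairQ_simps field_simps)
      qed
      then show False using neg \<open>s > 0\<close> by (simp add: pairQ_simps field_simps)
    qed
  qed
  then obtain l where l: "\<And>i. i \<in> ?J \<Longrightarrow> l i \<ge> 0" "homog u c = (\<Sum>i\<in>?J. l i *s g i)"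
    using cone_gen_image[of ?J "homog u c" g] I by auto
  have sum: "(\<Sum>i\<in>?J. h i) = h None + (\<Sum>i\<in>I. h (Some i))" for h :: "'a option \<Rightarrow> 'c::comm_monoid_add"
    using I by (simp add: sum.reindex)
  have "u = (\<Sum>i\<in>I. l (Some i) *s a i)"
    using arg_cong[OF l(2), of dehomog] by (simp only: sum) (simp add: g_def dehomog_linear dehomog_sum)
  moreover have "c = l None + (\<Sum>i\<in>I. l (Some i) * b i)"
    using arg_cong[OF l(2), of "\<lambda>x. x $ None"] by (simp only: sum) (simp add: g_def)
  ultimately show ?thesis using l(1) by (intro that[of "\<lambda>i. l (Some i)"]) auto
qed

subsection \<open>Polyhedra with a given tail cone\<close>

lemma polytope_hull_eq: "polytope_hull V = {(\<Sum>w\<in>V. c w *s w) | c. (\<forall>w\<in>V. c w \<ge> 0) \<and> (\<Sum>w\<in>V. c w) = 1}"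
  unfolding polytope_hull_def lincomb_eq by blast

lemma polytope_hull_mem:
  assumes "finite V" "w \<in> V"
  shows "w \<in> polytope_hull V"
proof -
  have "(\<Sum>x\<in>V. (if x = w then 1 else 0) *s x) = (\<Sum>x\<in>V. if x = w then x else (0 :: rat^'a))"
    by (intro sum.cong) auto
  then show ?thesis unfolding polytope_hull_eq using assms
    by (intro CollectI exI[of _ "\<lambda>x. if x = w then 1 else 0"]) auto
qed

lemma polytope_hull_image:
  assumes "finite E" "\<And>e. e \<in> E \<Longrightarrow> l e \<ge> 0" "(\<Sum>e\<in>E. l e) = 1"
  shows "(\<Sum>e\<in>E. l e *s g e) \<in> polytope_hull (g ` E)"
proof -
  \<comment> \<open>\<open>g\<close> may identify elements of \<open>E\<close>, whereas a hull sums
    over a set of points; so the coefficients are added up along each fibre.\<close>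
  define c where "c w = (\<Sum>e\<in>{e\<in>E. g e = w}. l e)" for w
  have "(\<Sum>w\<in>g ` E. c w *s w) = (\<Sum>w\<in>g ` E. \<Sum>e\<in>{e\<in>E. g e = w}. l e *s g e)"
    by (intro sum.cong) (auto simp: c_def vec_eq_iff sum_distrib_right)
  also have "\<dots> = (\<Sum>e\<in>E. l e *s g e)" using sum.image_gen[OF assms(1), of "\<lambda>e. l e *s g e" g] by simp
  finally have 1: "(\<Sum>w\<in>g ` E. c w *s w) = (\<Sum>e\<in>E. l e *s g e)" .
  have "(\<Sum>w\<in>g ` E. c w) = 1"
    unfolding c_def using sum.image_gen[OF assms(1), of l g] assms(3) by simp
  moreover have "\<forall>w\<in>g ` E. c w \<ge> 0" unfolding c_def using assms(2) by (auto intro!: sum_nonneg)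
  ultimately show ?thesis unfolding polytope_hull_eq 1[symmetric] by blast
qed

definition vpolyhedron :: "(rat^'n::finite) set \<Rightarrow> (rat^'n) set \<Rightarrow> (rat^'n) set" where
  "vpolyhedron \<sigma> V = {p + s | p s. p \<in> polytope_hull V \<and> s \<in> \<sigma>}"

lemma sigma_polyhedron_iff: "sigma_polyhedron \<sigma> \<Delta> \<longleftrightarrow> (\<exists>V. finite V \<and> V \<noteq> {} \<and> \<Delta> = vpolyhedron \<sigma> V)"
  by (simp add: sigma_polyhedron_def vpolyhedron_def)

lemma vpolyhedron_nonneg_iff:
  assumes "finite V" "0 \<in> \<sigma>" "u \<in> dualQ \<sigma>"
  shows "(\<forall>v\<in>vpolyhedron \<sigma> V. pairQ u v + c \<ge> 0) \<longleftrightarrow> (\<forall>w\<in>V. pairQ u w + c \<ge> 0)"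
proof
  assume *: "\<forall>v\<in>vpolyhedron \<sigma> V. pairQ u v + c \<ge> 0"
  have "w \<in> vpolyhedron \<sigma> V" if "w \<in> V" for w
    unfolding vpolyhedron_def using polytope_hull_mem[OF assms(1) that] assms(2)
    by (intro CollectI exI[of _ w] exI[of _ 0]) auto
  then show "\<forall>w\<in>V. pairQ u w + c \<ge> 0" using * by blast
next
  assume *: "\<forall>w\<in>V. pairQ u w + c \<ge> 0"
  show "\<forall>v\<in>vpolyhedron \<sigma> V. pairQ u v + c \<ge> 0"
  proof
    fix v assume "v \<in> vpolyhedron \<sigma> V"
    then obtain l s where l: "\<forall>w\<in>V. l w \<ge> 0" "(\<Sum>w\<in>V. l w) = 1" "s \<in> \<sigma>" "v = (\<Sum>w\<in>V. l w *s w) + s"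
      unfolding vpolyhedron_def polytope_hull_eq by blast
    have "0 \<le> (\<Sum>w\<in>V. l w * (pairQ u w + c))" using l(1) * by (intro sum_nonneg) auto
    also have "\<dots> = (\<Sum>w\<in>V. l w * pairQ u w) + c"
      by (simp add: distrib_left sum.distrib l(2) flip: sum_distrib_right)
    finally have "0 \<le> (\<Sum>w\<in>V. l w * pairQ u w) + c" .
    moreover have "pairQ u s \<ge> 0" using assms(3) l(3) by (simp add: dualQ_def)
    ultimately show "pairQ u v + c \<ge> 0" by (simp add: l(4) pairQ_simps)
  qed
qed

text \<open>The point lies in the polyhedron if (v, 1) lies in the cone spanned by the vertices at
  height 1 and the rays at height 0. Otherwise Farkas' lemma gives a form whose last coordinate is
  the constant \<open>c\<close>.\<close>

lemma vpolyhedron_separation: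
  assumes "finite V" "finite F" "v \<notin> vpolyhedron (cone_gen F) V"
  obtains u c where "u \<in> dualQ (cone_gen F)" "pairQ u v + c < 0" "\<And>w. w \<in> V \<Longrightarrow> pairQ u w + c \<ge> 0"
proof -
  define g where "g i = (case i of Inl w \<Rightarrow> homog w 1 | Inr f \<Rightarrow> homog f 0)" for i :: "(rat^'a) + (rat^'a)"
  let ?J = "V <+> F"
  have notin: "homog v 1 \<notin> cone_gen (g ` ?J)"
  proof
    assume "homog v 1 \<in> cone_gen (g ` ?J)"
    then obtain l where l: "\<And>i. i \<in> ?J \<Longrightarrow> l i \<ge> 0" "homog v 1 = (\<Sum>i\<in>?J. l i *s g i)"
      using cone_gen_image[of ?J "homog v 1" g] assms by auto
    have sum: "(\<Sum>i\<in>?J. h i) = (\<Sum>w\<in>V. h (Inl w)) + (\<Sum>f\<in>F. h (Inr f))" for h :: "_ \<Rightarrow> 'c::comm_monoid_add"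
      using assms by (simp add: sum.Plus)
    have "v = (\<Sum>w\<in>V. l (Inl w) *s w) + (\<Sum>f\<in>F. l (Inr f) *s f)"
      using arg_cong[OF l(2), of dehomog] by (simp only: sum) (simp add: g_def dehomog_linear dehomog_sum)
    moreover have "(\<Sum>w\<in>V. l (Inl w)) = 1"
      using arg_cong[OF l(2), of "\<lambda>x. x $ None"] by (simp only: sum) (simp add: g_def)
    moreover have "(\<Sum>f\<in>F. l (Inr f) *s f) \<in> cone_gen F"
      unfolding cone_gen_finite[OF assms(2)] using l(1) by (intro CollectI exI[of _ "\<lambda>f. l (Inr f)"]) auto
    ultimately have "v \<in> vpolyhedron (cone_gen F) V"
      unfolding vpolyhedron_def polytope_hull_eq using l(1)
      by (intro CollectI exI[of _ "\<Sum>w\<in>V. l (Inl w) *s w"] exI[of _ "\<Sum>f\<in>F. l (Inr f) *s f"]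
          conjI exI[of _ "\<lambda>w. l (Inl w)"]) auto
    then show False using assms(3) by blast
  qed
  have fin: "finite (g ` ?J)" using assms by simp
  obtain x where x: "\<And>f. f \<in> g ` ?J \<Longrightarrow> pairQ x f \<ge> 0" "pairQ x (homog v 1) < 0"
    using farkas[OF fin notin] by blast
  show ?thesis
  proof (rule that[of "dehomog x" "x $ None"])
    show "dehomog x \<in> dualQ (cone_gen F)" unfolding dualQ_cone_gen
    proof (intro CollectI ballI)
      fix f assume "f \<in> F"
      then have "g (Inr f) \<in> g ` ?J" by blast
      from x(1)[OF this] show "pairQ (dehomog x) f \<ge> 0" by (simp add: g_def pairQ_option)
    qed
    show "pairQ (dehomog x) v + x $ None < 0" using x(2) by (simp add: pairQ_option)
    fix w assume "w \<in> V"
    then have "g (Inl w) \<in> g ` ?J" by blast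
    from x(1)[OF this] show "pairQ (dehomog x) w + x $ None \<ge> 0" by (simp add: g_def pairQ_option)
  qed
qed

text \<open>The cone over the polyhedron is finitely generated. Its generators of positive height,
  scaled to height 1, span the polytope, and those of height 0 lie in the tail cone; a point of the
  polyhedron forces some height to be positive.\<close>

lemma halfspaces_sigma_polyhedron:
  fixes a :: "'i \<Rightarrow> rat^'n::finite"
  assumes I: "finite I" and \<sigma>: "\<sigma> = {v. \<forall>i\<in>I. pairQ (a i) v \<ge> 0}"
    and ne: "{v. \<forall>i\<in>I. pairQ (a i) v \<ge> - b i} \<noteq> {}"
  shows "sigma_polyhedron \<sigma> {v. \<forall>i\<in>I. pairQ (a i) v \<ge> - b i}"
proof -
  let ?D = "{v. \<forall>i\<in>I. pairQ (a i) v \<ge> - b i}"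
  let ?G = "insert (homog 0 1) ((\<lambda>i. homog (a i) (b i)) ` I)"
  have G: "finite ?G" using I by simp
  obtain E where E: "finite E" "{x. \<forall>u\<in>?G. pairQ u x \<ge> 0} = cone_gen E"
    using halfspaces_cone_gen[OF G] .
  have memC: "x \<in> cone_gen E \<longleftrightarrow> x $ None \<ge> 0 \<and> (\<forall>i\<in>I. b i * x $ None + pairQ (a i) (dehomog x) \<ge> 0)" for x
    unfolding E(2)[symmetric] by (auto simp: pairQ_option pairQ_simps)
  define P where "P = {e\<in>E. e $ None > 0}"
  define g where "g e = (1 / e $ None) *s dehomog e" for e :: "rat^('n option)"
  have EP: "finite P" using E(1) by (simp add: P_def)
  have E0: "e $ None = 0" if "e \<in> E - P" for e
    using that memC[of e] cone_gen_mem[of e E] by (auto simp: P_def)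
  have rep: "\<exists>l. (\<forall>e\<in>E. l e \<ge> 0) \<and> (\<Sum>e\<in>P. l e * e $ None) = 1
      \<and> v = (\<Sum>e\<in>P. (l e * e $ None) *s g e) + (\<Sum>e\<in>E - P. l e *s dehomog e)" if "v \<in> ?D" for v
  proof -
    have "homog v 1 \<in> cone_gen E" using that by (auto simp: memC)
    then obtain l where l: "\<forall>e\<in>E. l e \<ge> 0" "homog v 1 = (\<Sum>e\<in>E. l e *s e)"
      unfolding cone_gen_finite[OF E(1)] by blast
    have split: "(\<Sum>e\<in>E. h e) = (\<Sum>e\<in>P. h e) + (\<Sum>e\<in>E - P. h e)" for h :: "_ \<Rightarrow> 'c::comm_monoid_add"
      using E(1) by (subst sum.subset_diff[of P E]) (auto simp: P_def add.commute)
    have "1 = (\<Sum>e\<in>E. l e * e $ None)" using arg_cong[OF l(2), of "\<lambda>x. x $ None"] by simp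
    then have 1: "(\<Sum>e\<in>P. l e * e $ None) = 1" using E0 by (simp add: split)
    have "v = (\<Sum>e\<in>E. l e *s dehomog e)"
      using arg_cong[OF l(2), of dehomog] by (simp add: dehomog_linear dehomog_sum)
    also have "\<dots> = (\<Sum>e\<in>P. l e *s dehomog e) + (\<Sum>e\<in>E - P. l e *s dehomog e)" by (rule split)
    also have "(\<Sum>e\<in>P. l e *s dehomog e) = (\<Sum>e\<in>P. (l e * e $ None) *s g e)"
      by (intro sum.cong) (auto simp: P_def g_def vector_smult_assoc)
    finally show ?thesis using l(1) 1 by blast
  qed
  have P_ne: "P \<noteq> {}"
  proof
    assume P: "P = {}"
    obtain v where "v \<in> ?D" using ne by blast
    from rep[OF this] P show False by simp
  qed
  have "?D = vpolyhedron \<sigma> (g ` P)"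
  proof (intro set_eqI iffI)
    fix v assume "v \<in> ?D"
    then obtain l where l: "\<forall>e\<in>E. l e \<ge> 0" "(\<Sum>e\<in>P. l e * e $ None) = 1"
       "v = (\<Sum>e\<in>P. (l e * e $ None) *s g e) + (\<Sum>e\<in>E - P. l e *s dehomog e)" using rep by blast
    have "(\<Sum>e\<in>P. (l e * e $ None) *s g e) \<in> polytope_hull (g ` P)"
      using l(1,2) EP by (intro polytope_hull_image) (auto simp: P_def)
    moreover have "(\<Sum>e\<in>E - P. l e *s dehomog e) \<in> \<sigma>"
    proof -
      have "pairQ (a i) (dehomog e) \<ge> 0" if "i \<in> I" "e \<in> E - P" for i e
        using memC[of e] cone_gen_mem[of e E] that E0[of e] by auto
      then show ?thesis unfolding \<sigma> using l(1) by (auto simp: pairQ_simps intro!: sum_nonneg)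
    qed
    ultimately show "v \<in> vpolyhedron \<sigma> (g ` P)" unfolding vpolyhedron_def l(3) by blast
  next
    fix v assume v: "v \<in> vpolyhedron \<sigma> (g ` P)"
    have "pairQ (a i) v + b i \<ge> 0" if i: "i \<in> I" for i
    proof -
      have "0 \<in> \<sigma>" "a i \<in> dualQ \<sigma>" unfolding \<sigma> using i by (auto simp: dualQ_def pairQ_simps)
      moreover have "pairQ (a i) w + b i \<ge> 0" if w: "w \<in> g ` P" for w
      proof -
        obtain e where e: "e \<in> P" "w = g e" using w by blast
        then have pos: "e $ None > 0" and "e \<in> cone_gen E" using cone_gen_mem[of e E] by (auto simp: P_def)
        then have "b i * e $ None + pairQ (a i) (dehomog e) \<ge> 0" using memC i by blast
        then show ?thesis using pos by (simp add: e(2) g_def pairQ_simps field_simps)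
      qed
      ultimately show ?thesis using vpolyhedron_nonneg_iff[of "g ` P" \<sigma> "a i" "b i"] EP v by blast
    qed
    then show "v \<in> ?D" by force
  qed
  then show ?thesis unfolding sigma_polyhedron_iff using EP P_ne by (intro exI[of _ "g ` P"]) auto
qed

text \<open>Integral generators for the cone of pairs (m, c) with h(m) + c nonnegative, where h is
  the minimum over \<open>V\<close>. The coefficients \<open>l\<close> stay rational; rounding them
  is left to the common denominator.\<close>

lemma hypograph_generators:
  fixes V F :: "(rat^'n::finite) set"
  assumes "finite V" "finite F"
  obtains E :: "((int^'n) \<times> int) set" where "finite E"
    "\<And>m c. (m, c) \<in> E \<Longrightarrow> m \<in> dualM (cone_gen F) \<and> (\<forall>w\<in>V. pairing m w + of_int c \<ge> 0)"
    "\<And>m c. m \<in> dualM (cone_gen F) \<Longrightarrow> (\<forall>w\<in>V. pairing m w + of_int c \<ge> 0) \<Longrightarrow>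
      \<exists>l. (\<forall>e\<in>E. l e \<ge> 0) \<and> toQ m = (\<Sum>e\<in>E. l e *s toQ (fst e)) \<and> of_int c = (\<Sum>e\<in>E. l e * of_int (snd e))"
proof -
  let ?G = "(\<lambda>w. homog w 1) ` V \<union> (\<lambda>f. homog f 0) ` F"
  have G: "finite ?G" using assms by simp
  obtain E where E: "finite E" "{x. \<forall>u\<in>?G. pairQ u x \<ge> 0} = cone_gen E"
    using halfspaces_cone_gen[OF G] .
  have memC: "x \<in> cone_gen E \<longleftrightarrow> dehomog x \<in> dualQ (cone_gen F) \<and> (\<forall>w\<in>V. pairQ (dehomog x) w + x $ None \<ge> 0)" for x
    unfolding E(2)[symmetric] dualQ_cone_gen by (auto simp: ball_Un pairQ_option pairQ_commute add.commute)
  obtain k m where km: "\<And>e. k e > (0::nat)" "\<And>e::rat^('n option). of_nat (k e) *s e = toQ (m e)"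
    using ex_int_multiple_vec by metis
  define h where "h e = ((\<chi> i. m e $ Some i), m e $ None)" for e
  have h: "homog (toQ (fst (h e))) (of_int (snd (h e))) = of_nat (k e) *s e" for e
    unfolding km(2) by (simp add: vec_option_eq_iff h_def) (simp add: vec_eq_iff)
  have cone: "cone_gen ((\<lambda>e. homog (toQ (fst e)) (of_int (snd e))) ` h ` E) = cone_gen E"
    unfolding image_image h using km(1) by (intro cone_gen_scale_gens) auto
  show ?thesis
  proof (rule that[of "h ` E"])
    show "finite (h ` E)" using E(1) by simp
    show "x \<in> dualM (cone_gen F) \<and> (\<forall>w\<in>V. pairing x w + of_int c \<ge> 0)" if "(x, c) \<in> h ` E" for x c
    proof -
      have "homog (toQ x) (of_int c) \<in> cone_gen E"
        unfolding cone[symmetric]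
        using imageI[OF that, of "\<lambda>e. homog (toQ (fst e)) (of_int (snd e))"] by (intro cone_gen_mem) simp
      then show ?thesis unfolding memC by (simp add: dualM_eq pairing_eq)
    qed
    show "\<exists>l. (\<forall>e\<in>h ` E. l e \<ge> 0) \<and> toQ x = (\<Sum>e\<in>h ` E. l e *s toQ (fst e)) \<and> of_int c = (\<Sum>e\<in>h ` E. l e * of_int (snd e))"
      if x: "x \<in> dualM (cone_gen F)" "\<forall>w\<in>V. pairing x w + of_int c \<ge> 0" for x c
    proof -
      have "homog (toQ x) (of_int c) \<in> cone_gen E" unfolding memC using x by (simp add: dualM_eq pairing_eq)
      then have "homog (toQ x) (of_int c) \<in> cone_gen ((\<lambda>e. homog (toQ (fst e)) (of_int (snd e))) ` h ` E)"
        unfolding cone .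
      then obtain l where l: "\<And>e. e \<in> h ` E \<Longrightarrow> l e \<ge> 0"
          "homog (toQ x) (of_int c) = (\<Sum>e\<in>h ` E. l e *s homog (toQ (fst e)) (of_int (snd e)))"
        by (rule cone_gen_image[rotated]) (use E(1) in auto)
      have "toQ x = (\<Sum>e\<in>h ` E. l e *s toQ (fst e))"
        using arg_cong[OF l(2), of dehomog] by (simp add: dehomog_linear dehomog_sum)
      moreover have "of_int c = (\<Sum>e\<in>h ` E. l e * of_int (snd e))"
        using arg_cong[OF l(2), of "\<lambda>x. x $ None"] by simp
      ultimately show ?thesis using l(1) by blast
    qed
  qed
qed

text \<open>Strong convexity keeps -f out of the cone, so some dual vector is positive on f. The sum
  of these vectors over all generators is positive on each nonzero one, and a multiple of it is
  integral.\<close>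

lemma strongly_convex_interior_point:
  assumes "finite F" "strongly_convex (cone_gen F)"
  obtains m where "\<And>f. f \<in> F \<Longrightarrow> f \<noteq> 0 \<Longrightarrow> pairing m f > 0"
proof -
  let ?F = "F - {0}"
  have "\<exists>u. u \<in> dualQ (cone_gen F) \<and> pairQ u f > 0" if f: "f \<in> ?F" for f
  proof -
    have "f \<in> cone_gen F" using f cone_gen_mem by blast
    then have "- f \<notin> cone_gen F" using assms(2) f unfolding strongly_convex_def by blast
    then obtain u where "\<And>f. f \<in> F \<Longrightarrow> pairQ u f \<ge> 0" "pairQ u (- f) < 0" using farkas assms(1) by blast
    then show ?thesis by (auto simp: dualQ_cone_gen pairQ_simps)
  qed
  then obtain u where u: "\<And>f. f \<in> ?F \<Longrightarrow> u f \<in> dualQ (cone_gen F) \<and> pairQ (u f) f > 0" by metis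
  obtain k m where km: "k > (0::nat)" "of_nat k *s (\<Sum>f\<in>?F. u f) = toQ m" using ex_int_multiple_vec by blast
  show ?thesis
  proof (rule that[of m])
    fix f assume f: "f \<in> F" "f \<noteq> 0"
    have nonneg: "pairQ (u g) f \<ge> 0" if "g \<in> ?F" for g using u[OF that] f(1) by (auto simp: dualQ_cone_gen)
    have "0 < pairQ (u f) f" using u f by blast
    also have "\<dots> \<le> (\<Sum>g\<in>?F. pairQ (u g) f)" using assms(1) nonneg f by (intro member_le_sum) auto
    finally have "0 < of_nat k * (\<Sum>g\<in>?F. pairQ (u g) f)" using km(1) by simp
    then show "pairing m f > 0" unfolding pairing_eq km(2)[symmetric] by (simp add: pairQ_simps)
  qed
qed

text \<open>A large multiple of the interior point \<open>m0\<close> moves each unit vector into the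
  dual cone, and \<open>m0\<close> itself serves to subtract it again.\<close>

lemma dualM_generates_lattice:
  fixes F :: "(rat^'n::finite) set"
  assumes "finite F" "strongly_convex (cone_gen F)"
  obtains M0 where "finite M0" "M0 \<subseteq> dualM (cone_gen F)" "\<And>m. \<exists>c. m = (\<Sum>x\<in>M0. c x *s x)"
proof -
  obtain m0 :: "int^'n" where m0: "\<And>f. f \<in> F \<Longrightarrow> f \<noteq> 0 \<Longrightarrow> pairing m0 f > 0"
    using strongly_convex_interior_point[OF assms] by blast
  have mem: "m \<in> dualM (cone_gen F) \<longleftrightarrow> (\<forall>f\<in>F. pairing m f \<ge> 0)" for m
    unfolding dualM_eq dualQ_cone_gen by (simp add: pairing_eq)
  have "\<exists>k::nat. \<forall>f\<in>F. pairing (axis i 1 + int k *s m0) f \<ge> 0" for i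
  proof -
    define k where "k = (\<Sum>f\<in>F. nat \<lceil>\<bar>f $ i\<bar> / \<bar>pairing m0 f\<bar>\<rceil>)"
    have "pairing (axis i 1 + int k *s m0) f \<ge> 0" if f: "f \<in> F" for f
    proof (cases "f = 0")
      case True then show ?thesis by (simp add: pairing_eq pairQ_simps)
    next
      case False
      then have pos: "pairing m0 f > 0" using m0 f by blast
      have "nat \<lceil>\<bar>f $ i\<bar> / \<bar>pairing m0 f\<bar>\<rceil> \<le> k" unfolding k_def
        using assms(1) f by (intro member_le_sum[of f F "\<lambda>f. nat \<lceil>\<bar>f $ i\<bar> / \<bar>pairing m0 f\<bar>\<rceil>"]) auto
      then have "\<lceil>\<bar>f $ i\<bar> / \<bar>pairing m0 f\<bar>\<rceil> \<le> int k" by simp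
      then have "\<bar>f $ i\<bar> / \<bar>pairing m0 f\<bar> \<le> of_int (int k)" by (simp only: ceiling_le_iff)
      then have "\<bar>f $ i\<bar> \<le> of_nat k * pairing m0 f" using pos by (simp add: field_simps)
      moreover have "toQ (axis i 1) = axis i 1" by (auto simp: vec_eq_iff axis_def)
      then have "pairing (axis i 1 + int k *s m0) f = f $ i + of_nat k * pairing m0 f"
        by (simp add: pairing_eq toQ_linear pairQ_simps pairQ_axis)
      ultimately show ?thesis by linarith
    qed
    then show ?thesis by blast
  qed
  then obtain k where k: "\<And>i. \<forall>f\<in>F. pairing (axis i 1 + int (k i) *s m0) f \<ge> 0" by metis
  let ?M = "insert m0 (range (\<lambda>i. axis i 1 + int (k i) *s m0))"
  define S where "S = {m. \<exists>c. m = (\<Sum>x\<in>?M. c x *s x)}"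
  have add: "x + y \<in> S" if xy: "x \<in> S" "y \<in> S" for x y
  proof -
    obtain c d where "x = (\<Sum>x\<in>?M. c x *s x)" "y = (\<Sum>x\<in>?M. d x *s x)" using xy by (auto simp: S_def)
    then have "x + y = (\<Sum>x\<in>?M. (c x + d x) *s x)"
      unfolding vector_sadd_rdistrib sum.distrib by simp
    then show ?thesis unfolding S_def by (intro CollectI exI[of _ "\<lambda>x. c x + d x"])
  qed
  have scale: "a *s x \<in> S" if x: "x \<in> S" for a x
  proof -
    obtain c where "x = (\<Sum>x\<in>?M. c x *s x)" using x by (auto simp: S_def)
    then have "a *s x = (\<Sum>x\<in>?M. (a * c x) *s x)" by (simp only: vec_eq_iff) (simp add: sum_distrib_left mult.assoc)
    then show ?thesis unfolding S_def by (intro CollectI exI[of _ "\<lambda>x. a * c x"])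
  qed
  have gen: "x \<in> S" if x: "x \<in> ?M" for x
  proof -
    have "(\<Sum>y\<in>?M. (if y = x then 1 else 0) *s y) = (\<Sum>y\<in>?M. if y = x then y else 0)"
      by (intro sum.cong) auto
    also have "\<dots> = x" using x by (subst sum.delta) auto
    finally have "x = (\<Sum>y\<in>?M. (if y = x then 1 else 0) *s y)" ..
    then show ?thesis unfolding S_def by (intro CollectI exI[of _ "\<lambda>y. if y = x then 1 else 0"])
  qed
  have zero: "0 \<in> S" using scale[OF gen[of m0], of 0] by simp
  have sum: "(\<Sum>i\<in>I. f i) \<in> S" if "\<And>i. i \<in> I \<Longrightarrow> f i \<in> S" for I f
    using that by (induction I rule: infinite_finite_induct) (auto intro: zero add)
  have "axis i 1 \<in> S" for i
  proof -
    have "(axis i 1 + int (k i) *s m0) + (- int (k i)) *s m0 \<in> S"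
      by (intro add scale gen) auto
    moreover have "(axis i 1 + int (k i) *s m0) + (- int (k i)) *s m0 = axis i 1" by (simp add: vec_eq_iff)
    ultimately show ?thesis by simp
  qed
  then have "(\<Sum>i\<in>UNIV. (m $ i) *s axis i 1) \<in> S" for m by (intro sum scale)
  moreover have "(\<Sum>i\<in>UNIV. (m $ i) *s axis i 1) = m" for m :: "int^'n"
    by (simp add: vec_eq_iff axis_def if_distrib cong: if_cong)
  ultimately have "m \<in> S" for m by metis
  moreover have "?M \<subseteq> dualM (cone_gen F)" using k m0 by (auto simp: mem) (metis less_imp_le pairQ_zero_right pairing_eq order_refl)
  ultimately show ?thesis using that[of ?M] unfolding S_def by auto
qed

subsection \<open>Sections\<close>

text \<open>The order is an integer, so the floor disappears and the infimum becomes a condition at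
  every point of \<open>D\<close>; an empty \<open>D\<close> imposes none.\<close>

lemma efloor_hmin_nonneg_iff:
  "0 \<le> ereal (of_int a) + efloor (hmin D m) \<longleftrightarrow> (\<forall>v\<in>D. pairing m v + of_int a \<ge> 0)"
proof -
  have "0 \<le> ereal (of_int a) + efloor x \<longleftrightarrow> ereal (of_int (- a)) \<le> x" for x
  proof (cases x)
    case (real r)
    have "0 \<le> ereal (of_int a) + efloor x \<longleftrightarrow> 0 \<le> a + \<lfloor>r\<rfloor>"
      using real by (simp add: efloor_def zero_ereal_def flip: of_int_add)
    also have "\<dots> \<longleftrightarrow> - a \<le> \<lfloor>r\<rfloor>" by linarith
    also have "\<dots> \<longleftrightarrow> ereal (of_int (- a)) \<le> x" using real by (simp only: le_floor_iff ereal_less_eq)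
    finally show ?thesis .
  qed (auto simp: efloor_def)
  then have "0 \<le> ereal (of_int a) + efloor (hmin D m) \<longleftrightarrow> (\<forall>v\<in>D. ereal (of_int (- a)) \<le> ereal (of_rat (pairing m v)))"
    by (simp add: hmin_def le_INF_iff)
  also have "\<dots> \<longleftrightarrow> (\<forall>v\<in>D. pairing m v + of_int a \<ge> 0)"
  proof -
    have "of_int (- a) \<le> (of_rat q :: real) \<longleftrightarrow> q + of_int a \<ge> 0" for q
    proof -
      have "of_int (- a) \<le> (of_rat q :: real) \<longleftrightarrow> of_rat (of_int (- a)) \<le> (of_rat q :: real)" by (simp only: of_rat_of_int_eq)
      also have "\<dots> \<longleftrightarrow> of_int (- a) \<le> q" by (rule of_rat_less_eq)
      finally show ?thesis by auto
    qed
    then show ?thesis by simp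
  qed
  finally show ?thesis .
qed

lemma sections_iff:
  "g \<in> sections A D m \<longleftrightarrow> g = 0 \<or> (\<forall>z\<in>closed_pts A. \<forall>v\<in>D z. pairing m v + of_int (ord_at A z g) \<ge> 0)"
  by (simp add: sections_def efloor_hmin_nonneg_iff)

lemma algD_iff:
  "f \<in> algD A \<sigma> D \<longleftrightarrow> (\<forall>m\<in>Poly_Mapping.keys f. m \<in> dualM \<sigma> \<and>
     (\<forall>z\<in>closed_pts A. \<forall>v\<in>D z. pairing m v + of_int (ord_at A z (Poly_Mapping.lookup f m)) \<ge> 0))"
  unfolding algD_def mem_Collect_eq sections_iff by (auto simp: in_keys_iff)

section \<open>Algebras generated by monomials\<close>

lemma single_nonzero: "c \<noteq> 0 \<Longrightarrow> Poly_Mapping.single m c \<noteq> 0"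
  by (metis lookup_single_eq lookup_zero)

lemma single_power:
  fixes m :: "int^'n::finite" and c :: "'k::field"
  shows "Poly_Mapping.single m c ^ k = Poly_Mapping.single (int k *s m) (c ^ k)"
proof (induction k)
  case 0 show ?case by (simp add: vec_eq_iff flip: single_one)
next
  case (Suc k)
  have "m + int k *s m = int (Suc k) *s m" by (simp add: vec_eq_iff algebra_simps)
  then show ?case by (simp add: Suc mult_single)
qed

lemma single_prod:
  fixes ms :: "'i \<Rightarrow> int^'n::finite" and fs :: "'i \<Rightarrow> 'k::field"
  assumes "finite I"
  shows "(\<Prod>i\<in>I. Poly_Mapping.single (ms i) (fs i) ^ e i) = Poly_Mapping.single (\<Sum>i\<in>I. int (e i) *s ms i) (\<Prod>i\<in>I. fs i ^ e i)"
  using assms by (induction I rule: finite_induct) (auto simp: single_power mult_single)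

lemma finite_bounded_int_vec: "finite {m :: int^'n::finite. \<forall>j. \<bar>m $ j\<bar> \<le> K j}"
proof -
  have "finite (vec_lambda ` (PiE UNIV (\<lambda>j. {- K j..K j})) :: (int^'n) set)"
    by (intro finite_imageI finite_PiE) auto
  moreover have "{m :: int^'n. \<forall>j. \<bar>m $ j\<bar> \<le> K j} \<subseteq> vec_lambda ` (PiE UNIV (\<lambda>j. {- K j..K j}))"
  proof
    fix m :: "int^'n" assume "m \<in> {m. \<forall>j. \<bar>m $ j\<bar> \<le> K j}"
    then show "m \<in> vec_lambda ` (PiE UNIV (\<lambda>j. {- K j..K j}))"
      by (intro image_eqI[of _ _ "\<lambda>j. m $ j"]) (auto simp: abs_le_iff, smt (verit))
  qed
  ultimately show ?thesis by (rule finite_subset[rotated])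
qed

subsection \<open>Algebras with a common denominator\<close>

text \<open>An ideal \<open>I\<close> of \<open>C\<close> becomes the ideal d I of \<open>B\<close>;
  finitely many generators of d I over \<open>B\<close>, divided by \<open>d\<close>, generate
  \<open>I\<close> over \<open>C\<close>.\<close>

lemma noetherian_conductor:
  fixes B C :: "(int^'n::finite \<Rightarrow>\<^sub>0 'k::field) set"
  assumes B: "noetherian_set B" "subring_set B" and C: "subring_set C" and "B \<subseteq> C"
    and d: "d \<in> C" "d \<noteq> 0" "\<And>x. x \<in> C \<Longrightarrow> d * x \<in> B"
  shows "noetherian_set C"
  unfolding noetherian_set_def
proof (intro allI impI)
  fix I assume I: "ideal_in C I"
  let ?J = "(\<lambda>x. d * x) ` I"
  have J: "ideal_in B ?J" unfolding ideal_in_def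
  proof (intro conjI ballI)
    show "?J \<subseteq> B" using d(3) ideal_subset[OF I] by blast
    show "0 \<in> ?J" using ideal_0[OF I] by force
    show "x + y \<in> ?J" if "x \<in> ?J" "y \<in> ?J" for x y
      using that ideal_add[OF I] by (auto simp flip: distrib_left)
    show "a * x \<in> ?J" if "a \<in> B" "x \<in> ?J" for a x
    proof -
      obtain y where y: "y \<in> I" "x = d * y" using \<open>x \<in> ?J\<close> by blast
      have "a * y \<in> I" using ideal_mult[OF I _ y(1)] \<open>a \<in> B\<close> assms(4) by blast
      then have "d * (a * y) \<in> ?J" by blast
      then show ?thesis by (simp add: y(2) mult.left_commute)
    qed
  qed
  obtain G where G: "finite G" "G \<subseteq> ?J" "?J = gen_ideal B G"
    using noetherian_finite_basis[OF B(1) J] .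
  obtain H where H: "finite H" "H \<subseteq> I" "G = (\<lambda>x. d * x) ` H"
    using finite_subset_image[OF G(1,2)] by blast
  have "gen_ideal B G \<subseteq> (\<lambda>x. d * x) ` gen_ideal C H"
  proof (rule gen_ideal_least)
    show "0 \<in> (\<lambda>x. d * x) ` gen_ideal C H" using gen_ideal_0[of C H] by force
    show "x + y \<in> (\<lambda>x. d * x) ` gen_ideal C H"
      if "x \<in> (\<lambda>x. d * x) ` gen_ideal C H" "y \<in> (\<lambda>x. d * x) ` gen_ideal C H" for x y
      using that gen_ideal_add[OF C] by (auto simp flip: distrib_left)
    show "a * x \<in> (\<lambda>x. d * x) ` gen_ideal C H" if "a \<in> B" "x \<in> G" for a x
    proof -
      obtain y where y: "y \<in> H" "x = d * y" using \<open>x \<in> G\<close> H(3) by blast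
      have "a * y \<in> gen_ideal C H" using gen_ideal_mult_mem[of a C y H] y(1) \<open>a \<in> B\<close> assms(4) by blast
      then have "d * (a * y) \<in> (\<lambda>x. d * x) ` gen_ideal C H" by blast
      then show ?thesis by (simp add: y(2) mult.left_commute)
    qed
  qed
  then have le: "?J \<subseteq> (\<lambda>x. d * x) ` gen_ideal C H" using G(3) by simp
  have "x \<in> gen_ideal C H" if "x \<in> I" for x
  proof -
    obtain y where "y \<in> gen_ideal C H" "d * x = d * y" using le \<open>x \<in> I\<close> by blast
    then show ?thesis using laurent_mult_cancel[OF d(2)] by metis
  qed
  moreover have "gen_ideal C H \<subseteq> I" by (rule gen_ideal_subset[OF I H(2)])
  ultimately show "\<exists>G. finite G \<and> G \<subseteq> I \<and> I = gen_ideal C G" using H by blast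
qed

text \<open>All powers of an element of \<open>C\<close> share the denominator \<open>d\<close> over
  the noetherian ring \<open>B\<close>, so the element is integral over \<open>B\<close>.
  Conversely, the normal ring \<open>C\<close> absorbs the fractions integral over
  \<open>B\<close>.\<close>

lemma normalization_conductor:
  fixes B C :: "(int^'n::finite \<Rightarrow>\<^sub>0 'k::field) set"
  assumes B: "noetherian_set B" "subring_set B" and C: "subring_set C" "normal_set C" and "B \<subseteq> C"
    and d: "d \<in> B" "d \<noteq> 0" "\<And>x. x \<in> C \<Longrightarrow> d * x \<in> B"
  shows "is_normalization B C"
  unfolding is_normalization_def
proof (intro conjI ballI impI)
  fix x assume x: "x \<in> C"
  have "d * x ^ n \<in> B" for n using d(3) subring_power[OF C(1) x] by blast
  then obtain N :: nat and c where c: "\<And>i. i < N \<Longrightarrow> c i \<in> B" "x ^ N = (\<Sum>i<N. c i * x ^ i)"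
    using noetherian_almost_integral[OF B, of d x] laurent_mult_eq_0[of d] d(2) by metis
  have "frac_integral B (d * x) d" by (rule frac_integralI[OF B(2) c refl])
  then show "\<exists>p\<in>B. \<exists>q\<in>B. q \<noteq> 0 \<and> q * x = p \<and> frac_integral B p q" using d x by blast
next
  fix p q assume "p \<in> B" "q \<in> B" "q \<noteq> 0 \<and> frac_integral B p q"
  then show "\<exists>x\<in>C. q * x = p"
    using C(2) frac_integral_mono[OF assms(5)] assms(5) unfolding normal_set_def by (metis subsetD)
qed

section \<open>Monomials whose degrees generate the lattice\<close>

locale monomial_family = dedekind A for A :: "'k::field set" +
  fixes I :: "'i set" and fs :: "'i \<Rightarrow> 'k" and ms :: "'i \<Rightarrow> int^'n::finite"
  assumes finite_I: "finite I" and fs_nonzero: "i \<in> I \<Longrightarrow> fs i \<noteq> 0"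
    and generate: "\<exists>c. m = (\<Sum>i\<in>I. c i *s ms i)"
begin

definition alg :: "(int^'n \<Rightarrow>\<^sub>0 'k) set" where
  "alg = gen_subring (Poly_Mapping.single 0 ` A \<union> (\<lambda>i. Poly_Mapping.single (ms i) (fs i)) ` I)"

lemma subring_alg: "subring_set alg"
  by (simp add: alg_def subring_gen_subring)

lemma noetherian_alg: "noetherian_set alg"
proof -
  have sub: "subring_set (Poly_Mapping.single (0 :: int^'n) ` A)"
    unfolding subring_set_def
  proof (intro conjI ballI)
    show "0 \<in> Poly_Mapping.single (0 :: int^'n) ` A" using A_intros(1) by (force intro: image_eqI[of _ _ 0])
    show "1 \<in> Poly_Mapping.single (0 :: int^'n) ` A" using A_intros(2) by (force intro: image_eqI[of _ _ 1])
    fix x y assume "x \<in> Poly_Mapping.single (0 :: int^'n) ` A" "y \<in> Poly_Mapping.single (0 :: int^'n) ` A"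
    then obtain a b where ab: "a \<in> A" "b \<in> A" "x = Poly_Mapping.single 0 a" "y = Poly_Mapping.single 0 b" by blast
    show "x + y \<in> Poly_Mapping.single 0 ` A" using ab A_intros(3) by (auto simp flip: single_add)
    show "x * y \<in> Poly_Mapping.single 0 ` A" using ab A_intros(4) by (auto simp: mult_single)
    show "- x \<in> Poly_Mapping.single 0 ` A" using ab A_intros(5) by (auto simp flip: single_uminus)
  qed
  show ?thesis unfolding alg_def
    using noetherian_image[OF noetherian subring sub] finite_I
    by (intro noetherian_gen_subring sub) (auto simp: single_add mult_single)
qed

lemma const_mem_alg: "a \<in> A \<Longrightarrow> Poly_Mapping.single 0 a \<in> alg"
  by (simp add: alg_def gen_subring_mem)

lemma gen_mem_alg: "i \<in> I \<Longrightarrow> Poly_Mapping.single (ms i) (fs i) \<in> alg"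
  by (simp add: alg_def gen_subring_mem)

lemma monomial_mem_alg:
  assumes "a \<in> A"
  shows "Poly_Mapping.single (\<Sum>i\<in>I. int (e i) *s ms i) (a * (\<Prod>i\<in>I. fs i ^ e i)) \<in> alg"
proof -
  have "Poly_Mapping.single 0 a * (\<Prod>i\<in>I. Poly_Mapping.single (ms i) (fs i) ^ e i) \<in> alg"
    using assms const_mem_alg gen_mem_alg
    by (intro subring_mult subring_prod subring_power subring_alg) auto
  then show ?thesis by (simp add: single_prod[OF finite_I] mult_single)
qed

lemma prod_fs_nonzero: "(\<Prod>i\<in>I. fs i ^ e i) \<noteq> 0"
  using fs_nonzero finite_I by simp

text \<open>An integral relation for \<open>m\<close> is split by sign: the negative coefficients
  become the exponents \<open>e'\<close> of the denominator, the positive ones those of the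
  product.\<close>

lemma single_denominator: "\<exists>d\<in>alg. d \<noteq> 0 \<and> d * Poly_Mapping.single m c \<in> alg"
proof -
  obtain k where k: "m = (\<Sum>i\<in>I. k i *s ms i)" using generate by blast
  define e e' where "e i = nat (k i)" and "e' i = nat (- k i)" for i
  obtain a b where ab: "a \<in> A" "b \<in> A" "b \<noteq> 0" "c * (\<Prod>i\<in>I. fs i ^ e' i) / (\<Prod>i\<in>I. fs i ^ e i) = a / b"
    using fractions by blast
  let ?d = "Poly_Mapping.single (\<Sum>i\<in>I. int (e' i) *s ms i) (b * (\<Prod>i\<in>I. fs i ^ e' i))"
  have "(\<Sum>i\<in>I. int (e' i) *s ms i) + m = (\<Sum>i\<in>I. int (e i) *s ms i)"
    unfolding k sum.distrib[symmetric]
    by (intro sum.cong refl) (auto simp: vec_eq_iff e_def e'_def simp flip: distrib_right)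
  moreover have "b * (\<Prod>i\<in>I. fs i ^ e' i) * c = a * (\<Prod>i\<in>I. fs i ^ e i)"
    using ab(3,4) prod_fs_nonzero[of e] by (simp add: field_simps)
  ultimately have "?d * Poly_Mapping.single m c \<in> alg"
    using monomial_mem_alg[OF ab(1), of e] by (simp add: mult_single)
  moreover have "?d \<noteq> 0" using ab(3) prod_fs_nonzero[of e'] by (intro single_nonzero) simp
  ultimately show ?thesis using monomial_mem_alg[OF ab(2), of e'] by blast
qed

lemma same_frac_alg: "same_frac alg"
proof -
  have *: "\<exists>d\<in>alg. d \<noteq> 0 \<and> (\<forall>m\<in>K. d * Poly_Mapping.single m (c m) \<in> alg)" if "finite K" for K c
    using that
  proof (induction K rule: finite_induct)
    case empty
    show ?case using subring_1[OF subring_alg] by (intro bexI[of _ 1]) auto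
  next
    case (insert m K)
    then obtain d where d: "d \<in> alg" "d \<noteq> 0" "\<And>m. m \<in> K \<Longrightarrow> d * Poly_Mapping.single m (c m) \<in> alg" by blast
    obtain d' where d': "d' \<in> alg" "d' \<noteq> 0" "d' * Poly_Mapping.single m (c m) \<in> alg"
      using single_denominator by blast
    show ?case
    proof (intro bexI[of _ "d * d'"] conjI ballI)
      show "d * d' \<noteq> 0" using laurent_mult_eq_0 d d' by blast
      show "d * d' \<in> alg" using d d' subring_mult[OF subring_alg] by blast
      fix x assume "x \<in> insert m K"
      then consider "x = m" | "x \<in> K" by blast
      then show "d * d' * Poly_Mapping.single x (c x) \<in> alg"
      proof cases
        case 1
        then show ?thesis using subring_mult[OF subring_alg d(1) d'(3)] by (simp add: mult.assoc)
      next
        case 2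
        then show ?thesis using subring_mult[OF subring_alg d'(1) d(3)] by (simp add: mult_ac)
      qed
    qed
  qed
  show ?thesis unfolding same_frac_def
  proof
    fix x :: "int^'n \<Rightarrow>\<^sub>0 'k"
    obtain d where d: "d \<in> alg" "d \<noteq> 0"
        "\<And>m. m \<in> Poly_Mapping.keys x \<Longrightarrow> d * Poly_Mapping.single m (Poly_Mapping.lookup x m) \<in> alg"
      using *[of "Poly_Mapping.keys x" "Poly_Mapping.lookup x"] by auto
    have "d * x = (\<Sum>m\<in>Poly_Mapping.keys x. d * Poly_Mapping.single m (Poly_Mapping.lookup x m))"
      by (subst poly_mapping_eq_sum_single[of x]) (rule sum_distrib_left)
    then have "d * x \<in> alg" using d(3) by (simp add: subring_sum subring_alg)
    then show "\<exists>a\<in>alg. \<exists>b\<in>alg. b \<noteq> 0 \<and> b * x = a" using d by blast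
  qed
qed

text \<open>Rounding the coefficients of a rational relation \<open>m = \<Sum> l i m\<^sub>i\<close> down leaves one of finitely many
  lattice points, so a single denominator serves all elements of \<open>C\<close>; membership in \<open>alg\<close> is
  checked locally at each point \<open>z\<close>.\<close>

theorem ex_conductor:
  assumes C: "\<And>x m z. x \<in> C \<Longrightarrow> m \<in> Poly_Mapping.keys x \<Longrightarrow> z \<in> closed_pts A \<Longrightarrow>
    \<exists>l::'i \<Rightarrow> rat. (\<forall>i\<in>I. l i \<ge> 0) \<and> toQ m = (\<Sum>i\<in>I. l i *s toQ (ms i))
      \<and> (\<Sum>i\<in>I. l i * of_int (ord_at A z (fs i))) \<le> of_int (ord_at A z (Poly_Mapping.lookup x m))"
  obtains d where "d \<in> alg" "d \<noteq> 0" "\<And>x. x \<in> C \<Longrightarrow> d * x \<in> alg"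
proof -
  obtain n where n: "\<And>m. m = (\<Sum>i\<in>I. n m i *s ms i)" using generate by metis
  \<comment> \<open>The lattice points of the half-open zonotope spanned by the degrees: the
    possible remainders after rounding down.\<close>
  define P where "P = {m. \<exists>\<mu>. (\<forall>i\<in>I. 0 \<le> \<mu> i \<and> \<mu> i < 1) \<and> toQ m = (\<Sum>i\<in>I. \<mu> i *s toQ (ms i))}"
  have "P \<subseteq> {m. \<forall>j. \<bar>m $ j\<bar> \<le> (\<Sum>i\<in>I. \<bar>ms i $ j\<bar>)}"
  proof (intro subsetI CollectI allI)
    fix m j assume "m \<in> P"
    then obtain \<mu> where \<mu>: "\<And>i. i \<in> I \<Longrightarrow> 0 \<le> \<mu> i \<and> \<mu> i < 1" "toQ m = (\<Sum>i\<in>I. \<mu> i *s toQ (ms i))"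
      unfolding P_def by blast
    have "\<bar>of_int (m $ j) :: rat\<bar> = \<bar>\<Sum>i\<in>I. \<mu> i * of_int (ms i $ j)\<bar>"
      using arg_cong[OF \<mu>(2), of "\<lambda>v. v $ j"] by simp
    also have "\<dots> \<le> (\<Sum>i\<in>I. \<bar>\<mu> i * of_int (ms i $ j)\<bar>)" by (rule sum_abs)
    also have "\<dots> \<le> (\<Sum>i\<in>I. \<bar>of_int (ms i $ j)\<bar>)"
    proof (rule sum_mono)
      fix i assume "i \<in> I"
      then have "\<bar>\<mu> i\<bar> \<le> 1" using \<mu>(1)[of i] by simp
      then show "\<bar>\<mu> i * of_int (ms i $ j)\<bar> \<le> \<bar>of_int (ms i $ j)\<bar>"
        unfolding abs_mult by (rule mult_left_le_one_le[rotated 2]) auto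
    qed
    also have "\<dots> = of_int (\<Sum>i\<in>I. \<bar>ms i $ j\<bar>)" by simp
    finally show "\<bar>m $ j\<bar> \<le> (\<Sum>i\<in>I. \<bar>ms i $ j\<bar>)" by (simp only: of_int_le_iff flip: of_int_abs)
  qed
  then have finP: "finite P" using finite_bounded_int_vec by (rule finite_subset)
  \<comment> \<open>Bounds the coefficients of the integral relations for all remainders, so that
    adding \<open>N\<close> makes every exponent nonnegative.\<close>
  define N where "N = (\<Sum>m\<in>P. \<Sum>i\<in>I. nat \<bar>n m i\<bar>)"
  have N: "\<bar>n m i\<bar> \<le> int N" if "m \<in> P" "i \<in> I" for m i
  proof -
    have "nat \<bar>n m i\<bar> \<le> (\<Sum>i\<in>I. nat \<bar>n m i\<bar>)" using that finite_I by (intro member_le_sum) auto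
    also have "\<dots> \<le> N" unfolding N_def using that finP by (intro member_le_sum) auto
    finally show ?thesis by simp
  qed
  define Z where "Z = {z \<in> closed_pts A. \<exists>i\<in>I. ord_at A z (fs i) \<noteq> 0}"
  have "Z = (\<Union>i\<in>I. {z \<in> closed_pts A. ord_at A z (fs i) \<noteq> 0})" by (auto simp: Z_def)
  then have finZ: "finite Z" using finite_I finite_ord_nonzero fs_nonzero by simp
  \<comment> \<open>Rounding and the relation for the remainder change each coefficient by at most 1
    + N. The constant \<open>\<delta>\<close> makes up for the resulting loss of order, which occurs
    in \<open>Z\<close> only.\<close>
  define K where "K = (\<Sum>z\<in>Z. \<Sum>i\<in>I. (1 + N) * nat \<bar>ord_at A z (fs i)\<bar>)"
  obtain \<delta> where \<delta>: "\<delta> \<in> A" "\<delta> \<noteq> 0" "\<And>z. z \<in> Z \<Longrightarrow> ord_at A z \<delta> \<ge> int K"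
    using ex_large_ord[OF finZ, of K] unfolding Z_def by blast
  have K: "(\<Sum>i\<in>I. (1 + int N) * \<bar>ord_at A z (fs i)\<bar>) \<le> ord_at A z \<delta>" if z: "z \<in> closed_pts A" for z
  proof (cases "z \<in> Z")
    case True
    have "(\<Sum>i\<in>I. (1 + int N) * \<bar>ord_at A z (fs i)\<bar>) = int (\<Sum>i\<in>I. (1 + N) * nat \<bar>ord_at A z (fs i)\<bar>)"
      by (simp add: distrib_right)
    also have "\<dots> \<le> int K" unfolding K_def of_nat_le_iff using finZ True
      by (intro member_le_sum[of z Z "\<lambda>z. \<Sum>i\<in>I. (1 + N) * nat \<bar>ord_at A z (fs i)\<bar>"]) auto
    finally show ?thesis using \<delta>(3)[OF True] by linarith
  next
    case False
    then have "\<And>i. i \<in> I \<Longrightarrow> ord_at A z (fs i) = 0" using z by (auto simp: Z_def)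
    then show ?thesis using ord_nonneg[OF z \<delta>(1,2)] by simp
  qed
  define d where "d = Poly_Mapping.single (\<Sum>i\<in>I. int N *s ms i) (\<delta> * (\<Prod>i\<in>I. fs i ^ N))"
  have key: "d * Poly_Mapping.single m (Poly_Mapping.lookup x m) \<in> alg"
    if x: "x \<in> C" and m: "m \<in> Poly_Mapping.keys x" for x m
  proof -
    let ?y = "Poly_Mapping.lookup x m"
    have y0: "?y \<noteq> 0" using m by (simp add: in_keys_iff)
    let ?w = "d * Poly_Mapping.single m ?y"
    let ?J = "{s \<in> A. Poly_Mapping.single 0 s * ?w \<in> alg}"
    have "ideal_in A ?J" unfolding ideal_in_def
    proof (intro conjI ballI)
      show "0 \<in> ?J" using A_intros(1) subring_0[OF subring_alg] by simp
      show "s + t \<in> ?J" if "s \<in> ?J" "t \<in> ?J" for s t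
        using that A_intros(3) subring_add[OF subring_alg] by (simp add: single_add distrib_right)
      show "a * s \<in> ?J" if "a \<in> A" "s \<in> ?J" for a s
      proof -
        have "Poly_Mapping.single 0 (a * s) * ?w = Poly_Mapping.single 0 a * (Poly_Mapping.single 0 s * ?w)"
          by (simp add: mult_single flip: mult.assoc)
        then show ?thesis using that A_intros(4) subring_mult[OF subring_alg const_mem_alg] by simp
      qed
    qed auto
    then have "1 \<in> ?J"
    proof (rule ideal_eq_ring_if_not_in_maximal[OF noetherian subring])
      fix z assume "maximal_in A z"
      then have z: "z \<in> closed_pts A" by (simp add: closed_pts_def)
      let ?b = "\<lambda>i. ord_at A z (fs i)"
      obtain l where l: "\<And>i. i \<in> I \<Longrightarrow> l i \<ge> 0" "toQ m = (\<Sum>i\<in>I. l i *s toQ (ms i))"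
          "(\<Sum>i\<in>I. l i * of_int (?b i)) \<le> of_int (ord_at A z ?y)"
        using C[OF x m z] by blast
      define m' where "m' = m - (\<Sum>i\<in>I. \<lfloor>l i\<rfloor> *s ms i)"
      have "toQ m' = (\<Sum>i\<in>I. (l i - of_int \<lfloor>l i\<rfloor>) *s toQ (ms i))"
        by (simp add: m'_def toQ_linear toQ_sum l(2) vector_ssub_ldistrib vec_eq_iff left_diff_distrib sum_subtractf)
      moreover have "0 \<le> l i - of_int \<lfloor>l i\<rfloor> \<and> l i - of_int \<lfloor>l i\<rfloor> < 1" for i by linarith
      ultimately have m'P: "m' \<in> P" unfolding P_def
        by (intro CollectI exI[of _ "\<lambda>i. l i - of_int \<lfloor>l i\<rfloor>"] conjI ballI) blast+
      define e where "e i = nat (\<lfloor>l i\<rfloor> + n m' i + int N)" for i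
      have e: "int (e i) = \<lfloor>l i\<rfloor> + n m' i + int N" if "i \<in> I" for i
      proof -
        have "\<lfloor>l i\<rfloor> \<ge> 0" using l(1)[OF that] by simp
        then have "\<lfloor>l i\<rfloor> + n m' i + int N \<ge> 0" using N[OF m'P that] by linarith
        then show ?thesis by (simp add: e_def)
      qed
      have "(\<Sum>i\<in>I. int (e i) *s ms i) = (\<Sum>i\<in>I. \<lfloor>l i\<rfloor> *s ms i) + (\<Sum>i\<in>I. n m' i *s ms i) + (\<Sum>i\<in>I. int N *s ms i)"
        by (simp add: e vector_sadd_rdistrib sum.distrib)
      also have "\<dots> = (\<Sum>i\<in>I. int N *s ms i) + m" using n[of m'] by (simp add: m'_def)
      finally have deg: "(\<Sum>i\<in>I. int N *s ms i) + m = (\<Sum>i\<in>I. int (e i) *s ms i)" ..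
      \<comment> \<open>The constant left after the monomial with exponents \<open>e\<close> is
        split off. By the inequality for \<open>l\<close> the main parts of the orders cannot make
        it negative at \<open>z\<close>, and \<open>\<delta>\<close> covers the rounding
        errors.\<close>
      define q where "q = \<delta> * (\<Prod>i\<in>I. fs i ^ N) * ?y / (\<Prod>i\<in>I. fs i ^ e i)"
      have q0: "q \<noteq> 0" using \<delta>(2) y0 prod_fs_nonzero by (simp add: q_def)
      have ordp: "ord_at A z (\<Prod>i\<in>I. fs i ^ k i) = (\<Sum>i\<in>I. int (k i) * ?b i)" for k
        using fs_nonzero by (subst ord_prod[OF z]) (auto simp: ord_power[OF z] intro!: sum.cong)
      have ordq: "ord_at A z q = ord_at A z \<delta> + ord_at A z ?y + (\<Sum>i\<in>I. (int N - int (e i)) * ?b i)"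
        unfolding q_def using \<delta>(2) y0 prod_fs_nonzero
        by (simp add: ord_divide[OF z] ord_mult[OF z] ordp left_diff_distrib sum_subtractf)
      have "ord_at A z q \<ge> 0"
      proof -
        have "- (of_int (\<Sum>i\<in>I. (1 + int N) * \<bar>?b i\<bar>) :: rat) = (\<Sum>i\<in>I. - ((1 + of_nat N) * \<bar>of_int (?b i)\<bar>))"
          by (simp add: sum_negf)
        also have "\<dots> \<le> (\<Sum>i\<in>I. (l i + of_int (int N - int (e i))) * of_int (?b i))"
        proof (rule sum_mono)
          fix i assume i: "i \<in> I"
          have "l i + of_int (int N - int (e i)) = l i - of_int \<lfloor>l i\<rfloor> - of_int (n m' i)"
            using e[OF i] by simp
          moreover have "\<bar>of_int (n m' i) :: rat\<bar> \<le> of_nat N" using N[OF m'P i]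
            by (metis of_int_abs of_int_le_iff of_int_of_nat_eq)
          moreover have "0 \<le> l i - of_int \<lfloor>l i\<rfloor>" "l i - of_int \<lfloor>l i\<rfloor> < 1" by linarith+
          ultimately have "\<bar>l i + of_int (int N - int (e i))\<bar> \<le> 1 + of_nat N" by linarith
          then have "\<bar>l i + of_int (int N - int (e i))\<bar> * \<bar>of_int (?b i)\<bar> \<le> (1 + of_nat N) * \<bar>of_int (?b i)\<bar>"
            by (rule mult_right_mono) simp
          then show "- ((1 + of_nat N) * \<bar>of_int (?b i)\<bar>) \<le> (l i + of_int (int N - int (e i))) * of_int (?b i)"
            by (metis abs_le_iff abs_mult minus_le_iff)
        qed
        also have "\<dots> = (\<Sum>i\<in>I. l i * of_int (?b i)) + of_int (\<Sum>i\<in>I. (int N - int (e i)) * ?b i)"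
          by (simp add: distrib_right sum.distrib)
        also have "\<dots> \<le> of_int (ord_at A z ?y) + of_int (\<Sum>i\<in>I. (int N - int (e i)) * ?b i)"
          using l(3) by simp
        finally have "- (of_int (\<Sum>i\<in>I. (1 + int N) * \<bar>?b i\<bar>) :: rat)
            \<le> of_int (ord_at A z ?y + (\<Sum>i\<in>I. (int N - int (e i)) * ?b i))" by simp
        then have "- (\<Sum>i\<in>I. (1 + int N) * \<bar>?b i\<bar>) \<le> ord_at A z ?y + (\<Sum>i\<in>I. (int N - int (e i)) * ?b i)"
          by (simp only: of_int_le_iff flip: of_int_minus)
        then show ?thesis using K[OF z] unfolding ordq by linarith
      qed
      then obtain s where s: "s \<in> A - z" "s * q \<in> A" using ord_nonneg_iff[OF z q0] by blast
      have "Poly_Mapping.single 0 s * ?w = Poly_Mapping.single (\<Sum>i\<in>I. int (e i) *s ms i) (s * q * (\<Prod>i\<in>I. fs i ^ e i))"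
        using prod_fs_nonzero[of e] by (simp add: d_def mult_single deg q_def mult.assoc)
      then have "s \<in> ?J" using monomial_mem_alg[OF s(2), of e] s(1) by simp
      then show "\<exists>s\<in>?J. s \<notin> z" using s(1) by blast
    qed
    then show ?thesis by simp
  qed
  show ?thesis
  proof (rule that)
    show "d \<in> alg" unfolding d_def using monomial_mem_alg[OF \<delta>(1), of "\<lambda>_. N"] by simp
    show "d \<noteq> 0" unfolding d_def using \<delta>(2) prod_fs_nonzero[of "\<lambda>_. N"]
      by (intro single_nonzero) simp
    fix x assume "x \<in> C"
    have "d * x = (\<Sum>m\<in>Poly_Mapping.keys x. d * Poly_Mapping.single m (Poly_Mapping.lookup x m))"
      by (subst poly_mapping_eq_sum_single[of x]) (rule sum_distrib_left)
    then show "d * x \<in> alg" using key[OF \<open>x \<in> C\<close>] by (simp add: subring_sum subring_alg)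
  qed
qed

end

subsection \<open>Normality of the algebra of a polyhedral divisor\<close>

context monomial_valuation
begin

lemma ge_add: "ge t x \<Longrightarrow> ge t y \<Longrightarrow> ge t (x + y)"
  using ge_sum[of "{True, False}" t "\<lambda>b. if b then x else y"] by auto

lemma ge_uminus: "ge t x \<Longrightarrow> ge t (- x)"
  by (auto simp: ge_def weight_def in_keys_iff val_uminus)

lemma subring_ge_0: "subring_set {x. ge 0 x}"
  using attains_one ge_mult[of 0 _ 0] by (auto simp: subring_set_def ge_add ge_uminus attains_def ge_def[of 0 0])

end

context dedekind
begin

definition val_ring :: "'k set \<Rightarrow> rat^'n::finite \<Rightarrow> (int^'n \<Rightarrow>\<^sub>0 'k) set" where
  "val_ring z v = {x. \<forall>m\<in>Poly_Mapping.keys x. pairing m v + of_int (ord_at A z (Poly_Mapping.lookup x m)) \<ge> 0}"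

definition cone_ring :: "rat^'n::finite \<Rightarrow> (int^'n \<Rightarrow>\<^sub>0 'k) set" where
  "cone_ring v = {x. \<forall>m\<in>Poly_Mapping.keys x. pairing m v \<ge> 0}"

lemma monomial_valuation_ord:
  assumes "z \<in> closed_pts A"
  shows "monomial_valuation (\<lambda>f. of_int (ord_at A z f)) (\<lambda>m::int^'n::finite. pairing m v)"
proof
  fix a b :: 'k assume "a \<noteq> 0" "b \<noteq> 0"
  then show "rat_of_int (ord_at A z (a * b)) = of_int (ord_at A z a) + of_int (ord_at A z b)"
    by (simp add: ord_mult[OF assms])
  assume "a + b \<noteq> 0"
  then show "min (rat_of_int (ord_at A z a)) (of_int (ord_at A z b)) \<le> of_int (ord_at A z (a + b))"
    using ord_add[OF assms \<open>a \<noteq> 0\<close> \<open>b \<noteq> 0\<close>] by (auto simp: min_def split: if_splits)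
qed (simp add: pairing_eq toQ_linear pairQ_simps)

lemma monomial_valuation_cone:
  "monomial_valuation (\<lambda>f::'k. 0) (\<lambda>m::int^'n::finite. pairing m v)"
  by unfold_locales (auto simp: pairing_eq toQ_linear pairQ_simps)

lemma val_ring_eq: "z \<in> closed_pts A \<Longrightarrow>
    val_ring z v = {x. monomial_valuation.ge (\<lambda>f. of_int (ord_at A z f)) (\<lambda>m. pairing m v) 0 x}"
  by (simp add: val_ring_def add.commute monomial_valuation.ge_def[OF monomial_valuation_ord]
      monomial_valuation.weight_def[OF monomial_valuation_ord])

lemma cone_ring_eq: "cone_ring v = {x. monomial_valuation.ge (\<lambda>f. 0) (\<lambda>m. pairing m v) 0 x}"
  by (simp add: cone_ring_def monomial_valuation.ge_def[OF monomial_valuation_cone]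
      monomial_valuation.weight_def[OF monomial_valuation_cone])

lemma subring_val_ring: "z \<in> closed_pts A \<Longrightarrow> subring_set (val_ring z v)"
  unfolding val_ring_eq by (rule monomial_valuation.subring_ge_0[OF monomial_valuation_ord])

lemma subring_cone_ring: "subring_set (cone_ring v)"
  unfolding cone_ring_eq by (rule monomial_valuation.subring_ge_0[OF monomial_valuation_cone])

text \<open>One valuation condition for each vector of the cone and one for each point of each
  \<open>D z\<close>; closure properties can be checked separately for every member of the
  intersection.\<close>

lemma algD_eq: "algD A \<sigma> D = (\<Inter>v\<in>\<sigma>. cone_ring v) \<inter> (\<Inter>z\<in>closed_pts A. \<Inter>v\<in>D z. val_ring z v)"
  by (auto simp: algD_iff cone_ring_def val_ring_def dualM_def)

lemma subring_algD: "subring_set (algD A \<sigma> D)"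
proof -
  have "algD A \<sigma> D = \<Inter>(cone_ring ` \<sigma> \<union> (\<Union>z\<in>closed_pts A. val_ring z ` D z))"
    unfolding algD_eq by blast
  then show ?thesis using subring_cone_ring subring_val_ring by (auto intro!: subring_Inter)
qed

lemma normal_algD: "normal_set (algD A \<sigma> D :: (int^'n::finite \<Rightarrow>\<^sub>0 'k) set)"
  unfolding normal_set_def
proof (intro ballI impI)
  let ?C = "algD A \<sigma> D :: (int^'n \<Rightarrow>\<^sub>0 'k) set"
  fix p q assume "p \<in> ?C" "q \<in> ?C" "q \<noteq> 0 \<and> frac_integral ?C p q"
  then have pq: "q \<noteq> 0" "frac_integral ?C p q" by auto
  obtain x and N :: nat and c where x: "p = q * x"
    and c: "\<And>i. i < N \<Longrightarrow> c i \<in> ?C" "x ^ N = (\<Sum>i<N. c i * x ^ i)"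
    using laurent_integral_quotient[OF pq subring_algD] by blast
  have "x \<in> cone_ring v" if "v \<in> \<sigma>" for v
    unfolding cone_ring_eq
    using c that monomial_valuation.integral_ge_0[OF monomial_valuation_cone _ c(2)]
    unfolding algD_eq cone_ring_eq by auto
  moreover have "x \<in> val_ring z v" if z: "z \<in> closed_pts A" and v: "v \<in> D z" for z v
  proof -
    have "c i \<in> val_ring z v" if "i < N" for i using c(1)[OF that] z v unfolding algD_eq by blast
    then show ?thesis
      using monomial_valuation.integral_ge_0[OF monomial_valuation_ord[OF z] _ c(2)]
      unfolding val_ring_eq[OF z] by auto
  qed
  ultimately have "x \<in> ?C" unfolding algD_eq by blast
  then show "\<exists>a\<in>?C. p = q * a" using x by blast
qed

lemma single_mem_algD_iff:
  "c \<noteq> 0 \<Longrightarrow> Poly_Mapping.single m c \<in> algD A \<sigma> D \<longleftrightarrow> m \<in> dualM \<sigma> \<and>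
     (\<forall>z\<in>closed_pts A. \<forall>v\<in>D z. pairing m v + of_int (ord_at A z c) \<ge> 0)"
  by (simp add: algD_iff)

lemma const_mem_algD: "a \<in> A \<Longrightarrow> Poly_Mapping.single 0 a \<in> algD A \<sigma> D"
  using ord_nonneg[of _ a] by (auto simp: algD_iff dualM_0 pairing_eq toQ_linear pairQ_simps)

end

subsection \<open>Normalization of a monomial algebra\<close>

context monomial_family
begin

definition divisor :: "'k set \<Rightarrow> (rat^'n) set" where
  "divisor z = {v. \<forall>i\<in>I. pairing (ms i) v \<ge> - of_int (ord_at A z (fs i))}"

lemma divisor_iff: "v \<in> divisor z \<longleftrightarrow> (\<forall>i\<in>I. pairQ (toQ (ms i)) v + of_int (ord_at A z (fs i)) \<ge> 0)"
proof -
  have "- b \<le> a \<longleftrightarrow> a + b \<ge> 0" for a b :: rat by linarith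
  then show ?thesis by (simp add: divisor_def pairing_eq)
qed

lemma alg_subset_algD:
  assumes "\<And>i. i \<in> I \<Longrightarrow> Poly_Mapping.single (ms i) (fs i) \<in> algD A \<sigma> D"
  shows "alg \<subseteq> algD A \<sigma> D"
  unfolding alg_def using assms const_mem_algD by (intro gen_subring_least subring_algD) auto

lemma alg_subset_algD_divisor:
  assumes \<sigma>: "\<sigma> = {v. \<forall>i\<in>I. pairing (ms i) v \<ge> 0}"
  shows "alg \<subseteq> algD A \<sigma> divisor"
proof (rule alg_subset_algD)
  fix i assume i: "i \<in> I"
  then have "ms i \<in> dualM \<sigma>" by (auto simp: dualM_def \<sigma>)
  then show "Poly_Mapping.single (ms i) (fs i) \<in> algD A \<sigma> divisor"
    using fs_nonzero[OF i] i by (auto simp: single_mem_algD_iff divisor_iff pairing_eq)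
qed

text \<open>The affine Farkas lemma at each \<open>z\<close> yields the relation that
  \<open>ex_conductor\<close> asks for. Its recession condition is supplied by
  \<open>m \<in> dualM \<sigma>\<close>, so an empty \<open>divisor z\<close> is covered
  too.\<close>

theorem normalization_alg:
  assumes \<sigma>: "\<sigma> = {v. \<forall>i\<in>I. pairing (ms i) v \<ge> 0}"
  shows "is_normalization alg (algD A \<sigma> divisor)"
proof -
  have "\<exists>l::'i \<Rightarrow> rat. (\<forall>i\<in>I. l i \<ge> 0) \<and> toQ m = (\<Sum>i\<in>I. l i *s toQ (ms i))
      \<and> (\<Sum>i\<in>I. l i * of_int (ord_at A z (fs i))) \<le> of_int (ord_at A z (Poly_Mapping.lookup x m))"
    if x: "x \<in> algD A \<sigma> divisor" "m \<in> Poly_Mapping.keys x" "z \<in> closed_pts A" for x m z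
  proof -
    let ?c = "rat_of_int (ord_at A z (Poly_Mapping.lookup x m))"
    have m: "m \<in> dualM \<sigma>" "\<And>v. v \<in> divisor z \<Longrightarrow> pairQ (toQ m) v + ?c \<ge> 0"
      using x by (auto simp: algD_iff pairing_eq)
    show ?thesis
    proof (rule affine_farkas[OF finite_I, of "\<lambda>i. toQ (ms i)" "toQ m" "\<lambda>i. of_int (ord_at A z (fs i))" ?c])
      show "pairQ (toQ m) v \<ge> 0" if "\<And>i. i \<in> I \<Longrightarrow> pairQ (toQ (ms i)) v \<ge> 0" for v
        using m(1) that by (auto simp: dualM_def \<sigma> pairing_eq)
      show "pairQ (toQ m) v + ?c \<ge> 0"
        if "\<And>i. i \<in> I \<Longrightarrow> pairQ (toQ (ms i)) v + of_int (ord_at A z (fs i)) \<ge> 0" for v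
        using m(2)[of v] that by (auto simp: divisor_iff)
      fix l assume "\<And>i. i \<in> I \<Longrightarrow> 0 \<le> l i" "(\<Sum>i\<in>I. l i *s toQ (ms i)) = toQ m"
        "(\<Sum>i\<in>I. l i * of_int (ord_at A z (fs i))) \<le> ?c"
      then show ?thesis by (intro exI[of _ l]) auto
    qed
  qed
  then obtain d where "d \<in> alg" "d \<noteq> 0" "\<And>x. x \<in> algD A \<sigma> divisor \<Longrightarrow> d * x \<in> alg"
    using ex_conductor[of "algD A \<sigma> divisor"] by blast
  then show ?thesis
    by (intro normalization_conductor[OF noetherian_alg subring_alg subring_algD normal_algD alg_subset_algD_divisor[OF \<sigma>]])
qed

end

subsection \<open>Sections of a polyhedral divisor\<close>

lemma vpolyhedron_zero: "vpolyhedron \<sigma> {0} = \<sigma>"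
proof -
  have "polytope_hull {0} = {0 :: rat^'a}"
    unfolding polytope_hull_eq by (auto intro!: exI[of _ "\<lambda>_. 1"])
  then show ?thesis by (auto simp: vpolyhedron_def)
qed

locale polyhedral_divisor = dedekind A for A :: "'k::field set" +
  fixes F :: "(rat^'n::finite) set" and D :: "'k set \<Rightarrow> (rat^'n) set"
  assumes finite_F: "finite F" and divisor_D: "poly_divisor A (cone_gen F) D"
begin

abbreviation \<sigma> where "\<sigma> \<equiv> cone_gen F"

definition S where "S = {z \<in> closed_pts A. D z \<noteq> \<sigma>}"

definition V where
  "V z = (if z \<in> S then (SOME V. finite V \<and> V \<noteq> {} \<and> D z = vpolyhedron \<sigma> V) else {0})"

lemma finite_S: "finite S"
  using divisor_D by (simp add: poly_divisor_def S_def)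

lemma V: 
  assumes "z \<in> closed_pts A"
  shows "finite (V z) \<and> D z = vpolyhedron \<sigma> (V z)"
proof (cases "z \<in> S")
  case True
  have "\<exists>V. finite V \<and> V \<noteq> {} \<and> D z = vpolyhedron \<sigma> V"
    using divisor_D assms by (auto simp: poly_divisor_def sigma_polyhedron_iff)
  from someI_ex[OF this] show ?thesis using True by (simp add: V_def)
next
  case False
  then show ?thesis using assms by (simp add: V_def S_def vpolyhedron_zero)
qed

lemma D_nonneg_iff:
  assumes "z \<in> closed_pts A" "m \<in> dualM \<sigma>"
  shows "(\<forall>v\<in>D z. pairing m v + c \<ge> 0) \<longleftrightarrow> (\<forall>w\<in>V z. pairing m w + c \<ge> 0)"
  using vpolyhedron_nonneg_iff[of "V z" \<sigma> "toQ m" c] V[OF assms(1)] assms(2)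
  by (simp add: cone_gen_0 dualM_eq pairing_eq)

lemma ex_section:
  assumes z0: "z0 \<in> closed_pts A" and m: "m \<in> dualM \<sigma>" and c: "\<forall>w\<in>V z0. pairing m w + of_int c \<ge> 0"
  shows "\<exists>f. f \<noteq> 0 \<and> ord_at A z0 f = c \<and> Poly_Mapping.single m f \<in> algD A \<sigma> D"
proof -
  define n where "n = (\<Sum>z\<in>S. \<Sum>w\<in>V z. nat \<lceil>\<bar>pairing m w\<bar>\<rceil>)"
  have S: "S \<subseteq> closed_pts A" by (auto simp: S_def)
  have n: "\<bar>pairing m w\<bar> \<le> of_nat n" if "z \<in> S" "w \<in> V z" for z w
  proof -
    have "nat \<lceil>\<bar>pairing m w\<bar>\<rceil> \<le> (\<Sum>w\<in>V z. nat \<lceil>\<bar>pairing m w\<bar>\<rceil>)"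
      using V[of z] that S by (intro member_le_sum[of w "V z" "\<lambda>w. nat \<lceil>\<bar>pairing m w\<bar>\<rceil>"]) auto
    also have "\<dots> \<le> n" unfolding n_def
      using finite_S that by (intro member_le_sum[of z S "\<lambda>z. \<Sum>w\<in>V z. nat \<lceil>\<bar>pairing m w\<bar>\<rceil>"]) auto
    finally have "\<lceil>\<bar>pairing m w\<bar>\<rceil> \<le> int n" by simp
    then have "\<bar>pairing m w\<bar> \<le> of_int (int n)" by (simp only: ceiling_le_iff)
    then show ?thesis by simp
  qed
  obtain f where f: "f \<noteq> 0" "ord_at A z0 f = c"
    "\<And>z. z \<in> closed_pts A \<Longrightarrow> z \<noteq> z0 \<Longrightarrow> ord_at A z f \<ge> 0"
    "\<And>z. z \<in> S \<Longrightarrow> z \<noteq> z0 \<Longrightarrow> ord_at A z f \<ge> int n"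
    using ex_ord_prescribed[OF z0 finite_S S, of c n] by blast
  have "\<forall>w\<in>V z. pairing m w + of_int (ord_at A z f) \<ge> 0" if z: "z \<in> closed_pts A" for z
  proof (cases "z = z0")
    case True
    then show ?thesis using c f(2) by simp
  next
    case False
    show ?thesis
    proof (cases "z \<in> S")
      case True
      have "rat_of_nat n \<le> of_int (ord_at A z f)" using f(4)[OF True False] by (metis of_int_le_iff of_int_of_nat_eq)
      then show ?thesis using n[OF True] by fastforce
    next
      case S: False
      then have "V z = {0}" by (simp add: V_def)
      then show ?thesis using f(3)[OF z False] by (simp add: pairing_eq pairQ_simps)
    qed
  qed
  then have "Poly_Mapping.single m f \<in> algD A \<sigma> D"
    using f(1) m D_nonneg_iff[OF _ m] by (simp add: single_mem_algD_iff)
  then show ?thesis using f by blast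
qed

text \<open>Separating a point outside \<open>D z\<close> from \<open>D z\<close> by a lattice vector produces a section
  distinguishing the two divisors.\<close>

lemma divisor_antimono:
  assumes le: "algD A \<sigma> D \<subseteq> algD A \<sigma> D'" and z: "z \<in> closed_pts A"
  shows "D' z \<subseteq> D z"
proof
  fix v assume v: "v \<in> D' z"
  show "v \<in> D z"
  proof (rule ccontr)
    assume "v \<notin> D z"
    then have "v \<notin> vpolyhedron \<sigma> (V z)" using V[OF z] by simp
    then obtain u c where uc: "u \<in> dualQ \<sigma>" "pairQ u v + c < 0" "\<And>w. w \<in> V z \<Longrightarrow> pairQ u w + c \<ge> 0"
      using vpolyhedron_separation[of "V z" F v] V[OF z] finite_F by blast
    obtain k M where kM: "k > (0::nat)" "of_nat k *s homog u c = toQ M" using ex_int_multiple_vec by blast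
    define m where "m = (\<chi> i. M $ Some i)"
    define j where "j = M $ None"
    have m: "toQ m = of_nat k *s u" using arg_cong[OF kM(2), of dehomog] by (simp add: vec_eq_iff m_def)
    have j: "of_int j = of_nat k * c" using arg_cong[OF kM(2), of "\<lambda>x. x $ None"] by (simp add: j_def)
    have eq: "pairing m w + of_int j = of_nat k * (pairQ u w + c)" for w
      by (simp add: pairing_eq m j pairQ_simps distrib_left)
    have "m \<in> dualM \<sigma>" using uc(1) by (simp add: dualM_eq m dualQ_def pairQ_simps)
    moreover have "\<forall>w\<in>V z. pairing m w + of_int j \<ge> 0" using uc(3) by (simp add: eq)
    ultimately obtain f where f: "f \<noteq> 0" "ord_at A z f = j" "Poly_Mapping.single m f \<in> algD A \<sigma> D"
      using ex_section[OF z] by blast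
    then have "Poly_Mapping.single m f \<in> algD A \<sigma> D'" using le by blast
    then have "pairing m v + of_int j \<ge> 0" using f z v by (auto simp: single_mem_algD_iff)
    then have "pairQ u v + c \<ge> 0" using kM(1) by (simp add: eq zero_le_mult_iff)
    then show False using uc(2) by simp
  qed
qed

lemma ex_section_any: "m \<in> dualM \<sigma> \<Longrightarrow> \<exists>f. f \<noteq> 0 \<and> Poly_Mapping.single m f \<in> algD A \<sigma> D"
proof -
  assume m: "m \<in> dualM \<sigma>"
  obtain z where z: "z \<in> closed_pts A" using closed_pts_nonempty by blast
  define n where "n = (\<Sum>w\<in>V z. nat \<lceil>\<bar>pairing m w\<bar>\<rceil>)"
  have "\<forall>w\<in>V z. pairing m w + of_int (int n) \<ge> 0"
  proof
    fix w assume "w \<in> V z"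
    then have "nat \<lceil>\<bar>pairing m w\<bar>\<rceil> \<le> n" unfolding n_def
      using V[OF z] by (intro member_le_sum[of w "V z" "\<lambda>w. nat \<lceil>\<bar>pairing m w\<bar>\<rceil>"]) auto
    then have "\<lceil>\<bar>pairing m w\<bar>\<rceil> \<le> int n" by simp
    then have "\<bar>pairing m w\<bar> \<le> of_int (int n)" by (simp only: ceiling_le_iff)
    then show "pairing m w + of_int (int n) \<ge> 0" by linarith
  qed
  then show ?thesis using ex_section[OF z m] by blast
qed

end

lemma sum_extend_by_zero:
  assumes "finite I" "inj_on \<phi> E" "\<phi> ` E \<subseteq> I" and h: "\<And>p. h 0 p = (0 :: 'c::comm_monoid_add)"
  shows "(\<Sum>p\<in>I. h (if p \<in> \<phi> ` E then l (the_inv_into E \<phi> p) else 0) p) = (\<Sum>e\<in>E. h (l e) (\<phi> e))"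
proof -
  have "(\<Sum>p\<in>I. h (if p \<in> \<phi> ` E then l (the_inv_into E \<phi> p) else 0) p)
      = (\<Sum>p\<in>\<phi> ` E. h (l (the_inv_into E \<phi> p)) p)"
    using assms by (intro sum.mono_neutral_cong_right) auto
  also have "\<dots> = (\<Sum>e\<in>E. h (l e) (\<phi> e))"
    using assms(2) by (simp add: sum.reindex the_inv_into_f_f)
  finally show ?thesis .
qed

context polyhedral_divisor
begin

text \<open>The monomials \<open>g\<chi>\<^sup>m\<close> used here realise, at each of the finitely many special points \<open>z\<close>, integral generators
  \<open>(m, c)\<close> of the cone \<open>h\<^bsub>D z\<^esub>(m) + c \<ge> 0\<close>, with \<open>ord\<^bsub>z\<^esub> g = c\<close>. At all other points the first family
  consists of units, so its degrees only have to generate the dual cone.\<close>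

theorem noetherian_same_frac:
  assumes sc: "strongly_convex \<sigma>"
  shows "noetherian_set (algD A \<sigma> D) \<and> same_frac (algD A \<sigma> D)"
proof -
  let ?C = "algD A \<sigma> D"
  obtain M0 where M0: "finite M0" "M0 \<subseteq> dualM \<sigma>" "\<And>m. \<exists>c. m = (\<Sum>x\<in>M0. c x *s x)"
    using dualM_generates_lattice[OF finite_F sc] by blast
  obtain E0 where E0: "finite E0" "\<And>m c. (m, c) \<in> E0 \<Longrightarrow> m \<in> dualM \<sigma>"
    "\<And>m c. m \<in> dualM \<sigma> \<Longrightarrow> (\<forall>w\<in>{0}. pairing m w + of_int c \<ge> 0) \<Longrightarrow>
      \<exists>l. (\<forall>e\<in>E0. l e \<ge> 0) \<and> toQ m = (\<Sum>e\<in>E0. l e *s toQ (fst e)) \<and> of_int c = (\<Sum>e\<in>E0. l e * of_int (snd e))"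
    by (rule hypograph_generators[of "{0}" F]) (use finite_F in auto)
  define G0 where "G0 = E0 \<union> M0 \<times> {0}"
  have finG0: "finite G0" using E0(1) M0(1) by (simp add: G0_def)
  have "\<exists>f. f \<noteq> 0 \<and> Poly_Mapping.single (fst e) f \<in> ?C" if "e \<in> G0" for e
  proof -
    have "fst e \<in> dualM \<sigma>" using that E0(2)[of "fst e" "snd e"] M0(2) by (auto simp: G0_def)
    then show ?thesis by (rule ex_section_any)
  qed
  then obtain g0 where g0: "\<And>e. e \<in> G0 \<Longrightarrow> g0 e \<noteq> 0 \<and> Poly_Mapping.single (fst e) (g0 e) \<in> ?C" by metis
  define T where "T = S \<union> (\<Union>e\<in>G0. {z \<in> closed_pts A. ord_at A z (g0 e) \<noteq> 0})"
  have finT: "finite T" unfolding T_def using finite_S finG0 g0 finite_ord_nonzero by auto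
  have T: "z \<in> closed_pts A" if "z \<in> T" for z using that by (auto simp: T_def S_def)
  define gens where "gens z E \<longleftrightarrow> finite E
      \<and> (\<forall>e\<in>E. fst e \<in> dualM \<sigma> \<and> (\<forall>w\<in>V z. pairing (fst e) w + of_int (snd e) \<ge> 0))
      \<and> (\<forall>m c. m \<in> dualM \<sigma> \<longrightarrow> (\<forall>w\<in>V z. pairing m w + of_int c \<ge> 0) \<longrightarrow>
        (\<exists>l. (\<forall>e\<in>E. l e \<ge> 0) \<and> toQ m = (\<Sum>e\<in>E. l e *s toQ (fst e)) \<and> of_int c = (\<Sum>e\<in>E. l e * of_int (snd e))))"
    for z and E :: "((int^'n) \<times> int) set"
  have "\<exists>E. gens z E" if "z \<in> T" for z
  proof (rule hypograph_generators[of "V z" F])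
    show "finite (V z)" using V T that by blast
    fix E :: "((int^'n) \<times> int) set"
    assume h: "finite E" "\<And>m c. (m, c) \<in> E \<Longrightarrow> m \<in> dualM \<sigma> \<and> (\<forall>w\<in>V z. pairing m w + of_int c \<ge> 0)"
    "\<And>m c. m \<in> dualM \<sigma> \<Longrightarrow> (\<forall>w\<in>V z. pairing m w + of_int c \<ge> 0) \<Longrightarrow>
      \<exists>l. (\<forall>e\<in>E. l e \<ge> 0) \<and> toQ m = (\<Sum>e\<in>E. l e *s toQ (fst e)) \<and> of_int c = (\<Sum>e\<in>E. l e * of_int (snd e))"
    have "gens z E" unfolding gens_def
    proof (intro conjI allI impI)
      show "finite E" by (rule h(1))
      show "\<forall>e\<in>E. fst e \<in> dualM \<sigma> \<and> (\<forall>w\<in>V z. pairing (fst e) w + of_int (snd e) \<ge> 0)"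
        using h(2) by (metis prod.collapse)
    qed (rule h(3))
    then show ?thesis by blast
  qed (rule finite_F)
  then obtain E where gens: "\<And>z. z \<in> T \<Longrightarrow> gens z (E z)" by metis
  have E: "finite (E z)" "\<And>e. e \<in> E z \<Longrightarrow> fst e \<in> dualM \<sigma> \<and> (\<forall>w\<in>V z. pairing (fst e) w + of_int (snd e) \<ge> 0)"
    "\<And>m c. m \<in> dualM \<sigma> \<Longrightarrow> (\<forall>w\<in>V z. pairing m w + of_int c \<ge> 0) \<Longrightarrow>
      \<exists>l. (\<forall>e\<in>E z. l e \<ge> 0) \<and> toQ m = (\<Sum>e\<in>E z. l e *s toQ (fst e)) \<and> of_int c = (\<Sum>e\<in>E z. l e * of_int (snd e))"
    if "z \<in> T" for z
    using gens[OF that] by (simp_all add: gens_def)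
  have "\<exists>f. f \<noteq> 0 \<and> ord_at A z f = snd e \<and> Poly_Mapping.single (fst e) f \<in> ?C" if "z \<in> T" "e \<in> E z" for z e
    using ex_section[OF T[OF that(1)], of "fst e" "snd e"] E(2)[OF that] by blast
  then obtain g where g: "\<And>z e. z \<in> T \<Longrightarrow> e \<in> E z \<Longrightarrow>
      g z e \<noteq> 0 \<and> ord_at A z (g z e) = snd e \<and> Poly_Mapping.single (fst e) (g z e) \<in> ?C" by metis
  define I where "I = (\<lambda>e. (e, g0 e)) ` G0 \<union> (\<Union>z\<in>T. (\<lambda>e. (e, g z e)) ` E z)"
  have finI: "finite I" using finG0 finT E(1) by (simp add: I_def)
  have gen: "\<exists>c. m = (\<Sum>p\<in>I. c p *s fst (fst p))" for m
  proof -
    obtain c where c: "m = (\<Sum>x\<in>M0. c x *s x)" using M0(3) by blast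
    let ?\<phi> = "\<lambda>x. ((x, 0), g0 (x, 0))"
    have "?\<phi> ` M0 \<subseteq> I" by (auto simp: I_def G0_def)
    then have "(\<Sum>p\<in>I. (if p \<in> ?\<phi> ` M0 then c (the_inv_into M0 ?\<phi> p) else 0) *s fst (fst p)) = m"
      using sum_extend_by_zero[OF finI, of ?\<phi> M0 "\<lambda>a p. a *s fst (fst p)" c] c by (simp add: inj_on_def)
    then show ?thesis
      by (intro exI[of _ "\<lambda>p. if p \<in> ?\<phi> ` M0 then c (the_inv_into M0 ?\<phi> p) else 0"]) (rule sym)
  qed
  interpret mf: monomial_family A I snd "\<lambda>p. fst (fst p)"
  proof
    show "finite I" by (rule finI)
    show "snd p \<noteq> 0" if "p \<in> I" for p using that g g0 by (auto simp: I_def)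
    show "\<exists>c. m = (\<Sum>p\<in>I. c p *s fst (fst p))" for m by (rule gen)
  qed
  have sub: "mf.alg \<subseteq> ?C"
  proof (rule mf.alg_subset_algD)
    fix p assume "p \<in> I"
    then show "Poly_Mapping.single (fst (fst p)) (snd p) \<in> ?C" using g g0 by (auto simp: I_def)
  qed
  have cond: "\<exists>l. (\<forall>p\<in>I. l p \<ge> 0) \<and> toQ m = (\<Sum>p\<in>I. l p *s toQ (fst (fst p)))
      \<and> (\<Sum>p\<in>I. l p * of_int (ord_at A z (snd p))) \<le> of_int (ord_at A z (Poly_Mapping.lookup x m))"
    if x: "x \<in> ?C" "m \<in> Poly_Mapping.keys x" "z \<in> closed_pts A" for x m z
  proof -
    let ?c = "ord_at A z (Poly_Mapping.lookup x m)"
    have m: "m \<in> dualM \<sigma>" and D: "\<forall>v\<in>D z. pairing m v + of_int ?c \<ge> 0"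
      using x by (auto simp: algD_iff)
    have *: ?thesis
      if X: "\<phi> ` X \<subseteq> I" "inj_on \<phi> X" "\<And>e. e \<in> X \<Longrightarrow> fst (\<phi> e) = e"
        and l: "\<forall>e\<in>X. l e \<ge> 0" "toQ m = (\<Sum>e\<in>X. l e *s toQ (fst e))"
          "(\<Sum>e\<in>X. l e * of_int (ord_at A z (snd (\<phi> e)))) \<le> of_int ?c" for \<phi> X and l :: "_ \<Rightarrow> rat"
    proof -
      let ?l = "\<lambda>p. if p \<in> \<phi> ` X then l (the_inv_into X \<phi> p) else 0"
      have "\<forall>p\<in>I. ?l p \<ge> 0" using l(1) X(2) by (auto simp: the_inv_into_f_f)
      moreover have "(\<Sum>p\<in>I. ?l p *s toQ (fst (fst p))) = toQ m"
        using sum_extend_by_zero[OF finI X(2,1), of "\<lambda>a p. a *s toQ (fst (fst p))" l] l(2) X(3)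
        by (simp cong: sum.cong)
      moreover have "(\<Sum>p\<in>I. ?l p * of_int (ord_at A z (snd p))) = (\<Sum>e\<in>X. l e * of_int (ord_at A z (snd (\<phi> e))))"
        using sum_extend_by_zero[OF finI X(2,1), of "\<lambda>a p. a * of_int (ord_at A z (snd p))" l] by simp
      ultimately show ?thesis using l(3) by (intro exI[of _ ?l]) auto
    qed
    show ?thesis
    proof (cases "z \<in> T")
      case True
      have "\<forall>w\<in>V z. pairing m w + of_int ?c \<ge> 0" using D D_nonneg_iff[OF x(3) m] by blast
      then obtain l where l: "\<forall>e\<in>E z. l e \<ge> 0" "toQ m = (\<Sum>e\<in>E z. l e *s toQ (fst e))"
          "rat_of_int ?c = (\<Sum>e\<in>E z. l e * of_int (snd e))" using E(3)[OF True m] by blast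
      show ?thesis
      proof (rule *[of "\<lambda>e. (e, g z e)" "E z"])
        show "(\<lambda>e. (e, g z e)) ` E z \<subseteq> I" using True by (auto simp: I_def)
        show "(\<Sum>e\<in>E z. l e * of_int (ord_at A z (snd (e, g z e)))) \<le> of_int ?c"
          using l(3) g[OF True] by (simp cong: sum.cong)
      qed (use l in \<open>auto simp: inj_on_def\<close>)
    next
      case False
      then have "D z = \<sigma>" using x(3) by (auto simp: T_def S_def)
      then have "\<forall>w\<in>{0}. pairing m w + of_int ?c \<ge> 0" using D cone_gen_0 by auto
      then obtain l where l: "\<forall>e\<in>E0. l e \<ge> 0" "toQ m = (\<Sum>e\<in>E0. l e *s toQ (fst e))" using E0(3)[OF m] by blast
      have "?c \<ge> 0" using \<open>\<forall>w\<in>{0}. _\<close> by (simp add: pairing_eq pairQ_simps)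
      show ?thesis
      proof (rule *[of "\<lambda>e. (e, g0 e)" E0])
        show "(\<lambda>e. (e, g0 e)) ` E0 \<subseteq> I" by (auto simp: I_def G0_def)
        have "ord_at A z (g0 e) = 0" if "e \<in> E0" for e using False that x(3) by (auto simp: T_def G0_def)
        then show "(\<Sum>e\<in>E0. l e * of_int (ord_at A z (snd (e, g0 e)))) \<le> of_int ?c"
          using \<open>?c \<ge> 0\<close> by (simp cong: sum.cong)
      qed (use l in \<open>auto simp: inj_on_def\<close>)
    qed
  qed
  obtain d where d: "d \<in> mf.alg" "d \<noteq> 0" "\<And>x. x \<in> ?C \<Longrightarrow> d * x \<in> mf.alg"
    using mf.ex_conductor[of ?C] cond by blast
  have "noetherian_set ?C"
    using noetherian_conductor[OF mf.noetherian_alg mf.subring_alg subring_algD sub _ d(2,3)] d(1) sub by blast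
  moreover have "same_frac ?C" using mf.same_frac_alg sub unfolding same_frac_def by (meson subsetD)
  ultimately show ?thesis by blast
qed

end

subsection \<open>Finite generation of graded Noetherian algebras\<close>

definition conformal :: "int \<Rightarrow> int \<Rightarrow> bool" where
  "conformal a b \<longleftrightarrow> (0 \<le> a \<and> a \<le> b) \<or> (b \<le> a \<and> a \<le> 0)"

lemma conformal_subsequence_incr:
  fixes s :: "nat \<Rightarrow> int"
  assumes "\<And>i j. i \<le> j \<Longrightarrow> s i \<le> s j"
  shows "\<exists>N. \<forall>i j. i \<le> j \<longrightarrow> conformal (s (i + N)) (s (j + N))"
proof (cases "\<exists>N. s N \<ge> 0")
  case True
  then obtain N where N: "s N \<ge> 0" by blast
  then have "0 \<le> s (i + N)" for i using assms[of N "i + N"] by simp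
  then show ?thesis using assms by (intro exI[of _ N]) (auto simp: conformal_def)
next
  case False
  obtain N where N: "\<And>n. nat (- s N) \<le> nat (- s n)"
    using ex_has_least_nat[of "\<lambda>_. True" 0 "\<lambda>n. nat (- s n)"] by auto
  have "s (i + N) = s N" for i
    using assms[of N "i + N"] N[of "i + N"] False by (auto simp: not_le nat_le_eq_zle dest: less_imp_le)
  then show ?thesis using False by (intro exI[of _ N]) (auto simp: conformal_def not_le intro: less_imp_le)
qed

lemma conformal_subsequence:
  fixes s :: "nat \<Rightarrow> int"
  shows "\<exists>r::nat \<Rightarrow> nat. strict_mono r \<and> (\<forall>i j. i \<le> j \<longrightarrow> conformal (s (r i)) (s (r j)))"
proof -
  obtain f :: "nat \<Rightarrow> nat" where f: "strict_mono f" "monoseq (\<lambda>n. s (f n))"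
    using seq_monosub[of s] by blast
  have shift: "strict_mono (\<lambda>i. f (i + N))" for N
    using f(1) by (simp add: strict_mono_def)
  from f(2) consider "\<And>i j. i \<le> j \<Longrightarrow> s (f i) \<le> s (f j)" | "\<And>i j. i \<le> j \<Longrightarrow> s (f j) \<le> s (f i)"
    unfolding monoseq_def by blast
  then show ?thesis
  proof cases
    case 1
    then show ?thesis using conformal_subsequence_incr[of "\<lambda>n. s (f n)"] shift by blast
  next
    case 2
    then have "\<exists>N. \<forall>i j. i \<le> j \<longrightarrow> conformal (- s (f (i + N))) (- s (f (j + N)))"
      by (intro conformal_subsequence_incr) auto
    moreover have "conformal (- a) (- b) \<longleftrightarrow> conformal a b" for a b by (auto simp: conformal_def)
    ultimately show ?thesis using shift by auto
  qed
qed

lemma conformal_subsequence_vec: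
  fixes s :: "nat \<Rightarrow> int^'n::finite"
  obtains r :: "nat \<Rightarrow> nat" where "strict_mono r" "\<And>i j k. i \<le> j \<Longrightarrow> conformal (s (r i) $ k) (s (r j) $ k)"
proof -
  have "\<exists>r::nat \<Rightarrow> nat. strict_mono r \<and> (\<forall>k\<in>K. \<forall>i j. i \<le> j \<longrightarrow> conformal (s (r i) $ k) (s (r j) $ k))" for K
    using finite[of K]
  proof (induction K rule: finite_induct)
    case empty
    show ?case by (intro exI[of _ id]) (auto simp: strict_mono_def)
  next
    case (insert k K)
    then obtain r :: "nat \<Rightarrow> nat" where r: "strict_mono r"
        "\<forall>k\<in>K. \<forall>i j. i \<le> j \<longrightarrow> conformal (s (r i) $ k) (s (r j) $ k)" by blast
    obtain q :: "nat \<Rightarrow> nat" where q: "strict_mono q"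
        "\<forall>i j. i \<le> j \<longrightarrow> conformal (s (r (q i)) $ k) (s (r (q j)) $ k)"
      using conformal_subsequence[of "\<lambda>n. s (r n) $ k"] by blast
    have "strict_mono (\<lambda>i. r (q i))" using r(1) q(1) by (simp add: strict_mono_def)
    moreover have "q i \<le> q j" if "i \<le> j" for i j using q(1) that by (simp add: strict_mono_less_eq)
    ultimately show ?case using r(2) q(2) by (intro exI[of _ "\<lambda>i. r (q i)"]) auto
  qed
  from this[of UNIV] show ?thesis using that by blast
qed

text \<open>A sequence of monomials of minimal degree outside the subalgebra generated by the previous ones
  has a subsequence with conformal degrees. The Noetherian property expresses some term through the earlier
  ones, with homogeneous coefficients of smaller degree by conformality, contradicting minimality.\<close>

theorem graded_noetherian_finitely_generated:
  fixes R :: "(int^'n::finite \<Rightarrow>\<^sub>0 'k::field) set"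
  assumes R: "subring_set R" and graded: "\<forall>f\<in>R. \<forall>m. Poly_Mapping.single m (Poly_Mapping.lookup f m) \<in> R"
    and noetherian: "noetherian_set R"
  obtains G :: "((int^'n) \<times> 'k) set" where "finite G" "\<And>p. p \<in> G \<Longrightarrow> Poly_Mapping.single (fst p) (snd p) \<in> R"
    "R = gen_subring (Poly_Mapping.single 0 ` {c. Poly_Mapping.single 0 c \<in> R} \<union> (\<lambda>p. Poly_Mapping.single (fst p) (snd p)) ` G)"
proof (rule ccontr)
  assume no: "\<not> thesis"
  note witness = that
  define mono where "mono p = Poly_Mapping.single (fst p) (snd p)" for p :: "(int^'n) \<times> 'k"
  define gen where "gen G = gen_subring (Poly_Mapping.single 0 ` {c. Poly_Mapping.single 0 c \<in> R} \<union> mono ` G)" for G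
  define U where "U = {p. mono p \<in> R}"
  define deg where "deg m = (\<Sum>i\<in>UNIV. nat \<bar>m $ i\<bar>)" for m :: "int^'n"
  define Q where "Q G p \<longleftrightarrow> mono p \<notin> gen G \<and> (\<forall>q\<in>U. mono q \<notin> gen G \<longrightarrow> deg (fst p) \<le> deg (fst q))" for G p
  have sub_gen: "subring_set (gen G)" for G by (simp add: gen_def subring_gen_subring)
  have "\<exists>p\<in>U. Q G p" if G: "finite G" "G \<subseteq> U" for G
  proof -
    have "gen G \<subseteq> R" unfolding gen_def using G(2) by (intro gen_subring_least R) (auto simp: U_def)
    moreover have "gen G \<noteq> R"
      using no witness[of G] G unfolding gen_def mono_def U_def by blast
    ultimately obtain x where x: "x \<in> R" "x \<notin> gen G" by blast
    have "\<exists>m. Poly_Mapping.single m (Poly_Mapping.lookup x m) \<notin> gen G"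
    proof (rule ccontr)
      assume "\<not> ?thesis"
      then have "(\<Sum>m\<in>Poly_Mapping.keys x. Poly_Mapping.single m (Poly_Mapping.lookup x m)) \<in> gen G"
        by (intro subring_sum sub_gen) blast
      then show False using x(2) poly_mapping_eq_sum_single[of x] by simp
    qed
    then obtain m where m: "Poly_Mapping.single m (Poly_Mapping.lookup x m) \<notin> gen G" by blast
    have ex: "(m, Poly_Mapping.lookup x m) \<in> U \<and> mono (m, Poly_Mapping.lookup x m) \<notin> gen G"
      using m x(1) graded by (simp add: U_def mono_def)
    show ?thesis
      using ex_has_least_nat[of "\<lambda>p. p \<in> U \<and> mono p \<notin> gen G", OF ex, of "\<lambda>p. deg (fst p)"]
      unfolding Q_def by blast
  qed
  then obtain p :: "nat \<Rightarrow> (int^'n) \<times> 'k" where pU: "\<And>n. p n \<in> U" and pQ: "\<And>n. Q (p ` {..<n}) (p n)"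
    using sequence_avoiding_previous[of U Q] by blast
  obtain r :: "nat \<Rightarrow> nat" where r: "strict_mono r"
    "\<And>i j k. i \<le> j \<Longrightarrow> conformal (fst (p (r i)) $ k) (fst (p (r j)) $ k)"
    using conformal_subsequence_vec[of "\<lambda>n. fst (p n)"] by blast
  have "mono (p (r n)) \<in> R" for n using pU by (auto simp: U_def)
  then obtain N :: nat and c where c: "\<And>i. i < N \<Longrightarrow> c i \<in> R"
      "mono (p (r N)) = (\<Sum>i<N. c i * mono (p (r i)))"
    using noetherian_sequence[OF noetherian R, of "\<lambda>n. mono (p (r n))"] by blast
  let ?G = "p ` {..<r N}" and ?m = "fst (p (r N))"
  define a where "a i = Poly_Mapping.single (?m - fst (p (r i))) (Poly_Mapping.lookup (c i) (?m - fst (p (r i))))" for i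
  have eq_a: "mono (p (r N)) = (\<Sum>i<N. a i * mono (p (r i)))"
  proof -
    have "snd (p (r N)) = Poly_Mapping.lookup (mono (p (r N))) ?m" by (simp add: mono_def)
    also have "\<dots> = (\<Sum>i<N. Poly_Mapping.lookup (c i * mono (p (r i))) ?m)" by (subst c(2)) (rule lookup_sum)
    also have "\<dots> = (\<Sum>i<N. snd (p (r i)) * Poly_Mapping.lookup (c i) (?m - fst (p (r i))))"
      by (simp add: mono_def mult.commute[of "c _"] lookup_single_mult)
    finally have eq: "snd (p (r N)) = (\<Sum>i<N. snd (p (r i)) * Poly_Mapping.lookup (c i) (?m - fst (p (r i))))" .
    have single_sum: "Poly_Mapping.single ?m (\<Sum>i<N. h i) = (\<Sum>i<N. Poly_Mapping.single ?m (h i))" for h :: "nat \<Rightarrow> 'k"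
      by (rule poly_mapping_eqI) (simp add: lookup_sum lookup_single when_def)
    have "mono (p (r N)) = Poly_Mapping.single ?m (snd (p (r N)))" by (simp add: mono_def)
    also have "\<dots> = (\<Sum>i<N. a i * mono (p (r i)))"
      unfolding eq single_sum by (simp add: a_def mono_def mult_single mult.commute)
    finally show ?thesis .
  qed
  have mem: "a i * mono (p (r i)) \<in> gen ?G" if i: "i < N" for i
  proof (rule subring_mult[OF sub_gen])
    have ri: "r i < r N" using r(1) i by (simp add: strict_mono_def)
    then show "mono (p (r i)) \<in> gen ?G" unfolding gen_def by (intro gen_subring_mem) auto
    show "a i \<in> gen ?G"
    proof (rule ccontr)
      assume "a i \<notin> gen ?G"
      moreover have "a i \<in> R" using c(1)[OF i] graded by (simp add: a_def)
      ultimately have le: "deg ?m \<le> deg (?m - fst (p (r i)))"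
        using pQ[of "r N"] unfolding Q_def U_def by (auto simp: a_def mono_def dest: bspec)
      have split: "nat \<bar>?m $ k\<bar> = nat \<bar>(?m - fst (p (r i))) $ k\<bar> + nat \<bar>fst (p (r i)) $ k\<bar>" for k
        using r(2)[of i N k] i by (auto simp: conformal_def)
      have "deg ?m = deg (?m - fst (p (r i))) + deg (fst (p (r i)))"
        unfolding deg_def sum.distrib[symmetric] by (intro sum.cong refl split)
      then have "deg (fst (p (r i))) = 0" using le by simp
      then have "fst (p (r i)) = 0" by (simp add: deg_def vec_eq_iff)
      then have "mono (p (r i)) \<in> gen (p ` {..<r i})"
        using pU[of "r i"] unfolding gen_def by (intro gen_subring_mem) (auto simp: U_def mono_def)
      then show False using pQ[of "r i"] by (simp add: Q_def)
    qed
  qed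
  have "mono (p (r N)) \<in> gen ?G"
    unfolding eq_a by (rule subring_sum[OF sub_gen]) (use mem in simp)
  then show False using pQ[of "r N"] by (simp add: Q_def)
qed

subsection \<open>Existence of the polyhedral divisor\<close>

lemma ex_common_denominator:
  assumes "finite I" "\<And>i. i \<in> I \<Longrightarrow> l i \<ge> (0::rat)"
  shows "\<exists>k::nat. k > 0 \<and> (\<exists>e::'i \<Rightarrow> nat. \<forall>i\<in>I. of_nat k * l i = of_nat (e i))"
  using assms
proof (induction I rule: finite_induct)
  case empty
  show ?case by (intro exI[of _ 1]) auto
next
  case (insert i I)
  then obtain k e where k: "k > (0::nat)" "\<And>j. j \<in> I \<Longrightarrow> of_nat k * l j = of_nat (e j :: nat)" by auto
  obtain k' j where k': "k' > (0::nat)" "of_nat k' * l i = of_int j" using ex_int_multiple by blast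
  have "rat_of_int j \<ge> 0" using k'(2)[symmetric] insert.prems[of i] by simp
  then have j: "of_nat k' * l i = of_nat (nat j)" using k'(2) by simp
  define e' where "e' = (e(i := 0))"
  have "of_nat (k * k') * l x = of_nat (if x = i then k * nat j else k' * e x)" if "x \<in> insert i I" for x
  proof (cases "x = i")
    case True
    then show ?thesis using j by (simp add: mult.assoc)
  next
    case False
    then have "of_nat k * l x = of_nat (e x)" using k(2) that by simp
    then show ?thesis using False by (simp add: mult.commute mult.left_commute)
  qed
  moreover have "k * k' > 0" using k(1) k'(1) by simp
  ultimately show ?case
    by (intro exI[of _ "k * k'"] conjI exI[of _ "\<lambda>x. if x = i then k * nat j else k' * e x"] ballI)
qed

lemma keys_gen_subring:
  fixes ms :: "'i \<Rightarrow> int^'n::finite" and fs :: "'i \<Rightarrow> 'k::field"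
  assumes I: "finite I"
    and x: "x \<in> gen_subring (Poly_Mapping.single 0 ` A \<union> (\<lambda>i. Poly_Mapping.single (ms i) (fs i)) ` I)"
      "m \<in> Poly_Mapping.keys x"
  shows "\<exists>e. m = (\<Sum>i\<in>I. int (e i) *s ms i)"
proof -
  define M where "M = {m. \<exists>e. m = (\<Sum>i\<in>I. int (e i) *s ms i)}"
  have add: "a + b \<in> M" if ab: "a \<in> M" "b \<in> M" for a b
  proof -
    obtain e e' where "a = (\<Sum>i\<in>I. int (e i) *s ms i)" "b = (\<Sum>i\<in>I. int (e' i) *s ms i)"
      using ab unfolding M_def by blast
    then have "a + b = (\<Sum>i\<in>I. int (e i + e' i) *s ms i)"
      by (simp add: vector_sadd_rdistrib sum.distrib)
    then show ?thesis unfolding M_def by (intro CollectI exI[of _ "\<lambda>i. e i + e' i"])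
  qed
  have zero: "0 \<in> M" unfolding M_def by (intro CollectI exI[of _ "\<lambda>_. 0"]) simp
  have gen: "ms i \<in> M" if "i \<in> I" for i
  proof -
    have "(\<Sum>j\<in>I. int (if j = i then 1 else 0) *s ms j) = (\<Sum>j\<in>I. if j = i then ms j else 0)"
      by (intro sum.cong) auto
    also have "\<dots> = ms i" using that I by simp
    finally have "ms i = (\<Sum>j\<in>I. int (if j = i then 1 else 0) *s ms j)" ..
    then show ?thesis unfolding M_def by (intro CollectI exI[of _ "\<lambda>j. if j = i then 1 else 0"])
  qed
  let ?R = "{x :: int^'n \<Rightarrow>\<^sub>0 'k. Poly_Mapping.keys x \<subseteq> M}"
  have "subring_set ?R"
    unfolding subring_set_def
  proof (intro conjI ballI)
    show "0 \<in> ?R" by simp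
    show "1 \<in> ?R" using zero by simp
    fix x y assume xy: "x \<in> ?R" "y \<in> ?R"
    show "x + y \<in> ?R" using xy Poly_Mapping.keys_add[of x y] by blast
    show "x * y \<in> ?R" using xy keys_mult[of x y] add by blast
    show "- x \<in> ?R" using xy by (simp add: subset_iff in_keys_iff)
  qed
  moreover have "Poly_Mapping.single 0 ` A \<union> (\<lambda>i. Poly_Mapping.single (ms i) (fs i)) ` I \<subseteq> ?R"
    using zero gen by (auto split: if_splits)
  ultimately have "gen_subring (Poly_Mapping.single 0 ` A \<union> (\<lambda>i. Poly_Mapping.single (ms i) (fs i)) ` I) \<subseteq> ?R"
    by (rule gen_subring_least)
  then show ?thesis using x unfolding M_def by blast
qed

lemma (in dedekind) ex_polyhedral_divisor:
  fixes R :: "(int^'n::finite \<Rightarrow>\<^sub>0 'k) set"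
  assumes R: "subring_set R" "normal_set R" "noetherian_set R" "same_frac R"
    and graded: "\<forall>f\<in>R. \<forall>m. Poly_Mapping.single m (Poly_Mapping.lookup f m) \<in> R"
    and deg0: "{c. Poly_Mapping.single 0 c \<in> R} = A"
    and weight: "cone_gen {toQ m | m. \<exists>f\<in>R. Poly_Mapping.lookup f m \<noteq> 0} = dualQ (cone_gen F)"
    and F: "finite F"
  shows "\<exists>D. poly_divisor A (cone_gen F) D \<and> R = algD A (cone_gen F) D"
proof -
  obtain G :: "((int^'n) \<times> 'k) set" where G: "finite G" "\<And>p. p \<in> G \<Longrightarrow> Poly_Mapping.single (fst p) (snd p) \<in> R"
    "R = gen_subring (Poly_Mapping.single 0 ` {c. Poly_Mapping.single 0 c \<in> R} \<union> (\<lambda>p. Poly_Mapping.single (fst p) (snd p)) ` G)"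
    by (rule graded_noetherian_finitely_generated[OF R(1) graded R(3)]) (rule that)
  define I where "I = {p\<in>G. snd p \<noteq> 0}"
  let ?mono = "\<lambda>p. Poly_Mapping.single (fst p) (snd p)"
  have RI: "R = gen_subring (Poly_Mapping.single 0 ` A \<union> ?mono ` I)"
  proof
    have "?mono ` G \<subseteq> gen_subring (Poly_Mapping.single 0 ` A \<union> ?mono ` I)"
    proof (rule image_subsetI)
      fix p assume p: "p \<in> G"
      show "?mono p \<in> gen_subring (Poly_Mapping.single 0 ` A \<union> ?mono ` I)"
      proof (cases "snd p = 0")
        case True
        then show ?thesis using subring_0[OF subring_gen_subring] by simp
      next
        case False
        then show ?thesis using p by (intro gen_subring_mem) (auto simp: I_def)
      qed
    qed
    then have "gen_subring (Poly_Mapping.single 0 ` A \<union> ?mono ` G) \<subseteq> gen_subring (Poly_Mapping.single 0 ` A \<union> ?mono ` I)"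
      by (intro gen_subring_least subring_gen_subring) (auto intro: gen_subring_mem)
    then show "R \<subseteq> gen_subring (Poly_Mapping.single 0 ` A \<union> ?mono ` I)" using G(3) unfolding deg0 by simp
    show "gen_subring (Poly_Mapping.single 0 ` A \<union> ?mono ` I) \<subseteq> R"
      using G(2) deg0 by (intro gen_subring_least R(1)) (auto simp: I_def)
  qed
  have finI: "finite I" using G(1) by (simp add: I_def)
  have keysR: "\<exists>e. m = (\<Sum>p\<in>I. int (e p) *s fst p)" if "x \<in> R" "m \<in> Poly_Mapping.keys x" for x m
    using keys_gen_subring[OF finI, of x A fst snd m] that RI by simp
  have gen: "\<exists>c. m = (\<Sum>p\<in>I. c p *s fst p)" for m
  proof -
    obtain a b where ab: "a \<in> R" "b \<in> R" "b \<noteq> 0" "b * Poly_Mapping.single m 1 = a"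
      using R(4) unfolding same_frac_def by blast
    then obtain k where k: "k \<in> Poly_Mapping.keys b" by (metis keys_eq_empty ex_in_conv)
    have "Poly_Mapping.lookup a (m + k) = Poly_Mapping.lookup b k"
      using lookup_single_mult[of m 1 b "m + k"] ab(4) by (simp add: mult.commute)
    then have "m + k \<in> Poly_Mapping.keys a" using k by (simp add: in_keys_iff)
    then obtain e e' where e: "m + k = (\<Sum>p\<in>I. int (e p) *s fst p)" "k = (\<Sum>p\<in>I. int (e' p) *s fst p)"
      using keysR[OF ab(1)] keysR[OF ab(2) k] by blast
    have "m = (\<Sum>p\<in>I. int (e p) *s fst p) - (\<Sum>p\<in>I. int (e' p) *s fst p)"
      using e by (metis add_diff_cancel_right')
    also have "\<dots> = (\<Sum>p\<in>I. (int (e p) - int (e' p)) *s fst p)"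
      by (simp add: vec_eq_iff left_diff_distrib sum_subtractf)
    finally show ?thesis by (intro exI[of _ "\<lambda>p. int (e p) - int (e' p)"])
  qed
  interpret mf: monomial_family A I snd fst
    by unfold_locales (use finI gen in \<open>auto simp: I_def\<close>)
  have alg: "mf.alg = R" unfolding mf.alg_def RI[symmetric] ..
  let ?W = "{toQ m | m. \<exists>f\<in>R. Poly_Mapping.lookup f m \<noteq> 0}"
  have \<sigma>: "cone_gen F = {v. \<forall>p\<in>I. pairing (fst p) v \<ge> 0}"
  proof -
    have "dualQ (cone_gen ?W) = cone_gen F" unfolding weight by (rule dualQ_dualQ[OF F])
    then have "cone_gen F = {v. \<forall>w\<in>?W. pairQ v w \<ge> 0}" unfolding dualQ_cone_gen by (rule sym)
    also have "\<dots> = {v. \<forall>p\<in>I. pairing (fst p) v \<ge> 0}"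
    proof (intro set_eqI iffI CollectI ballI)
      fix v p assume v: "v \<in> {v. \<forall>w\<in>?W. pairQ v w \<ge> 0}" and p: "p \<in> I"
      have "?mono p \<in> R" "Poly_Mapping.lookup (?mono p) (fst p) \<noteq> 0" using p G(2) by (auto simp: I_def)
      then have "toQ (fst p) \<in> ?W" by blast
      then have "pairQ v (toQ (fst p)) \<ge> 0" using v by blast
      then show "pairing (fst p) v \<ge> 0" by (simp add: pairing_eq pairQ_commute)
    next
      fix v w assume v: "v \<in> {v. \<forall>p\<in>I. pairing (fst p) v \<ge> 0}" and "w \<in> ?W"
      then obtain m f where m: "w = toQ m" "f \<in> R" "m \<in> Poly_Mapping.keys f" by (auto simp: in_keys_iff)
      then obtain e where "m = (\<Sum>p\<in>I. int (e p) *s fst p)" using keysR by blast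
      then have "pairQ v w = (\<Sum>p\<in>I. of_nat (e p) * pairing (fst p) v)"
        by (simp add: m(1) toQ_sum toQ_linear pairQ_simps pairing_eq pairQ_commute)
      then show "pairQ v w \<ge> 0" using v by (simp add: sum_nonneg)
    qed
    finally show ?thesis .
  qed
  have "R = algD A (cone_gen F) mf.divisor"
  proof
    show "R \<subseteq> algD A (cone_gen F) mf.divisor" using mf.alg_subset_algD_divisor[OF \<sigma>] alg by simp
    show "algD A (cone_gen F) mf.divisor \<subseteq> R"
    proof
      fix x assume "x \<in> algD A (cone_gen F) mf.divisor"
      then obtain p q where pq: "p \<in> R" "q \<in> R" "q \<noteq> 0" "q * x = p" "frac_integral R p q"
        using mf.normalization_alg[OF \<sigma>] unfolding alg is_normalization_def by blast
      then obtain a where "a \<in> R" "p = q * a" using R(2) unfolding normal_set_def by blast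
      then show "x \<in> R" using laurent_mult_cancel[OF pq(3), of x a] pq(4) by simp
    qed
  qed
  moreover have "poly_divisor A (cone_gen F) mf.divisor"
    unfolding poly_divisor_def
  proof (intro conjI ballI)
    fix z assume z: "z \<in> closed_pts A"
    let ?b = "\<lambda>p. rat_of_int (ord_at A z (snd p))"
    have eq: "mf.divisor z = {v. \<forall>p\<in>I. pairQ (toQ (fst p)) v \<ge> - ?b p}"
      by (simp add: mf.divisor_def pairing_eq)
    have "mf.divisor z \<noteq> {}"
    proof
      assume empty: "mf.divisor z = {}"
      have "\<exists>l. (\<forall>p\<in>I. l p \<ge> 0) \<and> (\<Sum>p\<in>I. l p *s toQ (fst p)) = 0 \<and> (\<Sum>p\<in>I. l p * ?b p) \<le> - 1"
      proof (rule affine_farkas[OF finI, of "\<lambda>p. toQ (fst p)" 0 ?b "- 1"])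
        show "pairQ 0 v + - 1 \<ge> 0" if "\<And>p. p \<in> I \<Longrightarrow> pairQ (toQ (fst p)) v + ?b p \<ge> 0" for v
          using empty that mf.divisor_iff[of v z] by auto
        fix l assume "\<And>p. p \<in> I \<Longrightarrow> 0 \<le> l p" "(\<Sum>p\<in>I. l p *s toQ (fst p)) = 0" "(\<Sum>p\<in>I. l p * ?b p) \<le> - 1"
        then show ?thesis by (intro exI[of _ l]) auto
      qed (simp add: pairQ_simps)
      then obtain l where l: "\<And>p. p \<in> I \<Longrightarrow> l p \<ge> 0" "(\<Sum>p\<in>I. l p *s toQ (fst p)) = 0" "(\<Sum>p\<in>I. l p * ?b p) \<le> - 1"
        by blast
      obtain k e where k: "k > (0::nat)" "\<And>p. p \<in> I \<Longrightarrow> of_nat k * l p = of_nat (e p)"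
        using ex_common_denominator[OF finI, of l] l(1) by blast
      have "toQ (\<Sum>p\<in>I. int (e p) *s fst p) = (\<Sum>p\<in>I. (of_nat k * l p) *s toQ (fst p))"
        by (simp add: toQ_sum toQ_linear k(2))
      also have "\<dots> = of_nat k *s (\<Sum>p\<in>I. l p *s toQ (fst p))"
        by (simp add: vec_eq_iff sum_distrib_left mult.assoc)
      finally have "toQ (\<Sum>p\<in>I. int (e p) *s fst p) = toQ 0" using l(2) by (simp add: toQ_linear)
      then have "(\<Sum>p\<in>I. int (e p) *s fst p) = 0" unfolding toQ_inj .
      then have "Poly_Mapping.single 0 (\<Prod>p\<in>I. snd p ^ e p) \<in> R"
        using mf.monomial_mem_alg[OF A_intros(2), of e] alg by simp
      then have "(\<Prod>p\<in>I. snd p ^ e p) \<in> A" using deg0 by blast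
      then have "ord_at A z (\<Prod>p\<in>I. snd p ^ e p) \<ge> 0" using ord_nonneg[OF z] mf.prod_fs_nonzero by blast
      moreover have "ord_at A z (\<Prod>p\<in>I. snd p ^ e p) = (\<Sum>p\<in>I. int (e p) * ord_at A z (snd p))"
        using mf.fs_nonzero by (subst ord_prod[OF z]) (auto simp: ord_power[OF z] intro!: sum.cong)
      ultimately have "0 \<le> rat_of_int (\<Sum>p\<in>I. int (e p) * ord_at A z (snd p))"
        by (simp only: of_int_0_le_iff)
      also have "\<dots> = (\<Sum>p\<in>I. of_nat k * l p * ?b p)" by (simp add: k(2))
      also have "\<dots> = of_nat k * (\<Sum>p\<in>I. l p * ?b p)" by (simp add: sum_distrib_left mult.assoc)
      finally have "0 \<le> (\<Sum>p\<in>I. l p * ?b p)" using k(1) by (simp add: zero_le_mult_iff)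
      then show False using l(3) by simp
    qed
    then show "sigma_polyhedron (cone_gen F) (mf.divisor z)"
      unfolding eq using \<sigma> by (intro halfspaces_sigma_polyhedron finI) (auto simp: pairing_eq)
  next
    have "mf.divisor z = cone_gen F" if "\<forall>p\<in>I. ord_at A z (snd p) = 0" for z
      unfolding mf.divisor_def \<sigma> using that by (intro Collect_cong ball_cong) simp_all
    then have "{z \<in> closed_pts A. mf.divisor z \<noteq> cone_gen F} \<subseteq> (\<Union>p\<in>I. {z \<in> closed_pts A. ord_at A z (snd p) \<noteq> 0})"
      by blast
    moreover have "finite (\<Union>p\<in>I. {z \<in> closed_pts A. ord_at A z (snd p) \<noteq> 0})"
      using finI finite_ord_nonzero mf.fs_nonzero by auto
    ultimately show "finite {z \<in> closed_pts A. mf.divisor z \<noteq> cone_gen F}" by (rule finite_subset)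
  qed
  ultimately show ?thesis by blast
qed


theorem theorem4p4p4:
  fixes A0 :: "'k::field set" and \<sigma> :: "(rat^'n::finite) set"
  assumes "dedekind_set A0"
    and "\<forall>x::'k. \<exists>a\<in>A0. \<exists>b\<in>A0. b \<noteq> 0 \<and> x = a / b"
    and "polyhedral_cone \<sigma>" and "strongly_convex \<sigma>"
  shows "(\<forall>D. poly_divisor A0 \<sigma> D \<longrightarrow>
            normal_set (algD A0 \<sigma> D) \<and> noetherian_set (algD A0 \<sigma> D) \<and> same_frac (algD A0 \<sigma> D))
   \<and> (\<forall>A :: (int^'n \<Rightarrow>\<^sub>0 'k) set.
        subring_set A
        \<and> (\<forall>f\<in>A. \<forall>m. Poly_Mapping.single m (Poly_Mapping.lookup f m) \<in> A)
        \<and> (\<forall>f\<in>A. \<forall>m. Poly_Mapping.lookup f m \<noteq> 0 \<longrightarrow> m \<in> dualM \<sigma>)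
        \<and> {c. Poly_Mapping.single 0 c \<in> A} = A0
        \<and> cone_gen {toQ m | m. \<exists>f\<in>A. Poly_Mapping.lookup f m \<noteq> 0} = dualQ \<sigma>
        \<and> normal_set A \<and> noetherian_set A \<and> same_frac A
      \<longrightarrow> (\<exists>D. poly_divisor A0 \<sigma> D \<and> A = algD A0 \<sigma> D
              \<and> (\<forall>D'. poly_divisor A0 \<sigma> D' \<and> A = algD A0 \<sigma> D' \<longrightarrow>
                      (\<forall>z\<in>closed_pts A0. D' z = D z))))
   \<and> (\<forall>(r::nat) (fs :: nat \<Rightarrow> 'k) (ms :: nat \<Rightarrow> int^'n).
        (\<forall>i<r. fs i \<noteq> 0 \<and> ms i \<noteq> 0)
        \<and> (\<forall>m. \<exists>c::nat \<Rightarrow> int. m = (\<chi> j. \<Sum>i<r. c i * ms i $ j))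
        \<and> \<sigma> = dualN (cone_gen {toQ (ms i) | i. i < r})
      \<longrightarrow> is_normalization
            (gen_subring ((\<lambda>a. Poly_Mapping.single 0 a) ` A0
                          \<union> {Poly_Mapping.single (ms i) (fs i) | i. i < r}))
            (algD A0 \<sigma> (\<lambda>z. {v. \<forall>i<r. pairing (ms i) v \<ge> - of_int (ord_at A0 z (fs i))})))"
proof -
  interpret dedekind A0 using assms(1,2) by unfold_locales
  obtain F where F: "finite F" "\<sigma> = cone_gen F" using assms(3) unfolding polyhedral_cone_def by blast
  have part1: "normal_set (algD A0 \<sigma> D) \<and> noetherian_set (algD A0 \<sigma> D) \<and> same_frac (algD A0 \<sigma> D)"
    if "poly_divisor A0 \<sigma> D" for D
  proof -
    interpret polyhedral_divisor A0 F D using F that by unfold_locales auto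
    show ?thesis using noetherian_same_frac assms(4) normal_algD unfolding F(2) by blast
  qed
  have part2: "\<exists>D. poly_divisor A0 \<sigma> D \<and> A = algD A0 \<sigma> D
      \<and> (\<forall>D'. poly_divisor A0 \<sigma> D' \<and> A = algD A0 \<sigma> D' \<longrightarrow> (\<forall>z\<in>closed_pts A0. D' z = D z))"
    if A: "subring_set A" "\<forall>f\<in>A. \<forall>m. Poly_Mapping.single m (Poly_Mapping.lookup f m) \<in> A"
      "{c. Poly_Mapping.single 0 c \<in> A} = A0"
      "cone_gen {toQ m | m. \<exists>f\<in>A. Poly_Mapping.lookup f m \<noteq> 0} = dualQ \<sigma>"
      "normal_set A" "noetherian_set A" "same_frac A" for A :: "(int^'n \<Rightarrow>\<^sub>0 'k) set"
  proof -
    obtain D where D: "poly_divisor A0 \<sigma> D" "A = algD A0 \<sigma> D"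
      using ex_polyhedral_divisor[OF A(1,5,6,7,2,3) _ F(1)] A(4) unfolding F(2) by blast
    have "D' z = D z" if D': "poly_divisor A0 \<sigma> D'" "A = algD A0 \<sigma> D'" and z: "z \<in> closed_pts A0" for D' z
    proof -
      interpret D: polyhedral_divisor A0 F D using F D(1) by unfold_locales auto
      interpret D': polyhedral_divisor A0 F D' using F D'(1) by unfold_locales auto
      show ?thesis
        using D.divisor_antimono[of D', OF _ z] D'.divisor_antimono[of D, OF _ z] D(2) D'(2) F(2) by auto
    qed
    then show ?thesis using D by blast
  qed
  have part3: "is_normalization
            (gen_subring ((\<lambda>a. Poly_Mapping.single 0 a) ` A0
                          \<union> {Poly_Mapping.single (ms i) (fs i) | i. i < r}))
            (algD A0 \<sigma> (\<lambda>z. {v. \<forall>i<r. pairing (ms i) v \<ge> - of_int (ord_at A0 z (fs i))}))"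
    if nz: "\<forall>i<r. fs i \<noteq> 0 \<and> ms i \<noteq> 0"
      and gen: "\<forall>m. \<exists>c::nat \<Rightarrow> int. m = (\<chi> j. \<Sum>i<r. c i * ms i $ j)"
      and \<sigma>: "\<sigma> = dualN (cone_gen {toQ (ms i) | i. i < r})"
    for r :: nat and fs :: "nat \<Rightarrow> 'k" and ms :: "nat \<Rightarrow> int^'n"
  proof -
    have gen': "\<exists>c. m = (\<Sum>i<r. c i *s ms i)" for m
    proof -
      obtain c where "m = (\<chi> j. \<Sum>i<r. c i * ms i $ j)" using gen by blast
      then show ?thesis by (intro exI[of _ c]) (simp add: vec_eq_iff)
    qed
    interpret mf: monomial_family A0 "{..<r}" fs ms
      using nz gen' by unfold_locales auto
    have "\<sigma> = {v. \<forall>i\<in>{..<r}. pairing (ms i) v \<ge> 0}"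
      unfolding \<sigma> dualN_eq_dualQ dualQ_cone_gen by (auto simp: pairing_eq pairQ_commute)
    then have "is_normalization mf.alg (algD A0 \<sigma> mf.divisor)" by (rule mf.normalization_alg)
    moreover have "{Poly_Mapping.single (ms i) (fs i) | i. i < r} = (\<lambda>i. Poly_Mapping.single (ms i) (fs i)) ` {..<r}"
      by auto
    moreover have "mf.divisor = (\<lambda>z. {v. \<forall>i<r. pairing (ms i) v \<ge> - of_int (ord_at A0 z (fs i))})"
      by (auto simp: mf.divisor_def)
    ultimately show ?thesis by (simp add: mf.alg_def)
  qed
  show ?thesis
  proof (intro conjI, goal_cases)
    case 1
    show ?case using part1 by blast
  next
    case 2
    show ?case by (intro allI impI, elim conjE) (rule part2)
  next
    case 3
    show ?case by (intro allI impI, elim conjE) (rule part3)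
  qed
qed

end
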